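(* Let $K$ be an algebraic number field with ring of integers $R$ and let $\mathcal{P}$ be the set of prime ideals of $R$. The correspondence $\omega_{r,a}\mapsto Z(a)$ induces a homeomorphism of the quasi-orbit space for the action of $K\rtimes K^*$ on $\Omega_{\mathbb{A}_f}$ onto the power set $2^{\mathcal{P}}$ with the power-cofinite topology.
   Context: Notation. "Prime ideal" means nonzero prime ideal of $R$, and $K^*=K\setminus\{0\}$. $\mathbb{A}_f$ is the locally compact ring of finite adeles of $K$ ($K$ is embedded diagonally), $\hat R\subseteq\mathbb{A}_f$ is its maximal compact subring of integral adeles, and $\hat R^*$ is the group of invertible elements of $\hat R$. $K\rtimes K^*$ is the group with product $(x,k)(y,l)=(x+ky,kl)$. The space. $\Omega_{\mathbb{A}_f}$ is the quotient topological space of $\mathbb{A}_f\times\mathbb{A}_f$ by the equivalence relation $(r,a)\sim(s,b)\iff a\hat R^*=b\hat R^*$ and $r-s\in a\hat R$. The class of $(r,a)$ is denoted $\omega_{r,a}$. The group $K\rtimes K^*$ acts on $\Omega_{\mathbb{A}_f}$ by $(x,k)\cdot\omega_{r,a}=\omega_{x+kr,ka}$. For $a\in\mathbb{A}_f$ put $Z(a)=\{P\in\mathcal{P}: a_P=0\}$, where $a_P$ is the component of $a$ in the completion $K_P$; this depends only on the class $\omega_{r,a}$. Quasi-orbits. If a group $G$ acts on a topological space $X$, the quasi-orbit space is the quotient space $X/\!\sim$ (with the quotient topology) by the equivalence relation $x\sim y\iff\overline{Gx}=\overline{Gy}$. The power-cofinite topology on $2^{\mathcal{P}}$ has as basic open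 sets $U_F=\{T\in 2^{\mathcal{P}}: T\cap F=\emptyset\}$, indexed by the finite subsets $F\subseteq\mathcal{P}$. *)

theory Defs
  imports
    "HOL-Analysis.Abstract_Metric_Spaces"
    "HOL-Computational_Algebra.Polynomial"
    "HOL-Algebra.QuotRing"
    "HOL-Algebra.Ideal_Product"
    "HOL-Algebra.Group_Action"
begin

section \<open>Number fields, rings of integers, prime ideals\<close>

definition number_field :: "'k::field_char_0 itself \<Rightarrow> bool" where
  "number_field _ \<longleftrightarrow>
     (\<exists>B::'k set. finite B \<and> module.span (\<lambda>(q::rat) (x::'k). of_rat q * x) B = UNIV)"

definition integer_ring :: "'k::field_char_0 ring" where
  "integer_ring = \<lparr>carrier = {x. algebraic_int x}, mult = (*), one = 1, zero = 0, add = (+)\<rparr>"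

definition prime_ideals :: "'k::field_char_0 set set" where
  "prime_ideals = {P. primeideal P integer_ring \<and> P \<noteq> {0}}"


section \<open>The completion at a prime ideal\<close>

text \<open>For nonzero \<open>x\<close> in the ring of integers, the exponent of \<open>P\<close> in the ideal generated by
  \<open>x\<close> is the largest \<open>n\<close> such that \<open>x\<close> lies in the ideal power \<open>P\<^sup>n\<close>.\<close>

definition int_valuation :: "'k::field_char_0 set \<Rightarrow> 'k \<Rightarrow> nat" where
  "int_valuation P x = (GREATEST n::nat. x \<in> P [^]\<^bsub>ideals_set integer_ring\<^esub> n)"

definition valuation :: "'k::field_char_0 set \<Rightarrow> 'k \<Rightarrow> int" where
  "valuation P x = (THE v. \<exists>a b. algebraic_int a \<and> algebraic_int b \<and> a \<noteq> 0 \<and> b \<noteq> 0 \<and>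
     x = a / b \<and> v = int (int_valuation P a) - int (int_valuation P b))"

text \<open>The base 2 is one of many equivalent normalisations: neither the completion, nor its
  topology, nor its unit ball depends on the choice.\<close>

definition abs_val :: "'k::field_char_0 set \<Rightarrow> 'k \<Rightarrow> real" where
  "abs_val P x = (if x = 0 then 0 else 2 powi (- valuation P x))"

definition cauchy_ring :: "'k::field_char_0 set \<Rightarrow> (nat \<Rightarrow> 'k) ring" where
  "cauchy_ring P = \<lparr>
     carrier = {x. \<forall>e>0. \<exists>N. \<forall>m\<ge>N. \<forall>n\<ge>N. abs_val P (x m - x n) < e},
     mult = (\<lambda>x y n. x n * y n), one = (\<lambda>n. 1), zero = (\<lambda>n. 0), add = (\<lambda>x y n. x n + y n)\<rparr>"

definition null_sequences :: "'k::field_char_0 set \<Rightarrow> (nat \<Rightarrow> 'k) set" where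
  "null_sequences P = {x. (\<lambda>n. abs_val P (x n)) \<longlonglongrightarrow> 0}"

definition completion :: "'k::field_char_0 set \<Rightarrow> (nat \<Rightarrow> 'k) set ring" where
  "completion P = cauchy_ring P Quot null_sequences P"

definition embed :: "'k::field_char_0 set \<Rightarrow> 'k \<Rightarrow> (nat \<Rightarrow> 'k) set" where
  "embed P x = null_sequences P +>\<^bsub>cauchy_ring P\<^esub> (\<lambda>n. x)"

definition completion_abs :: "'k::field_char_0 set \<Rightarrow> (nat \<Rightarrow> 'k) set \<Rightarrow> real" where
  "completion_abs P c = (THE l. \<exists>x\<in>c. (\<lambda>n. abs_val P (x n)) \<longlonglongrightarrow> l)"

text \<open>The locale \<^locale>\<open>Metric_space\<close> wants symmetry and nonnegativity of the distance on the
  whole type, hence the dummy value outside of the carrier.\<close>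

definition completion_dist ::
    "'k::field_char_0 set \<Rightarrow> (nat \<Rightarrow> 'k) set \<Rightarrow> (nat \<Rightarrow> 'k) set \<Rightarrow> real" where
  "completion_dist P c d =
     (if c \<in> carrier (completion P) \<and> d \<in> carrier (completion P)
      then completion_abs P (c \<ominus>\<^bsub>completion P\<^esub> d) else 0)"

definition completion_top :: "'k::field_char_0 set \<Rightarrow> (nat \<Rightarrow> 'k) set topology" where
  "completion_top P = Metric_space.mtopology (carrier (completion P)) (completion_dist P)"

definition completion_integers :: "'k::field_char_0 set \<Rightarrow> (nat \<Rightarrow> 'k) set set" where
  "completion_integers P = {c \<in> carrier (completion P). completion_abs P c \<le> 1}"


section \<open>Finite adeles\<close>

type_synonym 'k adele = "'k set \<Rightarrow> (nat \<Rightarrow> 'k) set"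

definition finite_adeles :: "'k::field_char_0 adele ring" where
  "finite_adeles = \<lparr>
     carrier = {a \<in> (\<Pi>\<^sub>E P\<in>prime_ideals. carrier (completion P)).
                  finite {P \<in> prime_ideals. a P \<notin> completion_integers P}},
     mult = (\<lambda>a b. \<lambda>P\<in>prime_ideals. a P \<otimes>\<^bsub>completion P\<^esub> b P),
     one = (\<lambda>P\<in>prime_ideals. \<one>\<^bsub>completion P\<^esub>),
     zero = (\<lambda>P\<in>prime_ideals. \<zero>\<^bsub>completion P\<^esub>),
     add = (\<lambda>a b. \<lambda>P\<in>prime_ideals. a P \<oplus>\<^bsub>completion P\<^esub> b P)\<rparr>"

text \<open>Restricted product topology with respect to the subrings \<^const>\<open>completion_integers\<close>.\<close>

definition adele_top :: "'k::field_char_0 adele topology" where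
  "adele_top = topology_generated_by
     {Pi\<^sub>E prime_ideals U | U. (\<forall>P\<in>prime_ideals. openin (completion_top P) (U P)) \<and>
        finite {P \<in> prime_ideals. U P \<noteq> completion_integers P}}"

definition integral_adeles :: "'k::field_char_0 adele set" where
  "integral_adeles = (\<Pi>\<^sub>E P\<in>prime_ideals. completion_integers P)"

definition integral_adele_units :: "'k::field_char_0 adele set" where
  "integral_adele_units = Units (finite_adeles\<lparr>carrier := integral_adeles\<rparr>)"

definition diag :: "'k::field_char_0 \<Rightarrow> 'k adele" where
  "diag x = (\<lambda>P\<in>prime_ideals. embed P x)"

definition zero_primes :: "'k::field_char_0 adele \<Rightarrow> 'k set set" where
  "zero_primes a = {P \<in> prime_ideals. a P = \<zero>\<^bsub>completion P\<^esub>}"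


section \<open>Quotient spaces and quasi-orbit spaces\<close>

definition quotient_topology :: "'a topology \<Rightarrow> ('a \<times> 'a) set \<Rightarrow> 'a set topology" where
  "quotient_topology X r =
     topology (\<lambda>U. U \<subseteq> topspace X // r \<and> openin X {x \<in> topspace X. r `` {x} \<in> U})"

lemma openin_quotient_topology:
  "openin (quotient_topology X r) U \<longleftrightarrow>
     U \<subseteq> topspace X // r \<and> openin X {x \<in> topspace X. r `` {x} \<in> U}"
proof -
  have "istopology (\<lambda>U. U \<subseteq> topspace X // r \<and> openin X {x \<in> topspace X. r `` {x} \<in> U})"
    unfolding istopology_def
  proof (rule conjI; intro allI impI)
    fix S T
    assume S: "S \<subseteq> topspace X // r \<and> openin X {x \<in> topspace X. r `` {x} \<in> S}"
      and T: "T \<subseteq> topspace X // r \<and> openin X {x \<in> topspace X. r `` {x} \<in> T}"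
    have "{x \<in> topspace X. r `` {x} \<in> S \<inter> T} =
        {x \<in> topspace X. r `` {x} \<in> S} \<inter> {x \<in> topspace X. r `` {x} \<in> T}" by blast
    moreover have "openin X \<dots>" using S T by (intro openin_Int) blast+
    ultimately show "S \<inter> T \<subseteq> topspace X // r \<and> openin X {x \<in> topspace X. r `` {x} \<in> S \<inter> T}"
      using S by (simp only:) blast
  next
    fix \<K>
    assume K: "\<forall>S\<in>\<K>. S \<subseteq> topspace X // r \<and> openin X {x \<in> topspace X. r `` {x} \<in> S}"
    have "{x \<in> topspace X. r `` {x} \<in> \<Union>\<K>} = (\<Union>S\<in>\<K>. {x \<in> topspace X. r `` {x} \<in> S})"
      by blast
    moreover have "openin X \<dots>" using K by (intro openin_Union) blast
    ultimately show "\<Union>\<K> \<subseteq> topspace X // r \<and> openin X {x \<in> topspace X. r `` {x} \<in> \<Union>\<K>}"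
      using K by (simp only:) blast
  qed
  then show ?thesis by (simp only: quotient_topology_def topology_inverse')
qed

lemma topspace_quotient_topology: "topspace (quotient_topology X r) = topspace X // r"
proof (rule subset_antisym)
  have "{x \<in> topspace X. r `` {x} \<in> topspace X // r} = topspace X"
    by (blast intro: quotientI)
  then have "openin (quotient_topology X r) (topspace X // r)"
    by (simp add: openin_quotient_topology)
  then show "topspace X // r \<subseteq> topspace (quotient_topology X r)" by (rule openin_subset)
  show "topspace (quotient_topology X r) \<subseteq> topspace X // r"
    using openin_topspace[of "quotient_topology X r"] unfolding openin_quotient_topology by (rule conjunct1)
qed

lemma quotient_map_quotient_topology:
  "quotient_map X (quotient_topology X r) (\<lambda>x. r `` {x})"
proof -
  have "(\<lambda>x. r `` {x}) ` topspace X = topspace X // r"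
    unfolding quotient_def by blast
  then show ?thesis
    by (simp only: quotient_map_def topspace_quotient_topology openin_quotient_topology) blast
qed

definition quasi_orbit_rel ::
    "('g, 'm) monoid_scheme \<Rightarrow> ('g \<Rightarrow> 'a \<Rightarrow> 'a) \<Rightarrow> 'a topology \<Rightarrow> ('a \<times> 'a) set" where
  "quasi_orbit_rel G \<phi> X = {(x, y). x \<in> topspace X \<and> y \<in> topspace X \<and>
     X closure_of (orbit G \<phi> x) = X closure_of (orbit G \<phi> y)}"

definition quasi_orbit_space ::
    "('g, 'm) monoid_scheme \<Rightarrow> ('g \<Rightarrow> 'a \<Rightarrow> 'a) \<Rightarrow> 'a topology \<Rightarrow> 'a set topology" where
  "quasi_orbit_space G \<phi> X = quotient_topology X (quasi_orbit_rel G \<phi> X)"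

definition power_cofinite_top :: "'a set \<Rightarrow> 'a set topology" where
  "power_cofinite_top A =
     topology_generated_by {{T \<in> Pow A. T \<inter> F = {}} | F. finite F \<and> F \<subseteq> A}"


section \<open>The space \<open>\<Omega>\<close> and the action of the affine group\<close>

definition Omega_rel :: "(('k::field_char_0 adele \<times> 'k adele) \<times> ('k adele \<times> 'k adele)) set" where
  "Omega_rel = {((r, a), (s, b)).
     r \<in> carrier finite_adeles \<and> a \<in> carrier finite_adeles \<and>
     s \<in> carrier finite_adeles \<and> b \<in> carrier finite_adeles \<and>
     a <#\<^bsub>finite_adeles\<^esub> integral_adele_units = b <#\<^bsub>finite_adeles\<^esub> integral_adele_units \<and>
     r \<ominus>\<^bsub>finite_adeles\<^esub> s \<in> a <#\<^bsub>finite_adeles\<^esub> integral_adeles}"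

definition Omega_top :: "('k::field_char_0 adele \<times> 'k adele) set topology" where
  "Omega_top = quotient_topology (prod_topology adele_top adele_top) Omega_rel"

definition omega :: "'k::field_char_0 adele \<Rightarrow> 'k adele \<Rightarrow> ('k adele \<times> 'k adele) set" where
  "omega r a = Omega_rel `` {(r, a)}"

definition affine_group :: "('k::field_char_0 \<times> 'k) monoid" where
  "affine_group = \<lparr>carrier = UNIV \<times> (UNIV - {0}),
     mult = (\<lambda>(x, k) (y, l). (x + k * y, k * l)), one = (0, 1)\<rparr>"

lemma group_affine_group: "group (affine_group :: ('k::field_char_0 \<times> 'k) monoid)"
proof (rule groupI)
  fix g :: "'k \<times> 'k"
  assume g: "g \<in> carrier affine_group"
  obtain x k where [simp]: "g = (x, k)" by force
  from g show "\<exists>h\<in>carrier affine_group. h \<otimes>\<^bsub>affine_group\<^esub> g = \<one>\<^bsub>affine_group\<^esub>"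
    by (intro bexI[of _ "(- (x / k), 1 / k)"]) (simp_all add: affine_group_def)
qed (auto simp: affine_group_def algebra_simps)

text \<open>The action on a class, computed on its representatives: all members of the union coincide.\<close>

definition affine_action ::
    "'k::field_char_0 \<times> 'k \<Rightarrow> ('k adele \<times> 'k adele) set \<Rightarrow> ('k adele \<times> 'k adele) set" where
  "affine_action = (\<lambda>(x, k) C. \<Union>(r, a)\<in>C.
     omega (diag x \<oplus>\<^bsub>finite_adeles\<^esub> (diag k \<otimes>\<^bsub>finite_adeles\<^esub> r)) (diag k \<otimes>\<^bsub>finite_adeles\<^esub> a))"

end

theory Submission
  imports Defs "Jordan_Normal_Form.Char_Poly"
begin

text \<open>The closure of the orbit of \<open>\<omega>\<^sub>r\<^sub>,\<^sub>a\<close> consists of the \<open>\<omega>\<^sub>s\<^sub>,\<^sub>b\<close> with \<open>Z(a) \<subseteq> Z(b)\<close>. Nonvanishing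
  of a component is an open condition and is preserved by the action, which gives one inclusion.
  For the other one, strong approximation yields \<open>k \<in> K\<^sup>*\<close> with prescribed absolute values at finitely
  many primes and integral elsewhere, so that \<open>k a u\<close> is close to \<open>b\<close> for a suitable unit \<open>u\<close>; then
  density of \<open>K\<close> in the finite adeles moves \<open>k r\<close> close to \<open>s\<close>. Hence \<open>Z\<close> is injective on
  quasi-orbits, and it is continuous, open and onto already on \<open>\<Omega>\<close>.

  The arithmetic rests on the finiteness of \<open>R/aR\<close> for \<open>a \<noteq> 0\<close>: only finitely many ideals contain
  \<open>a\<close>, nonzero primes are maximal, and there are \<open>t \<in> K\<close> and \<open>\<pi> \<in> P\<close> with \<open>t P \<subseteq> R\<close> and
  \<open>t \<pi> \<notin> P\<close>. Then \<open>P\<^sup>n = {x \<in> R. t\<^sup>n x \<in> R}\<close>, which makes the valuation multiplicative.\<close>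

section \<open>Algebraic integers in a number field\<close>

text \<open>The exponent of P in x is defined through ideal powers, a form that says little about
  products. The element t lies in the inverse ideal of P and outside R, and \<pi> is a uniformizer:
  t \<pi> is invertible modulo P, so multiplication by t strips off exactly one factor of P. For the
  orbit closure, additive approximation has to produce a multiplicative condition. The ultrametric
  inequality bridges the gap: |k - y| < |y| forces |k| = |y|. So only the absolute value of k is
  prescribed, |k| = |b/a| where b is nonzero and |k| small where b vanishes; the remaining
  discrepancy between k a and b is a local unit, which the classes of \<Omega> absorb. The inclusion
  of zero sets is what gives b/a a meaning at the primes where b is nonzero. The topology on the
  power set is power-cofinite because a basic open set of adeles restricts only finitely many
  components: at all others zero is available, and a vanishing component can be perturbed to a
  nonzero one, since no K_P is discrete.\<close>

interpretation int_module: Modules.module "\<lambda>(q::int) (x::'k::field_char_0). of_int q * x"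
  by unfold_locales (simp_all add: algebra_simps)

interpretation rat_space: Vector_Spaces.vector_space "\<lambda>(q::rat) (x::'k::field_char_0). of_rat q * x"
  by unfold_locales (simp_all add: algebra_simps of_rat_add of_rat_mult)

section \<open>Integrality through finitely generated subgroups of K\<close>

text \<open>Multiplication by t is additive, so it suffices to look at generators.\<close>

lemma mult_span_subset:
  assumes "\<And>b. b \<in> B \<Longrightarrow> t * b \<in> int_module.span B'" and "x \<in> int_module.span B"
  shows "t * (x::'k::field_char_0) \<in> int_module.span B'"
  using assms(2)
proof (induction rule: int_module.span_induct_alt)
  case base
  then show ?case using int_module.span_zero by simp
next
  case (step c b y)
  have "t * (of_int c * b + y) = of_int c * (t * b) + t * y" by (simp add: algebra_simps)
  then show ?case using assms(1)[OF step(1)] step(2)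
    by (auto intro!: int_module.span_add int_module.span_scale)
qed

text \<open>The hypothesis makes the vector of the \<open>v i\<close> an eigenvector of an integer
  matrix for the eigenvalue t, so t is a root of the characteristic polynomial, which is monic with
  integer coefficients.\<close>

lemma algebraic_int_if_matrix:
  fixes t :: "'k::field_char_0" and v :: "nat \<Rightarrow> 'k" and A :: "nat \<Rightarrow> nat \<Rightarrow> int"
  assumes eq: "\<And>i. i < n \<Longrightarrow> t * v i = (\<Sum>j<n. of_int (A i j) * v j)"
    and nz: "i0 < n" "v i0 \<noteq> 0"
  shows "algebraic_int t"
proof -
  define M where "M = mat n n (\<lambda>(i, j). A i j)"
  define N :: "'k mat" where "N = map_mat of_int M"
  have M: "M \<in> carrier_mat n n" and N: "N \<in> carrier_mat n n" by (auto simp: M_def N_def)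
  have "N *\<^sub>v vec n v = t \<cdot>\<^sub>v vec n v"
    by (rule eq_vecI) (auto simp: N_def M_def scalar_prod_def eq atLeast0LessThan intro!: sum.cong)
  moreover have "vec n v \<noteq> 0\<^sub>v n" using nz by (metis index_vec index_zero_vec(1))
  ultimately have "eigenvalue N t" unfolding eigenvalue_def eigenvector_def
    using N by (auto intro!: exI[of _ "vec n v"])
  then have "poly (char_poly N) t = 0" using eigenvalue_root_char_poly[OF N] by simp
  also have "char_poly N = map_poly of_int (char_poly M)"
    unfolding N_def by (rule of_int_hom.char_poly_hom[OF M])
  finally show ?thesis unfolding algebraic_int_altdef_ipoly
    using degree_monic_char_poly[OF M] by auto
qed

text \<open>The determinant trick: multiplication by t acts on a finite generating set through an
  integer matrix. The nonzero x guarantees a nonzero generator, so that the eigenvector does not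
  vanish.\<close>

lemma algebraic_int_if_stable:
  fixes t :: "'k::field_char_0"
  assumes "finite B" "\<And>b. b \<in> B \<Longrightarrow> t * b \<in> int_module.span B" "x \<in> int_module.span B" "x \<noteq> 0"
  shows "algebraic_int t"
proof -
  obtain f where f: "bij_betw f {..<card B} B"
    using \<open>finite B\<close> ex_bij_betw_nat_finite atLeast0LessThan by metis
  have "\<exists>b\<in>B. b \<noteq> 0"
  proof (rule ccontr)
    assume "\<not> ?thesis"
    then have "B \<subseteq> {0}" by auto
    then have "int_module.span B \<subseteq> {0}"
      by (rule int_module.span_minimal[OF _ int_module.subspace_single_0])
    with assms(3,4) show False by blast
  qed
  then obtain i0 where i0: "i0 < card B" "f i0 \<noteq> 0"
    using f unfolding bij_betw_def by (metis imageE lessThan_iff)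
  have "\<forall>i<card B. \<exists>u. t * f i = (\<Sum>j<card B. of_int (u j) * f j)"
  proof (intro allI impI)
    fix i assume "i < card B"
    then have "t * f i \<in> int_module.span B" using assms(2) f by (auto simp: bij_betw_def)
    then obtain u :: "'k \<Rightarrow> int" where "t * f i = (\<Sum>v\<in>B. of_int (u v) * v)"
      unfolding int_module.span_finite[OF \<open>finite B\<close>] by auto
    also have "\<dots> = (\<Sum>j<card B. of_int (u (f j)) * f j)"
      by (rule sum.reindex_bij_betw[OF f, symmetric])
    finally show "\<exists>u. t * f i = (\<Sum>j<card B. of_int (u j) * f j)" by (rule exI[of _ "\<lambda>j. u (f j)"])
  qed
  then obtain A where "\<And>i. i < card B \<Longrightarrow> t * f i = (\<Sum>j<card B. of_int (A i j) * f j)" by metis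
  then show ?thesis using i0 by (rule algebraic_int_if_matrix)
qed

text \<open>\<open>B'\<close> generates the sum of the t^i M for i < n, where M is the span of B.
  Multiplication by t shifts i, and only the top power leaves the range; the monic equation brings
  it back, since the coefficients \<open>c i\<close> preserve M. The last claim lets old multipliers
  survive the enlargement, so that the construction can be iterated.\<close>

lemma span_powers_stable:
  fixes t :: "'k::field_char_0"
  assumes "finite B" and tn: "t ^ n = (\<Sum>i<n. c i * t ^ i)"
    and c: "\<forall>i<n. \<forall>x\<in>int_module.span B. c i * x \<in> int_module.span B"
    and one: "1 \<in> int_module.span B"
  defines "B' \<equiv> (\<lambda>(i, b). t ^ i * b) ` ({..<n} \<times> B)"
  shows "finite B'" "1 \<in> int_module.span B'"
    "\<And>x. x \<in> int_module.span B' \<Longrightarrow> t * x \<in> int_module.span B'"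
    "\<And>d x. \<forall>y\<in>int_module.span B. d * y \<in> int_module.span B \<Longrightarrow>
        x \<in> int_module.span B' \<Longrightarrow> d * x \<in> int_module.span B'"
proof -
  show "finite B'" unfolding B'_def using \<open>finite B\<close> by simp
  have n: "n > 0"
  proof (rule ccontr)
    assume "\<not> 0 < n" then show False using tn by simp
  qed
  have up: "t ^ i * x \<in> int_module.span B'" if "i < n" "x \<in> int_module.span B" for i x
  proof (rule mult_span_subset[OF _ that(2)])
    fix b assume "b \<in> B"
    then show "t ^ i * b \<in> int_module.span B'"
      using that(1) by (intro int_module.span_base) (auto simp: B'_def)
  qed
  show "1 \<in> int_module.span B'" using up[OF n one] by simp
  show "t * x \<in> int_module.span B'" if "x \<in> int_module.span B'" for x
  proof (rule mult_span_subset[OF _ that])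
    fix b' assume "b' \<in> B'"
    then obtain i b where ib: "i < n" "b \<in> B" "b' = t ^ i * b" by (auto simp: B'_def)
    show "t * b' \<in> int_module.span B'"
    proof (cases "Suc i < n")
      case True
      then show ?thesis using up[OF True int_module.span_base[OF ib(2)]] ib(3) by (simp add: mult.assoc)
    next
      case False
      then have "n = Suc i" using ib(1) by simp
      then have "t * b' = t ^ n * b" using ib(3) by simp
      also have "\<dots> = (\<Sum>i<n. t ^ i * (c i * b))"
        unfolding tn sum_distrib_right by (intro sum.cong) simp_all
      also have "\<dots> \<in> int_module.span B'"
        using c int_module.span_base[OF ib(2)] by (auto intro!: int_module.span_sum up)
      finally show ?thesis .
    qed
  qed
  show "d * x \<in> int_module.span B'" if d: "\<forall>y\<in>int_module.span B. d * y \<in> int_module.span B"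
    and x: "x \<in> int_module.span B'" for d x
  proof (rule mult_span_subset[OF _ x])
    fix b' assume "b' \<in> B'"
    then obtain i b where ib: "i < n" "b \<in> B" "b' = t ^ i * b" by (auto simp: B'_def)
    have "t ^ i * (d * b) \<in> int_module.span B'"
      using up ib(1) d int_module.span_base[OF ib(2)] by blast
    then show "d * b' \<in> int_module.span B'" unfolding ib(3) by (simp add: mult.left_commute)
  qed
qed

lemma algebraic_int_power_eq:
  fixes x :: "'k::field_char_0"
  assumes "algebraic_int x"
  obtains n c where "x ^ n = (\<Sum>i<n. of_int (c i) * x ^ i)"
proof -
  obtain p :: "int poly" where p: "poly (map_poly of_int p) x = 0" "lead_coeff p = 1"
    using assms unfolding algebraic_int_altdef_ipoly by auto
  have "0 = (\<Sum>i\<le>degree p. of_int (coeff p i) * x ^ i)"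
    using p(1) by (simp add: poly_altdef degree_map_poly coeff_map_poly)
  also have "\<dots> = (\<Sum>i<degree p. of_int (coeff p i) * x ^ i) + x ^ degree p"
    using p(2) by (simp add: lessThan_Suc_atMost[symmetric])
  finally have "x ^ degree p = (\<Sum>i<degree p. of_int (- coeff p i) * x ^ i)"
    by (simp add: sum_negf eq_neg_iff_add_eq_0 add.commute)
  then show ?thesis by (rule that)
qed

text \<open>Induction on C, starting from the span of 1: each new element is adjoined by its powers
  below the degree of a monic equation, whose integer coefficients preserve every additive subgroup.
  A common module for x and y is what makes their sum and product integral.\<close>

lemma finite_algebraic_ints_stable:
  fixes C :: "'k::field_char_0 set"
  assumes "finite C" "\<And>c. c \<in> C \<Longrightarrow> algebraic_int c"
  obtains B where "finite B" "1 \<in> int_module.span B"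
    "\<And>c x. c \<in> C \<Longrightarrow> x \<in> int_module.span B \<Longrightarrow> c * x \<in> int_module.span B"
proof -
  have "\<exists>B. finite B \<and> 1 \<in> int_module.span B \<and>
    (\<forall>c\<in>C. \<forall>x\<in>int_module.span B. c * x \<in> int_module.span B)"
    using assms
  proof (induction rule: finite_induct)
    case empty
    show ?case by (intro exI[of _ "{1}"]) (auto intro: int_module.span_base)
  next
    case (insert a C)
    then obtain B where B: "finite B" "1 \<in> int_module.span B"
      "\<And>c x. c \<in> C \<Longrightarrow> x \<in> int_module.span B \<Longrightarrow> c * x \<in> int_module.span B" by blast
    obtain n c where "a ^ n = (\<Sum>i<n. of_int (c i) * a ^ i)"
      using insert.prems by (metis algebraic_int_power_eq insertI1)
    have "\<forall>i<n. \<forall>x\<in>int_module.span B. of_int (c i) * x \<in> int_module.span B"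
      by (blast intro: int_module.span_scale)
    note S = span_powers_stable[OF B(1) \<open>a ^ n = _\<close> this B(2)]
    show ?case using S(1,2,3) S(4) B(3)
      by (intro exI[of _ "(\<lambda>(i, b). a ^ i * b) ` ({..<n} \<times> B)"]) auto
  qed
  then show ?thesis using that by blast
qed

lemma algebraic_int_add [simp]:
  assumes "algebraic_int (x::'k::field_char_0)" "algebraic_int y"
  shows "algebraic_int (x + y)"
proof -
  obtain B where B: "finite B" "1 \<in> int_module.span B"
    "\<And>c z. c \<in> {x, y} \<Longrightarrow> z \<in> int_module.span B \<Longrightarrow> c * z \<in> int_module.span B"
    using finite_algebraic_ints_stable[of "{x, y}"] assms by auto
  show ?thesis
    by (rule algebraic_int_if_stable[OF B(1) _ B(2)])
      (auto simp: distrib_right intro: int_module.span_add B(3)[OF _ int_module.span_base])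
qed

lemma algebraic_int_mult [simp]:
  assumes "algebraic_int (x::'k::field_char_0)" "algebraic_int y"
  shows "algebraic_int (x * y)"
proof -
  obtain B where B: "finite B" "1 \<in> int_module.span B"
    "\<And>c z. c \<in> {x, y} \<Longrightarrow> z \<in> int_module.span B \<Longrightarrow> c * z \<in> int_module.span B"
    using finite_algebraic_ints_stable[of "{x, y}"] assms by auto
  show ?thesis
    by (rule algebraic_int_if_stable[OF B(1) _ B(2)])
      (auto simp: mult.assoc intro: B(3) B(3)[OF _ int_module.span_base])
qed

lemma algebraic_int_diff [simp]:
  "algebraic_int (x::'k::field_char_0) \<Longrightarrow> algebraic_int y \<Longrightarrow> algebraic_int (x - y)"
  using algebraic_int_add[of x "- y"] by simp

lemma algebraic_int_power [simp]: "algebraic_int (x::'k::field_char_0) \<Longrightarrow> algebraic_int (x ^ n)"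
  by (induction n) simp_all

lemma algebraic_int_sum:
  "(\<And>i. i \<in> A \<Longrightarrow> algebraic_int (f i :: 'k::field_char_0)) \<Longrightarrow> algebraic_int (sum f A)"
  by (induction A rule: infinite_finite_induct) simp_all

lemma algebraic_int_prod:
  "(\<And>i. i \<in> A \<Longrightarrow> algebraic_int (f i :: 'k::field_char_0)) \<Longrightarrow> algebraic_int (prod f A)"
  by (induction A rule: infinite_finite_induct) simp_all

text \<open>Transitivity of integrality: start from a module stable under all coefficients and
  adjoin the powers of t below n. The result is still finitely generated over the integers and is
  stable under t.\<close>

lemma algebraic_int_integrally_closed:
  fixes t :: "'k::field_char_0"
  assumes tn: "t ^ n = (\<Sum>i<n. c i * t ^ i)" and c: "\<And>i. i < n \<Longrightarrow> algebraic_int (c i)"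
  shows "algebraic_int t"
proof -
  obtain B where B: "finite B" "1 \<in> int_module.span B"
    "\<And>d z. d \<in> c ` {..<n} \<Longrightarrow> z \<in> int_module.span B \<Longrightarrow> d * z \<in> int_module.span B"
    using finite_algebraic_ints_stable[of "c ` {..<n}"] c by auto
  have "\<forall>i<n. \<forall>x\<in>int_module.span B. c i * x \<in> int_module.span B" using B(3) by blast
  note S = span_powers_stable[OF B(1) tn this B(2)]
  show ?thesis
    by (rule algebraic_int_if_stable[OF S(1) S(3) S(2)]) (auto intro: int_module.span_base)
qed

section \<open>Denominators of elements of K\<close>

lemma finite_rats_common_denominator:
  assumes "finite (A::rat set)"
  obtains d :: int where "d > 0" "\<And>q. q \<in> A \<Longrightarrow> of_int d * q \<in> \<int>"
proof -
  have "\<exists>d::int. d > 0 \<and> (\<forall>q\<in>A. of_int d * q \<in> \<int>)" using assms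
  proof (induction rule: finite_induct)
    case empty
    show ?case by (intro exI[of _ 1]) simp
  next
    case (insert q A)
    then obtain d :: int where d: "d > 0" "\<forall>q\<in>A. of_int d * q \<in> \<int>" by blast
    obtain a b where ab: "quotient_of q = (a, b)" by force
    then have b: "b > 0" "q = of_int a / of_int b"
      using quotient_of_denom_pos quotient_of_div by blast+
    have "of_int (d * b) * r \<in> \<int>" if "r \<in> A" for r
    proof -
      have "of_int (d * b) * r = of_int b * (of_int d * r)" by simp
      then show ?thesis using d(2) that by (metis Ints_mult Ints_of_int)
    qed
    moreover have "of_int (d * b) * q = of_int (d * a)" using b by simp
    then have "of_int (d * b) * q \<in> \<int>" by (metis Ints_of_int)
    ultimately show ?case using d(1) b(1) by (intro exI[of _ "d * b"]) auto
  qed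
  then show ?thesis using that by blast
qed

text \<open>Multiplication by x is described by a rational matrix with respect to the finite
  spanning set B. If d clears its entries, d x maps the integer span of B into itself.\<close>

lemma number_field_denominator:
  fixes x :: "'k::field_char_0"
  assumes "number_field TYPE('k)"
  obtains d :: int where "d > 0" "algebraic_int (of_int d * x)"
proof -
  obtain B :: "'k set" where B: "finite B" "rat_space.span B = UNIV"
    using assms unfolding number_field_def by auto
  have "\<exists>u::'k \<Rightarrow> rat. x * b = (\<Sum>v\<in>B. of_rat (u v) * v)" for b
    using UNIV_I[of "x * b", folded B(2)] unfolding rat_space.span_finite[OF B(1)] by auto
  then obtain u :: "'k \<Rightarrow> 'k \<Rightarrow> rat" where u: "\<And>b. x * b = (\<Sum>v\<in>B. of_rat (u b v) * v)" by metis
  have "finite ((\<lambda>(b, v). u b v) ` (B \<times> B))" using B(1) by simp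
  then obtain d :: int where d: "d > 0" "\<And>q. q \<in> (\<lambda>(b, v). u b v) ` (B \<times> B) \<Longrightarrow> of_int d * q \<in> \<int>"
    using finite_rats_common_denominator by blast
  have stable: "of_int d * x * b \<in> int_module.span B" if "b \<in> B" for b
  proof -
    have "of_int d * x * b = (\<Sum>v\<in>B. of_rat (of_int d * u b v) * v)"
      by (simp add: mult.assoc u sum_distrib_left of_rat_mult)
    also have "\<dots> \<in> int_module.span B"
    proof (rule int_module.span_sum)
      fix v assume v: "v \<in> B"
      then have "of_int d * u b v \<in> \<int>" using d(2) \<open>b \<in> B\<close> by auto
      then obtain z where "of_int d * u b v = of_int z" by (auto elim: Ints_cases)
      then show "of_rat (of_int d * u b v) * v \<in> int_module.span B"
        using int_module.span_scale[OF int_module.span_base[OF v], of z] by simp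
    qed
    finally show ?thesis .
  qed
  have "\<exists>b\<in>B. b \<noteq> 0"
  proof (rule ccontr)
    assume "\<not> ?thesis"
    then have "B \<subseteq> {0}" by auto
    then have "rat_space.span B \<subseteq> {0}"
      by (rule rat_space.span_minimal[OF _ rat_space.subspace_single_0])
    then have "(1::'k) = 0" using B(2) by blast
    then show False by simp
  qed
  then obtain b where "b \<in> B" "b \<noteq> 0" by blast
  then have "algebraic_int (of_int d * x)"
    using algebraic_int_if_stable[OF B(1) stable int_module.span_base] by blast
  then show ?thesis using that d(1) by blast
qed

section \<open>Finiteness of R/aR\<close>

text \<open>Finiteness of R/aR, expressed by a finite set S that meets every coset; several members
  of S may represent the same coset.\<close>

definition finite_quotient :: "'k::field_char_0 \<Rightarrow> bool" where
  "finite_quotient a \<longleftrightarrow> (\<exists>S. finite S \<and> (\<forall>s\<in>S. algebraic_int s) \<and>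
     (\<forall>x. algebraic_int x \<longrightarrow> (\<exists>s\<in>S. \<exists>y. algebraic_int y \<and> x = s + a * y)))"

text \<open>Two-digit expansion: x = s + a y and y = t + b z give x = (s + a t) + a b z.\<close>

lemma finite_quotient_mult:
  assumes "finite_quotient a" "finite_quotient b" "algebraic_int (a::'k::field_char_0)"
  shows "finite_quotient (a * b)"
proof -
  obtain S where S: "finite S" "\<forall>s\<in>S. algebraic_int s"
    "\<forall>x. algebraic_int x \<longrightarrow> (\<exists>s\<in>S. \<exists>y. algebraic_int y \<and> x = s + a * y)"
    using assms(1) unfolding finite_quotient_def by blast
  obtain T where T: "finite T" "\<forall>s\<in>T. algebraic_int s"
    "\<forall>x. algebraic_int x \<longrightarrow> (\<exists>s\<in>T. \<exists>y. algebraic_int y \<and> x = s + b * y)"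
    using assms(2) unfolding finite_quotient_def by blast
  show ?thesis unfolding finite_quotient_def
  proof (intro exI[of _ "(\<lambda>(s, t). s + a * t) ` (S \<times> T)"] conjI allI impI)
    fix x :: 'k assume "algebraic_int x"
    then obtain s y where sy: "s \<in> S" "algebraic_int y" "x = s + a * y" using S(3) by blast
    then obtain t z where tz: "t \<in> T" "algebraic_int z" "y = t + b * z" using T(3) by blast
    show "\<exists>s\<in>(\<lambda>(s, t). s + a * t) ` (S \<times> T). \<exists>y. algebraic_int y \<and> x = s + a * b * y"
      using sy tz by (intro bexI[of _ "s + a * t"] exI[of _ z]) (auto simp: distrib_left mult.assoc)
  qed (use S T assms(3) in auto)
qed

text \<open>A multiple of a b is a multiple of a, so representatives modulo a b serve modulo
  a.\<close>

lemma finite_quotient_dvd: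
  assumes "finite_quotient (a * b)" "algebraic_int (b::'k::field_char_0)"
  shows "finite_quotient a"
  using assms unfolding finite_quotient_def by (metis algebraic_int_mult mult.assoc)

lemma integer_relation:
  fixes X :: "'k::field_char_0 set"
  assumes "rat_space.dependent X" "finite X"
  obtains c :: "'k \<Rightarrow> int" where "(\<Sum>x\<in>X. of_int (c x) * x) = 0" "\<exists>x\<in>X. c x \<noteq> 0"
proof -
  obtain u :: "'k \<Rightarrow> rat" where u: "(\<Sum>x\<in>X. of_rat (u x) * x) = 0" "\<exists>x\<in>X. u x \<noteq> 0"
    using assms by (auto simp: rat_space.dependent_finite)
  obtain d :: int where d: "d > 0" "\<And>q. q \<in> u ` X \<Longrightarrow> of_int d * q \<in> \<int>"
    using finite_rats_common_denominator[of "u ` X"] assms(2) by auto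
  have "\<forall>x\<in>X. \<exists>z::int. of_int d * u x = of_int z" using d(2) by (auto elim!: Ints_cases)
  then obtain c :: "'k \<Rightarrow> int" where c: "\<And>x. x \<in> X \<Longrightarrow> of_int d * u x = of_int (c x)" by metis
  have "(\<Sum>x\<in>X. of_int (c x) * x) = (\<Sum>x\<in>X. of_rat (of_int d * u x) * x)"
    by (intro sum.cong) (simp_all add: c)
  also have "\<dots> = of_int d * (\<Sum>x\<in>X. of_rat (u x) * x)"
    by (simp add: of_rat_mult mult.assoc sum_distrib_left)
  finally have "(\<Sum>x\<in>X. of_int (c x) * x) = 0" using u(1) by simp
  moreover have "\<exists>x\<in>X. c x \<noteq> 0"
  proof -
    obtain x where x: "x \<in> X" "u x \<noteq> 0" using u(2) by blast
    then have "(of_int (c x) :: rat) \<noteq> 0" using c[OF x(1), symmetric] d(1) by simp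
    then show ?thesis using x(1) by auto
  qed
  ultimately show ?thesis by (rule that)
qed

text \<open>An integer relation is divided by the gcd g of its coefficients. If p still divided
  every quotient, g p would divide g.\<close>

lemma primitive_integer_relation:
  fixes X :: "'k::field_char_0 set"
  assumes "rat_space.dependent X" "finite X" "prime (p::int)"
  obtains c :: "'k \<Rightarrow> int" where "(\<Sum>x\<in>X. of_int (c x) * x) = 0" "\<exists>x\<in>X. \<not> p dvd c x"
proof -
  obtain c :: "'k \<Rightarrow> int" where c: "(\<Sum>x\<in>X. of_int (c x) * x) = 0" "\<exists>x\<in>X. c x \<noteq> 0"
    using integer_relation assms(1,2) by blast
  define g where "g = Gcd (c ` X)"
  have g: "g \<noteq> 0" using c(2) by (auto simp: g_def Gcd_0_iff)
  have gd: "g dvd c x" if "x \<in> X" for x using that by (simp add: g_def)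
  have "(\<Sum>x\<in>X. of_int (c x div g) * x) = 0"
  proof -
    have "of_int g * (\<Sum>x\<in>X. of_int (c x div g) * x) = (\<Sum>x\<in>X. of_int (c x) * x)"
      unfolding sum_distrib_left mult.assoc[symmetric] of_int_mult[symmetric]
      by (intro sum.cong) (simp_all add: gd)
    then show ?thesis using c(1) g by simp
  qed
  moreover have "\<exists>x\<in>X. \<not> p dvd c x div g"
  proof (rule ccontr)
    assume "\<not> ?thesis"
    then have "g * p dvd c x" if "x \<in> X" for x
      using that gd by (metis dvd_mult_div_cancel mult_dvd_mono dvd_refl)
    then have "g * p dvd Gcd (c ` X)" by (intro Gcd_greatest) blast
    then have "g * p dvd g" by (simp only: g_def)
    then show False using g assms(3) by (metis dvd_mult_cancel_left mult.right_neutral not_prime_unit)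
  qed
  ultimately show ?thesis by (rule that)
qed

text \<open>A set of integers that is independent modulo \<open>p\<close> has at most \<open>[K:\<rat>]\<close> elements, because a
  rational relation can be scaled to a primitive integral one. A maximal such set spans \<open>R/pR\<close>.\<close>

lemma finite_quotient_prime:
  assumes nf: "number_field TYPE('k::field_char_0)" and p: "prime (p::int)"
  shows "finite_quotient (of_int p :: 'k)"
proof -
  define R :: "'k set" where "R = {x. algebraic_int x}"
  define indep where "indep X \<longleftrightarrow> finite X \<and> X \<subseteq> R \<and>
    (\<forall>c y. (\<Sum>x\<in>X. of_int (c x) * x) = of_int p * y \<longrightarrow> algebraic_int y \<longrightarrow> (\<forall>x\<in>X. p dvd c x))" for X
  obtain B :: "'k set" where B: "finite B" "rat_space.span B = UNIV"
    using nf unfolding number_field_def by auto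
  \<comment> \<open>A rational dependence, made primitive, is a relation with right-hand side p
    times 0, which \<open>indep X\<close> excludes.\<close>
  have bound: "card X < Suc (card B)" if "indep X" for X
  proof (rule ccontr)
    assume "\<not> ?thesis"
    moreover have fin: "finite X" using that by (simp add: indep_def)
    ultimately have "rat_space.dependent X"
      using rat_space.independent_span_bound[OF B(1), of X] B(2) by auto
    then obtain c :: "'k \<Rightarrow> int" where c: "(\<Sum>x\<in>X. of_int (c x) * x) = 0" "\<exists>x\<in>X. \<not> p dvd c x"
      using primitive_integer_relation[OF _ fin p] by blast
    then show False using that unfolding indep_def by (metis algebraic_int_0 mult_zero_right)
  qed
  have "indep {}" by (simp add: indep_def)
  then obtain X where X: "indep X" and max: "\<And>Y. indep Y \<Longrightarrow> card Y \<le> card X"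
    using ex_has_greatest_nat[of indep "{}" card "Suc (card B)"] bound by blast
  have fin: "finite X" and XR: "X \<subseteq> R" using X by (auto simp: indep_def)
  define S where "S = (\<lambda>c. \<Sum>x\<in>X. of_int (c x) * x) ` (X \<rightarrow>\<^sub>E {0..<p})"
  have gen: "\<exists>c y. algebraic_int y \<and> z = (\<Sum>x\<in>X. of_int (c x) * x) + of_int p * y" if z: "z \<in> R" for z
  proof (cases "z \<in> X")
    case True
    have "(\<Sum>x\<in>X. of_int (if x = z then 1 else 0) * x) = (\<Sum>x\<in>X. if x = z then z else 0)"
      by (intro sum.cong) auto
    then have "z = (\<Sum>x\<in>X. of_int (if x = z then 1 else 0) * x)"
      using True fin by simp
    then show ?thesis by (intro exI[of _ "\<lambda>x. if x = z then 1 else 0"] exI[of _ 0]) simp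
  next
    case False
    \<comment> \<open>By maximality, adjoining z creates a relation modulo p whose coefficients are
      not all divisible by p. The coefficient of z itself must be prime to p, for otherwise its term
      moves to the right-hand side and leaves a relation on X.\<close>
    then have "card (insert z X) > card X" using fin by simp
    then have "\<not> indep (insert z X)" using max[of "insert z X"] by linarith
    moreover have "finite (insert z X)" "insert z X \<subseteq> R" using fin XR z by auto
    ultimately have "\<not> (\<forall>c y. (\<Sum>x\<in>insert z X. of_int (c x) * x) = of_int p * y \<longrightarrow>
        algebraic_int y \<longrightarrow> (\<forall>x\<in>insert z X. p dvd c x))" unfolding indep_def by argo
    then obtain c y where cy: "(\<Sum>x\<in>insert z X. of_int (c x) * x) = of_int p * y" "algebraic_int y"
      "\<not> (\<forall>x\<in>insert z X. p dvd c x)" by blast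
    then have eq: "of_int (c z) * z + (\<Sum>x\<in>X. of_int (c x) * x) = of_int p * y"
      using fin False by simp
    have "\<not> p dvd c z"
    proof
      assume "p dvd c z"
      then obtain k where k: "c z = p * k" by blast
      have "(\<Sum>x\<in>X. of_int (c x) * x) = of_int p * (y - of_int k * z)"
        using eq k by (simp add: algebra_simps)
      moreover have "algebraic_int (y - of_int k * z)" using cy(2) z by (simp add: R_def)
      ultimately have "\<forall>x\<in>X. p dvd c x" using X unfolding indep_def by blast
      then show False using cy(3) \<open>p dvd c z\<close> by blast
    qed
    then have "coprime (c z) p" using p by (meson coprime_commute prime_imp_coprime)
    \<comment> \<open>Bezout inverts \<open>c z\<close> modulo p, so the relation can be solved for
      z.\<close>
    then obtain d e where de: "c z * d + p * e = 1"
      using bezout_int[of "c z" p] unfolding coprime_iff_gcd_eq_1 by (metis mult.commute)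
    have "z = of_int (c z * d + p * e) * z" by (simp only: de of_int_1 mult_1)
    also have "\<dots> = of_int d * (of_int (c z) * z) + of_int p * (of_int e * z)"
      by (simp add: algebra_simps)
    also have "of_int (c z) * z = of_int p * y - (\<Sum>x\<in>X. of_int (c x) * x)"
      using eq by (simp add: algebra_simps)
    also have "of_int d * \<dots> + of_int p * (of_int e * z) =
      (\<Sum>x\<in>X. of_int (- d * c x) * x) + of_int p * (of_int d * y + of_int e * z)"
      by (simp add: algebra_simps sum_distrib_left sum_negf)
    finally have "z = (\<Sum>x\<in>X. of_int (- d * c x) * x) + of_int p * (of_int d * y + of_int e * z)" .
    moreover have "algebraic_int (of_int d * y + of_int e * z)" using cy(2) z by (simp add: R_def)
    ultimately show ?thesis
      by (intro exI[of _ "\<lambda>x. - d * c x"] exI[of _ "of_int d * y + of_int e * z"] conjI)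
  qed
  show ?thesis unfolding finite_quotient_def
  proof (intro exI[of _ S] conjI allI impI ballI)
    show "finite S" unfolding S_def using fin by (intro finite_imageI finite_PiE) auto
    show "algebraic_int s" if "s \<in> S" for s
    proof -
      have "\<exists>c::'k \<Rightarrow> int. s = (\<Sum>x\<in>X. of_int (c x) * x)"
        using that unfolding S_def by (rule imageE) (rule exI)
      then obtain c :: "'k \<Rightarrow> int" where "s = (\<Sum>x\<in>X. of_int (c x) * x)" ..
      then show ?thesis using XR by (auto simp: R_def intro!: algebraic_int_sum)
    qed
    fix z :: 'k assume "algebraic_int z"
    then have "z \<in> R" by (simp add: R_def)
    then obtain c y where cy: "algebraic_int y" "z = (\<Sum>x\<in>X. of_int (c x) * x) + of_int p * y"
      using gen by blast
    \<comment> \<open>Reducing the coefficients modulo p leaves only finitely many sums; the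
      quotients \<open>c x div p\<close> go into the multiple of p.\<close>
    define c' where "c' = (\<lambda>x\<in>X. c x mod p)"
    have pt: "of_int (c x) * x = of_int p * (of_int (c x div p) * x) + of_int (c' x) * x" if "x \<in> X" for x
    proof -
      have "of_int (c x) * x = of_int (p * (c x div p) + c x mod p) * x" by simp
      also have "\<dots> = of_int p * (of_int (c x div p) * x) + of_int (c x mod p) * x"
        unfolding of_int_add of_int_mult by (simp only: distrib_right mult.assoc)
      finally show ?thesis using that by (simp add: c'_def)
    qed
    have "(\<Sum>x\<in>X. of_int (c x) * x) = (\<Sum>x\<in>X. of_int p * (of_int (c x div p) * x) + of_int (c' x) * x)"
      by (rule sum.cong[OF refl pt])
    also have "\<dots> = of_int p * (\<Sum>x\<in>X. of_int (c x div p) * x) + (\<Sum>x\<in>X. of_int (c' x) * x)"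
      by (simp add: sum.distrib sum_distrib_left)
    finally have "z = (\<Sum>x\<in>X. of_int (c' x) * x) + of_int p * ((\<Sum>x\<in>X. of_int (c x div p) * x) + y)"
      unfolding cy(2) by (simp only: distrib_left add_ac)
    moreover have "algebraic_int ((\<Sum>x\<in>X. of_int (c x div p) * x) + y)"
      using cy(1) XR by (intro algebraic_int_add algebraic_int_sum) (auto simp: R_def)
    moreover have "(\<Sum>x\<in>X. of_int (c' x) * x) \<in> S"
      unfolding S_def
    proof (rule image_eqI[OF refl])
      show "c' \<in> X \<rightarrow>\<^sub>E {0..<p}" using prime_gt_0_int[OF p] by (simp add: c'_def)
    qed
    ultimately show "\<exists>s\<in>S. \<exists>y. algebraic_int y \<and> z = s + of_int p * y" by blast
  qed
qed

text \<open>If d clears the denominator of 1/a, then a divides the positive integer d in R. Positive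
  integers are products of primes, hence have finite quotients, and this passes to the divisor
  a.\<close>

lemma finite_quotient_nonzero:
  assumes nf: "number_field TYPE('k::field_char_0)" and a: "algebraic_int (a::'k)" "a \<noteq> 0"
  shows "finite_quotient a"
proof -
  have one: "finite_quotient (1::'k)"
    unfolding finite_quotient_def by (intro exI[of _ "{0}"]) simp
  have nat: "n > 0 \<Longrightarrow> finite_quotient (of_nat n :: 'k)" for n :: nat
  proof (induction n rule: prime_divisors_induct)
    case (factor p x)
    have "finite_quotient (of_nat p :: 'k)"
      using finite_quotient_prime[OF nf, of "int p"] factor(1) by simp
    then show ?case using factor by (auto intro!: finite_quotient_mult)
  qed (use one in auto)
  obtain d :: int where d: "d > 0" "algebraic_int (of_int d * (1 / a))"
    using number_field_denominator[OF nf] by blast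
  have "a * (of_int d * (1 / a)) = of_nat (nat d)" using a(2) d(1) by simp
  then have "finite_quotient (a * (of_int d * (1 / a)))" using nat[of "nat d"] d(1) by simp
  then show ?thesis using d(2) by (rule finite_quotient_dvd)
qed

section \<open>Prime ideals, valuations and strong approximation\<close>

lemma integer_ring_simps [simp]:
  "carrier integer_ring = {x. algebraic_int x}" "x \<otimes>\<^bsub>integer_ring\<^esub> y = x * y"
  "x \<oplus>\<^bsub>integer_ring\<^esub> y = x + y" "\<one>\<^bsub>integer_ring\<^esub> = 1" "\<zero>\<^bsub>integer_ring\<^esub> = 0"
  by (simp_all add: integer_ring_def)

lemma cring_integer_ring: "cring (integer_ring :: 'k::field_char_0 ring)"
proof (rule cringI)
  show "abelian_group (integer_ring :: 'k ring)"
  proof (rule abelian_groupI)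
    fix x :: 'k assume "x \<in> carrier integer_ring"
    then show "\<exists>y\<in>carrier integer_ring. y \<oplus>\<^bsub>integer_ring\<^esub> x = \<zero>\<^bsub>integer_ring\<^esub>"
      by (intro bexI[of _ "- x"]) simp_all
  qed simp_all
  show "comm_monoid (integer_ring :: 'k ring)"
    by (rule comm_monoidI) (simp_all add: mult.assoc mult.commute)
qed (simp add: distrib_right)

lemma ideals_set_simps [simp]:
  "\<one>\<^bsub>ideals_set R\<^esub> = carrier R" "I \<otimes>\<^bsub>ideals_set R\<^esub> J = ideal_prod R I J"
  by (simp_all add: ideals_set_def)

text \<open>The ideals of R, expressed in the field operations of K instead of those of the ring
  record, so that integrality lemmas and arithmetic simplification apply directly.\<close>

definition integral_ideal :: "'k::field_char_0 set \<Rightarrow> bool" where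
  "integral_ideal I \<longleftrightarrow> (\<forall>x\<in>I. algebraic_int x) \<and> 0 \<in> I \<and> (\<forall>x\<in>I. \<forall>y\<in>I. x + y \<in> I) \<and>
     (\<forall>r x. algebraic_int r \<longrightarrow> x \<in> I \<longrightarrow> r * x \<in> I)"

lemma integral_idealI:
  assumes "\<And>x. x \<in> I \<Longrightarrow> algebraic_int x" "0 \<in> I" "\<And>x y. x \<in> I \<Longrightarrow> y \<in> I \<Longrightarrow> x + y \<in> I"
    "\<And>r x. algebraic_int r \<Longrightarrow> x \<in> I \<Longrightarrow> r * x \<in> I"
  shows "integral_ideal I"
  using assms unfolding integral_ideal_def by blast

lemma integral_idealD:
  assumes "integral_ideal I"
  shows "x \<in> I \<Longrightarrow> algebraic_int x" "0 \<in> I" "x \<in> I \<Longrightarrow> y \<in> I \<Longrightarrow> x + y \<in> I"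
    "algebraic_int r \<Longrightarrow> x \<in> I \<Longrightarrow> r * x \<in> I" "algebraic_int r \<Longrightarrow> x \<in> I \<Longrightarrow> x * r \<in> I"
    "x \<in> I \<Longrightarrow> - x \<in> I" "x \<in> I \<Longrightarrow> y \<in> I \<Longrightarrow> x - y \<in> I"
proof -
  show neg: "- x \<in> I" if "x \<in> I" for x
    using assms that unfolding integral_ideal_def
    by (metis algebraic_int_1 algebraic_int_minus mult_minus1)
  show "x \<in> I \<Longrightarrow> y \<in> I \<Longrightarrow> x - y \<in> I"
    using neg[of y] assms unfolding integral_ideal_def by (metis diff_conv_add_uminus)
qed (use assms in \<open>auto simp: integral_ideal_def mult.commute\<close>)

lemma integral_ideal_if_ideal:
  assumes "ideal I (integer_ring :: 'k::field_char_0 ring)"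
  shows "integral_ideal I"
proof -
  interpret ideal I "integer_ring :: 'k ring" by (fact assms)
  show ?thesis
    using Icarr zero_closed a_closed I_l_closed additive_subgroup.zero_closed[OF additive_subgroup_axioms]
      additive_subgroup.a_closed[OF additive_subgroup_axioms]
    by (intro integral_idealI) auto
qed

text \<open>Modulo I the element 1 - q is 1, hence so are its powers. The expression 1 - (1 - q)^n
  recurs below as an element of I that is congruent to 1 modulo (1 - q)^n.\<close>

lemma ideal_one_minus_power:
  assumes "integral_ideal I" "q \<in> I"
  shows "1 - (1 - q) ^ n \<in> I"
proof (induction n)
  case 0
  then show ?case using integral_idealD[OF assms(1)] by simp
next
  case (Suc n)
  have "1 - (1 - q) ^ Suc n = (1 - (1 - q) ^ n) + (1 - q) ^ n * q" by (simp add: algebra_simps)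
  moreover have "(1 - q) ^ n * q \<in> I"
    using assms integral_idealD(1)[OF assms] by (intro integral_idealD(4)[OF assms(1)]) simp_all
  ultimately show ?case using Suc integral_idealD(3)[OF assms(1)] by metis
qed

text \<open>An ideal containing a is a union of cosets of aR, so it is determined by the
  representatives that it contains.\<close>

lemma finite_ideals_containing:
  assumes nf: "number_field TYPE('k::field_char_0)" and a: "algebraic_int (a::'k)" "a \<noteq> 0"
  shows "finite {I. integral_ideal I \<and> a \<in> I}"
proof -
  obtain S where S: "finite S"
    "\<forall>x. algebraic_int x \<longrightarrow> (\<exists>s\<in>S. \<exists>y. algebraic_int y \<and> x = s + a * y)"
    using finite_quotient_nonzero[OF nf a] unfolding finite_quotient_def by blast
  have sub: "I \<subseteq> J"
    if I: "integral_ideal I" "a \<in> I" and J: "integral_ideal J" "a \<in> J" and eq: "I \<inter> S \<subseteq> J" for I J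
  proof
    fix x assume x: "x \<in> I"
    then obtain s y where sy: "s \<in> S" "algebraic_int y" "x = s + a * y"
      using S(2) integral_idealD(1)[OF I(1)] by blast
    have ay: "a * y \<in> I" "a * y \<in> J"
      using integral_idealD(5)[OF I(1) sy(2) I(2)] integral_idealD(5)[OF J(1) sy(2) J(2)] .
    have "s = x - a * y" using sy(3) by simp
    then have "s \<in> J" using integral_idealD(7)[OF I(1) x ay(1)] sy(1) eq by auto
    then show "x \<in> J" using integral_idealD(3)[OF J(1) _ ay(2)] sy(3) by simp
  qed
  have "inj_on (\<lambda>I. I \<inter> S) {I. integral_ideal I \<and> a \<in> I}"
  proof (rule inj_onI)
    fix I J assume "I \<in> {I. integral_ideal I \<and> a \<in> I}" "J \<in> {I. integral_ideal I \<and> a \<in> I}" "I \<inter> S = J \<inter> S"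
    then show "I = J" using sub[of I J] sub[of J I] by blast
  qed
  then show ?thesis
    by (rule inj_on_finite[of _ _ "Pow S"]) (use S(1) in auto)
qed

lemma pigeonhole_nat:
  assumes "finite A" "\<And>n::nat. f n \<in> A"
  obtains i j where "i < j" "f i = f j"
proof -
  have "\<not> inj f"
    using assms by (metis finite_subset image_subsetI infinite_UNIV_nat finite_imageD)
  then obtain i j where "f i = f j" "i \<noteq> j" by (auto simp: inj_def)
  then show ?thesis using that by (metis nat_neq_iff)
qed

text \<open>Two powers of z agree in the finite ring R/aR. Wherever the factor z^i can be cancelled,
  this provides an inverse of z.\<close>

lemma power_congruence:
  assumes nf: "number_field TYPE('k::field_char_0)" and a: "algebraic_int (a::'k)" "a \<noteq> 0"
    and z: "algebraic_int z"
  obtains i m y where "m > 0" "algebraic_int y" "z ^ i * (z ^ m - 1) = a * y"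
proof -
  obtain S where S: "finite S"
    "\<forall>x. algebraic_int x \<longrightarrow> (\<exists>s\<in>S. \<exists>y. algebraic_int y \<and> x = s + a * y)"
    using finite_quotient_nonzero[OF nf a] unfolding finite_quotient_def by blast
  have "\<forall>n. \<exists>s y. s \<in> S \<and> algebraic_int y \<and> z ^ n = s + a * y" using S(2) z by (meson algebraic_int_power)
  then obtain s y where sy: "\<And>n. s n \<in> S" "\<And>n. algebraic_int (y n)" "\<And>n. z ^ n = s n + a * y n" by metis
  obtain i j where ij: "i < j" "s i = s j" using pigeonhole_nat[of S s] S(1) sy(1) by blast
  have "z ^ i * (z ^ (j - i) - 1) = z ^ j - z ^ i"
    using ij(1) by (simp add: right_diff_distrib power_add[symmetric])
  also have "\<dots> = a * (y j - y i)" using sy(3)[of i] sy(3)[of j] ij(2) by (simp add: algebra_simps)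
  finally show ?thesis using that[of "j - i" "y j - y i" i] ij(1) sy(2) by simp
qed

abbreviation ideal_pow :: "'k::field_char_0 set \<Rightarrow> nat \<Rightarrow> 'k set" where
  "ideal_pow P n \<equiv> P [^]\<^bsub>ideals_set integer_ring\<^esub> n"

locale number_field_prime =
  fixes P :: "'k::field_char_0 set"
  assumes nf: "number_field TYPE('k)" and prime: "P \<in> prime_ideals"
begin

lemma ideal_P: "integral_ideal P"
  using prime by (auto simp: prime_ideals_def primeideal_def intro: integral_ideal_if_ideal)

lemmas P_integral = integral_idealD(1)[OF ideal_P]
  and P_zero = integral_idealD(2)[OF ideal_P]
  and P_add = integral_idealD(3)[OF ideal_P]
  and P_mult_left = integral_idealD(4)[OF ideal_P]
  and P_mult_right = integral_idealD(5)[OF ideal_P]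
  and P_diff = integral_idealD(7)[OF ideal_P]

lemma P_prime: "algebraic_int x \<Longrightarrow> algebraic_int y \<Longrightarrow> x * y \<in> P \<Longrightarrow> x \<in> P \<or> y \<in> P"
  using prime primeideal.I_prime[of P integer_ring x y] by (auto simp: prime_ideals_def)

lemma one_notin_P: "1 \<notin> P"
proof
  assume one: "1 \<in> P"
  have "P = carrier integer_ring" using P_integral P_mult_left[OF _ one] by auto
  then show False using prime primeideal.I_notcarr[of P integer_ring] by (auto simp: prime_ideals_def)
qed

lemma P_power: "algebraic_int x \<Longrightarrow> x ^ n \<in> P \<Longrightarrow> x \<in> P"
proof (induction n)
  case (Suc n)
  then show ?case using P_prime[of x "x ^ n"] by auto
qed (use one_notin_P in auto)

lemma obtain_nonzero: obtains a where "a \<in> P" "a \<noteq> 0" "algebraic_int a"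
  using prime P_zero P_integral by (auto simp: prime_ideals_def)

text \<open>For a nonzero a in P some x^i (x^m - 1) lies in aR, hence in P, and primality leaves x^m
  - 1 in P. So x^(m-1) is the inverse; in other words, P is maximal.\<close>

lemma inverse_mod_P:
  assumes x: "algebraic_int x" "x \<notin> P"
  obtains y where "algebraic_int y" "1 - x * y \<in> P"
proof -
  obtain a where a: "a \<in> P" "a \<noteq> 0" "algebraic_int a" by (rule obtain_nonzero)
  obtain i m y where m: "m > 0" and y: "algebraic_int y" "x ^ i * (x ^ m - 1) = a * y"
    using power_congruence[OF nf a(3,2) x(1)] .
  have "x ^ i * (x ^ m - 1) \<in> P" using P_mult_right[OF y(1) a(1)] y(2) by simp
  moreover have "x ^ i \<notin> P" using P_power x by blast
  ultimately have "x ^ m - 1 \<in> P" using P_prime[of "x ^ i" "x ^ m - 1"] x(1) by simp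
  from P_diff[OF P_zero this] have "1 - x * x ^ (m - 1) \<in> P"
    using power_minus_mult[OF m, of x] by (simp add: mult.commute)
  then show ?thesis by (rule that[rotated]) (simp add: x(1))
qed

section \<open>The inverse of a prime ideal\<close>

text \<open>The ideal (aR : x), that is, the annihilator of the class of x in R/aR.\<close>

definition colon :: "'k \<Rightarrow> 'k \<Rightarrow> 'k set" where
  "colon a x = {r. algebraic_int r \<and> (\<exists>y. algebraic_int y \<and> r * x = a * y)}"

lemma ideal_colon:
  assumes "algebraic_int x"
  shows "integral_ideal (colon a x)"
proof (rule integral_idealI)
  show "0 \<in> colon a x" by (auto simp: colon_def intro!: exI[of _ 0])
next
  fix r s assume "r \<in> colon a x" "s \<in> colon a x"
  then obtain y z where "algebraic_int r" "algebraic_int s" "algebraic_int y" "algebraic_int z"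
    "r * x = a * y" "s * x = a * z" by (auto simp: colon_def)
  then show "r + s \<in> colon a x"
    by (auto simp: colon_def distrib_right distrib_left intro!: exI[of _ "y + z"])
next
  fix s r :: 'k assume "algebraic_int s" "r \<in> colon a x"
  moreover from this obtain y where "algebraic_int r" "algebraic_int y" "r * x = a * y" by (auto simp: colon_def)
  ultimately show "s * r \<in> colon a x"
    by (auto simp: colon_def mult.left_commute mult.assoc intro!: exI[of _ "s * y"])
qed (simp add: colon_def)

text \<open>Choose \<open>x\<close> such that \<open>(aR : x)\<close> is maximal among the colon ideals contained in \<open>P\<close>. Some
  \<open>s \<notin> P\<close> multiplies \<open>P\<close> into this ideal, and \<open>t = s x / a\<close>.\<close>

lemma dual_element:
  obtains t where "\<not> algebraic_int t" "\<And>p. p \<in> P \<Longrightarrow> algebraic_int (t * p)"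
proof -
  obtain a where a: "a \<in> P" "a \<noteq> 0" "algebraic_int a" by (rule obtain_nonzero)
  have a_colon: "a * y \<in> colon a x" if "algebraic_int x" "algebraic_int y" for x y
    using that a(3) by (auto simp: colon_def mult.assoc intro!: exI[of _ "y * x"])
  define \<J> where "\<J> = {colon a x | x. algebraic_int x \<and> colon a x \<subseteq> P}"
  \<comment> \<open>All these colon ideals contain a, so there are finitely many of them and a
    maximal one exists; x = 1 shows that the family is not empty.\<close>
  have "\<J> \<subseteq> {I. integral_ideal I \<and> a \<in> I}"
    using ideal_colon a_colon[where y = 1] by (auto simp: \<J>_def)
  then have "finite \<J>" using finite_ideals_containing[OF nf a(3,2)] finite_subset by blast
  moreover have "colon a 1 \<subseteq> P" using P_mult_right[OF _ a(1)] by (auto simp: colon_def)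
  then have "colon a 1 \<in> \<J>" unfolding \<J>_def using algebraic_int_1 by blast
  ultimately obtain J where "J \<in> \<J>" and max: "\<And>I. I \<in> \<J> \<Longrightarrow> J \<subseteq> I \<Longrightarrow> J = I"
    using finite_has_maximal[of \<J>] by blast
  then obtain x where x: "algebraic_int x" "J = colon a x" "colon a x \<subseteq> P" by (auto simp: \<J>_def)
  note J = ideal_colon[OF x(1), of a]
  \<comment> \<open>Otherwise (aR : p x) lies in P, contains (aR : x) and equals it by maximality,
    so factors p can be cancelled modulo (aR : x). Applied to p^i (p^m - 1) in aR, this puts p^m - 1
    into P next to p^m, and 1 would lie in P.\<close>
  have local: "\<exists>s. algebraic_int s \<and> s \<notin> P \<and> s * p \<in> colon a x" if p: "p \<in> P" for p
  proof (rule ccontr)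
    assume neg: "\<not> ?thesis"
    have pi: "algebraic_int p" using P_integral p by blast
    have iff: "s \<in> colon a (p * x) \<longleftrightarrow> algebraic_int s \<and> s * p \<in> colon a x" for s
      using pi by (auto simp: colon_def mult.assoc)
    have "colon a (p * x) \<subseteq> P" using neg iff by blast
    then have "colon a (p * x) \<in> \<J>" using pi x(1) by (auto simp: \<J>_def)
    moreover have "colon a x \<subseteq> colon a (p * x)"
      using iff integral_idealD(1,5)[OF J] pi by blast
    ultimately have eq: "colon a (p * x) = colon a x" using max x(2) by blast
    have desc: "s * p ^ n \<in> colon a x \<Longrightarrow> algebraic_int s \<Longrightarrow> s \<in> colon a x" for s n
    proof (induction n arbitrary: s)
      case (Suc n)
      have "(s * p) * p ^ n \<in> colon a x" using Suc.prems(1) by (simp add: mult.assoc)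
      then have "s * p \<in> colon a x" using Suc.IH[of "s * p"] Suc.prems(2) pi by simp
      then show ?case using iff eq Suc.prems(2) by blast
    qed simp
    obtain i m y where m: "m > 0" and y: "algebraic_int y" "p ^ i * (p ^ m - 1) = a * y"
      using power_congruence[OF nf a(3,2) pi] .
    have "(p ^ m - 1) * p ^ i \<in> colon a x" using a_colon[OF x(1) y(1)] y(2) by (simp add: mult.commute)
    then have 1: "p ^ m - 1 \<in> P" using desc pi x(3) by (meson algebraic_int_1 algebraic_int_diff algebraic_int_power subsetD)
    have 2: "p ^ m \<in> P"
      using P_mult_left[OF _ p, of "p ^ (m - 1)"] pi power_minus_mult[OF m, of p] by simp
    from P_diff[OF 2 1] one_notin_P show False by simp
  qed
  obtain S where S: "finite S"
    "\<forall>x. algebraic_int x \<longrightarrow> (\<exists>s\<in>S. \<exists>y. algebraic_int y \<and> x = s + a * y)"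
    using finite_quotient_nonzero[OF nf a(3,2)] unfolding finite_quotient_def by blast
  \<comment> \<open>The elements s found for single p are multiplied together. Since P is generated
    by aR and the finitely many representatives in it, finitely many factors suffice.\<close>
  have "\<exists>s. algebraic_int s \<and> s \<notin> P \<and> (\<forall>\<sigma>\<in>T. s * \<sigma> \<in> colon a x)" if "finite T" "T \<subseteq> P" for T
    using that
  proof (induction rule: finite_induct)
    case empty
    then show ?case using one_notin_P by (intro exI[of _ 1]) simp
  next
    case (insert p T)
    then obtain s where s: "algebraic_int s" "s \<notin> P" "\<forall>\<sigma>\<in>T. s * \<sigma> \<in> colon a x" by auto
    obtain r where r: "algebraic_int r" "r \<notin> P" "r * p \<in> colon a x" using local insert.prems by blast
    have "r * s \<notin> P" using P_prime r s by blast
    moreover have "r * s * \<sigma> \<in> colon a x" if "\<sigma> \<in> T" for \<sigma>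
      using integral_idealD(4)[OF J r(1), of "s * \<sigma>"] s(3) that by (simp add: mult.assoc)
    moreover have "r * s * p \<in> colon a x"
      using integral_idealD(4)[OF J s(1) r(3)] by (simp add: mult_ac)
    ultimately show ?case using r(1) s(1) by (intro exI[of _ "r * s"]) auto
  qed
  from this[of "S \<inter> P"] obtain s where s: "algebraic_int s" "s \<notin> P" "\<forall>\<sigma>\<in>S \<inter> P. s * \<sigma> \<in> colon a x"
    using S(1) by auto
  have sp: "s * p \<in> colon a x" if p: "p \<in> P" for p
  proof -
    obtain \<sigma> y where sy: "\<sigma> \<in> S" "algebraic_int y" "p = \<sigma> + a * y" using S(2) P_integral p by blast
    have "\<sigma> = p - a * y" using sy(3) by simp
    then have "\<sigma> \<in> P" using P_diff[OF p P_mult_right[OF sy(2) a(1)]] by simp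
    then have "s * \<sigma> \<in> colon a x" using s(3) sy(1) by blast
    moreover have "a * (s * y) \<in> colon a x" using a_colon[OF x(1)] s(1) sy(2) by simp
    ultimately have "s * \<sigma> + a * (s * y) \<in> colon a x" by (rule integral_idealD(3)[OF J])
    then show ?thesis unfolding sy(3) by (simp add: algebra_simps)
  qed
  show ?thesis
  proof (rule that[of "s * x / a"])
    show "\<not> algebraic_int (s * x / a)"
    proof
      assume "algebraic_int (s * x / a)"
      then have "s \<in> colon a x" using s(1) a(2) by (auto simp: colon_def intro!: exI[of _ "s * x / a"])
      then show False using x(3) s(2) by blast
    qed
    fix p assume "p \<in> P"
    then obtain y where "algebraic_int y" "s * p * x = a * y" using sp by (auto simp: colon_def)
    then show "algebraic_int (s * x / a * p)" using a(2) by (simp add: field_simps)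
  qed
qed

text \<open>The ideals \<open>M n\<close> generated by a, t a, ..., t^(n-1) a contain a for n > 0,
  so two of them coincide. Then some t^n a is a combination over R of lower terms, and dividing by a
  gives a monic equation for t.\<close>

lemma algebraic_int_if_multiplier:
  assumes t: "\<And>p. p \<in> P \<Longrightarrow> t * p \<in> P"
  shows "algebraic_int t"
proof -
  obtain a where a: "a \<in> P" "a \<noteq> 0" "algebraic_int a" by (rule obtain_nonzero)
  have tna: "t ^ n * a \<in> P" for n by (induction n) (use a t in \<open>auto simp: mult.assoc\<close>)
  define M where "M n = {\<Sum>i<n. c i * (t ^ i * a) | c. \<forall>i. algebraic_int (c i)}" for n
  have ideal_M: "integral_ideal (M n)" for n
  proof (rule integral_idealI)
    fix x assume "x \<in> M n"
    then show "algebraic_int x"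
      using P_integral[OF tna] by (auto simp: M_def intro!: algebraic_int_sum)
  next
    show "0 \<in> M n" by (auto simp: M_def intro!: exI[of _ "\<lambda>_. 0"])
  next
    fix x y assume "x \<in> M n" "y \<in> M n"
    then obtain c d where "x = (\<Sum>i<n. c i * (t ^ i * a))" "y = (\<Sum>i<n. d i * (t ^ i * a))"
      "\<forall>i. algebraic_int (c i)" "\<forall>i. algebraic_int (d i)" by (auto simp: M_def)
    then show "x + y \<in> M n"
      by (auto simp: M_def distrib_right sum.distrib intro!: exI[of _ "\<lambda>i. c i + d i"])
  next
    fix r x :: 'k assume "algebraic_int r" "x \<in> M n"
    moreover from this obtain c where "x = (\<Sum>i<n. c i * (t ^ i * a))" "\<forall>i. algebraic_int (c i)"
      by (auto simp: M_def)
    ultimately show "r * x \<in> M n"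
      by (auto simp: M_def sum_distrib_left mult.assoc intro!: exI[of _ "\<lambda>i. r * c i"])
  qed
  have mem: "t ^ i * a \<in> M n" if "i < n" for i n
    unfolding M_def
  proof (intro CollectI exI[of _ "\<lambda>j. if j = i then 1 else 0"] conjI allI)
    show "t ^ i * a = (\<Sum>j<n. (if j = i then 1 else 0) * (t ^ j * a))"
      using that by (simp add: if_distribR if_distrib[where f = "\<lambda>x. x * _"] cong: if_cong)
  qed simp
  \<comment> \<open>The index is shifted because \<open>M 0\<close> is the zero ideal, which does
    not contain a.\<close>
  have "M (Suc n) \<in> {I. integral_ideal I \<and> a \<in> I}" for n
    using ideal_M[of "Suc n"] mem[of 0 "Suc n"] by simp
  then obtain m n where mn: "m < n" "M (Suc m) = M (Suc n)"
    using pigeonhole_nat[OF finite_ideals_containing[OF nf a(3,2)], of "\<lambda>n. M (Suc n)"]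
    by blast
  then have "t ^ Suc m * a \<in> M (Suc m)" using mem[of "Suc m" "Suc n"] by simp
  then obtain c where c: "t ^ Suc m * a = (\<Sum>i<Suc m. c i * (t ^ i * a))" "\<And>i. algebraic_int (c i)"
    unfolding M_def by blast
  have "t ^ Suc m * a = (\<Sum>i<Suc m. c i * t ^ i) * a"
    unfolding c(1) sum_distrib_right by (simp only: mult.assoc)
  then have "t ^ Suc m = (\<Sum>i<Suc m. c i * t ^ i)" using a(2) mult_right_cancel by blast
  then show ?thesis using c(2) by (rule algebraic_int_integrally_closed)
qed

text \<open>t belongs to the inverse ideal of P but not to R, and t \<pi> is a unit at P. So \<pi>
  has exponent exactly 1, and t plays the role of its inverse at P.\<close>

definition uniformizing :: "'k \<Rightarrow> 'k \<Rightarrow> bool" where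
  "uniformizing t \<pi> \<longleftrightarrow> \<not> algebraic_int t \<and> (\<forall>p\<in>P. algebraic_int (t * p)) \<and> \<pi> \<in> P \<and> t * \<pi> \<notin> P"

text \<open>If t \<pi> stayed in P for every \<pi> in P, then t would preserve P and be
  integral.\<close>

lemma uniformizing_exists: "\<exists>t \<pi>. uniformizing t \<pi>"
proof -
  obtain t where t: "\<not> algebraic_int t" "\<And>p. p \<in> P \<Longrightarrow> algebraic_int (t * p)"
    using dual_element by metis
  then show ?thesis using algebraic_int_if_multiplier unfolding uniformizing_def by blast
qed

section \<open>Powers of P and the exponent of an element\<close>

lemma P_pow_simps: "ideal_pow P 0 = {x. algebraic_int x}" "ideal_pow P (Suc n) = ideal_prod integer_ring (ideal_pow P n) P"
  by (simp_all add: nat_pow_def ideals_set_def)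

lemma P_pow_ideal: "ideal (ideal_pow P n) integer_ring"
proof (induction n)
  case 0
  interpret cring "integer_ring :: 'k ring" by (rule cring_integer_ring)
  show ?case unfolding P_pow_simps using oneideal by simp
next
  case (Suc n)
  interpret cring "integer_ring :: 'k ring" by (rule cring_integer_ring)
  have "ideal P integer_ring" using prime by (auto simp: prime_ideals_def primeideal_def)
  then show ?case unfolding P_pow_simps using ideal_prod_is_ideal Suc by blast
qed

lemma ideal_P_pow: "integral_ideal (ideal_pow P n)"
  by (rule integral_ideal_if_ideal[OF P_pow_ideal])

lemma P_pow_Suc_mult: "x \<in> ideal_pow P n \<Longrightarrow> y \<in> P \<Longrightarrow> x * y \<in> ideal_pow P (Suc n)"
  unfolding P_pow_simps using ideal_prod.prod[of x "ideal_pow P n" y P integer_ring] by simp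

lemma power_mem_P_pow: "x \<in> P \<Longrightarrow> x ^ n \<in> ideal_pow P n"
proof (induction n)
  case 0
  then show ?case by (simp add: P_pow_simps)
next
  case (Suc n)
  then show ?case using P_pow_Suc_mult[of "x ^ n" n x] by (simp add: mult.commute)
qed

lemma P_pow_antimono: "m \<le> n \<Longrightarrow> ideal_pow P n \<subseteq> ideal_pow P m"
proof (induction n rule: dec_induct)
  case (step n)
  have "ideal_pow P (Suc n) \<subseteq> ideal_pow P n"
  proof
    fix x assume "x \<in> ideal_pow P (Suc n)"
    then have "x \<in> ideal_prod integer_ring (ideal_pow P n) P" unfolding P_pow_simps .
    then show "x \<in> ideal_pow P n"
    proof (induction rule: ideal_prod.induct)
      case (prod i j)
      then show ?case using integral_idealD(5)[OF ideal_P_pow] P_integral by simp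
    next
      case (sum s1 s2)
      then show ?case using integral_idealD(3)[OF ideal_P_pow] by simp
    qed
  qed
  then show ?case using step by blast
qed simp

context
  fixes t \<pi> assumes unif: "uniformizing t \<pi>"
begin

lemma unifD: "\<not> algebraic_int t" "p \<in> P \<Longrightarrow> algebraic_int (t * p)" "\<pi> \<in> P" "t * \<pi> \<notin> P"
  "algebraic_int (t * \<pi>)"
  using unif by (auto simp: uniformizing_def)

text \<open>One direction is visible on the products that generate P^n. For the other, r inverts t
  \<pi> modulo P^n, so x differs from x (t \<pi> r)^n = (t^n x) r^n \<pi>^n by an element of P^n,
  and the latter product carries the factor \<pi>^n.\<close>

lemma mem_P_pow_iff: "x \<in> ideal_pow P n \<longleftrightarrow> algebraic_int x \<and> algebraic_int (t ^ n * x)"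
proof
  have "algebraic_int (t ^ n * x)" if "x \<in> ideal_pow P n" using that
  proof (induction n arbitrary: x)
    case 0
    then show ?case by (simp add: P_pow_simps)
  next
    case (Suc n)
    from Suc.prems have "x \<in> ideal_prod integer_ring (ideal_pow P n) P" unfolding P_pow_simps .
    then show ?case
    proof (induction rule: ideal_prod.induct)
      case (prod i j)
      have "t ^ Suc n * (i * j) = (t ^ n * i) * (t * j)" by (simp add: mult_ac)
      then show ?case
        using algebraic_int_mult[OF Suc.IH[OF prod(1)] unifD(2)[OF prod(2)]]
        by (simp only: integer_ring_simps)
    qed (simp add: distrib_left)
  qed
  then show "x \<in> ideal_pow P n \<Longrightarrow> algebraic_int x \<and> algebraic_int (t ^ n * x)"
    using integral_idealD(1)[OF ideal_P_pow] by blast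
next
  assume x: "algebraic_int x \<and> algebraic_int (t ^ n * x)"
  obtain y where y: "algebraic_int y" "1 - t * \<pi> * y \<in> P" using inverse_mod_P[OF unifD(5,4)] .
  define q where "q = 1 - t * \<pi> * y"
  have q: "q \<in> P" "algebraic_int q" using y P_integral by (auto simp: q_def)
  \<comment> \<open>Since 1 - q = t \<pi> y, the geometric sum inverts t \<pi> y up to q^n. This
    lifts the inverse y modulo P to an inverse modulo P^n.\<close>
  define r where "r = y * (\<Sum>i<n. q ^ i)"
  have r: "algebraic_int r" using y(1) q(2) unfolding r_def by (intro algebraic_int_mult algebraic_int_sum) simp_all
  have "t * \<pi> * r = (1 - q) * (\<Sum>i<n. q ^ i)" by (simp add: r_def q_def mult.assoc)
  also have "\<dots> = 1 - q ^ n" using sum_gp_basic[of q] one_diff_power_eq[of q n] by simp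
  finally have eq: "t * \<pi> * r = 1 - q ^ n" .
  define e where "e = 1 - (1 - q ^ n) ^ n"
  have e: "e \<in> ideal_pow P n" unfolding e_def
    by (rule ideal_one_minus_power[OF ideal_P_pow power_mem_P_pow[OF q(1)]])
  have "x = x * (t * \<pi> * r) ^ n + x * e" unfolding eq e_def by (simp add: algebra_simps)
  also have "x * (t * \<pi> * r) ^ n = (t ^ n * x * r ^ n) * \<pi> ^ n"
    by (simp add: power_mult_distrib mult_ac)
  finally have "x = (t ^ n * x * r ^ n) * \<pi> ^ n + x * e" .
  moreover have "(t ^ n * x * r ^ n) * \<pi> ^ n \<in> ideal_pow P n"
    using x r by (intro integral_idealD(4)[OF ideal_P_pow] power_mem_P_pow unifD(3)) simp
  moreover have "x * e \<in> ideal_pow P n" using x by (intro integral_idealD(4)[OF ideal_P_pow] e) simp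
  ultimately show "x \<in> ideal_pow P n" using integral_idealD(3)[OF ideal_P_pow] by metis
qed

text \<open>If x lay in every P^n, two of these powers would coincide, since only finitely many
  ideals contain x. Then \<pi>^m lies in P^(m+1), so t (t \<pi>)^m is integral, and inverting (t
  \<pi>)^m modulo P makes t itself integral.\<close>

lemma P_pow_bounded:
  assumes x: "algebraic_int x" "x \<noteq> 0"
  shows "\<exists>n. x \<notin> ideal_pow P n"
proof (rule ccontr)
  assume "\<not> ?thesis"
  then have "ideal_pow P n \<in> {I. integral_ideal I \<and> x \<in> I}" for n using ideal_P_pow by simp
  then obtain m n where mn: "m < n" "ideal_pow P m = ideal_pow P n"
    using pigeonhole_nat[OF finite_ideals_containing[OF nf x], of "ideal_pow P"] by blast
  then have "\<pi> ^ m \<in> ideal_pow P (Suc m)"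
    using power_mem_P_pow[OF unifD(3), of m] P_pow_antimono[of "Suc m" n] by auto
  then have 1: "algebraic_int (t ^ Suc m * \<pi> ^ m)" using mem_P_pow_iff by blast
  have "(t * \<pi>) ^ m \<notin> P" using P_power unifD by blast
  then obtain y where y: "algebraic_int y" "1 - (t * \<pi>) ^ m * y \<in> P"
    using inverse_mod_P[of "(t * \<pi>) ^ m"] unifD(5) by auto
  have "t = t ^ Suc m * \<pi> ^ m * y + t * (1 - (t * \<pi>) ^ m * y)"
    by (simp add: algebra_simps power_mult_distrib)
  moreover have "algebraic_int \<dots>" using 1 y unifD(2) by simp
  ultimately show False using unifD(1) by simp
qed

text \<open>If x lay in P^(n+1), then t^(n+1) x would be integral and its product with \<pi> would
  lie in P. That product is (t \<pi>)(t^n x), with both factors outside P.\<close>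

lemma mem_P_pow_imp_le:
  assumes "algebraic_int (t ^ n * x)" "t ^ n * x \<notin> P" "x \<in> ideal_pow P m"
  shows "m \<le> n"
proof (rule ccontr)
  assume "\<not> m \<le> n"
  then have "x \<in> ideal_pow P (Suc n)" using assms(3) P_pow_antimono[of "Suc n" m] by auto
  then have "algebraic_int (t ^ Suc n * x)" using mem_P_pow_iff by blast
  then have "t ^ Suc n * x * \<pi> \<in> P" using P_mult_left[OF _ unifD(3)] by blast
  then have "(t * \<pi>) * (t ^ n * x) \<in> P" by (simp add: mult_ac)
  then show False using P_prime[OF unifD(5) assms(1)] assms(2) unifD(4) by blast
qed

text \<open>The exponent is the n for which t^n x is integral and a unit at P; in this form it is
  visibly additive on products.\<close>

lemma int_valuation_eqI:
  assumes "algebraic_int x" "algebraic_int (t ^ n * x)" "t ^ n * x \<notin> P"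
  shows "int_valuation P x = n"
  unfolding int_valuation_def
  using assms mem_P_pow_iff mem_P_pow_imp_le[OF assms(2,3)] by (intro Greatest_equality) blast+

lemma int_valuation_spec:
  assumes x: "algebraic_int x" "x \<noteq> 0"
  shows "algebraic_int (t ^ int_valuation P x * x)" "t ^ int_valuation P x * x \<notin> P"
proof -
  obtain n where n: "x \<notin> ideal_pow P n" using P_pow_bounded[OF x] by blast
  obtain m where m: "x \<in> ideal_pow P m" "\<And>k. x \<in> ideal_pow P k \<Longrightarrow> k \<le> m"
  proof -
    have "x \<in> ideal_pow P 0" using x by (simp add: P_pow_simps)
    moreover have "k < n" if "x \<in> ideal_pow P k" for k
      using n that P_pow_antimono[of n k] by (meson not_less subsetD)
    ultimately show ?thesis
      using that ex_has_greatest_nat[of "\<lambda>k. x \<in> ideal_pow P k" 0 id n] by auto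
  qed
  have 1: "algebraic_int (t ^ m * x)" using m(1) mem_P_pow_iff by blast
  have 2: "t ^ m * x \<notin> P"
  proof
    assume "t ^ m * x \<in> P"
    then have "algebraic_int (t * (t ^ m * x))" by (rule unifD(2))
    then have "algebraic_int (t ^ Suc m * x)" by (simp add: mult.assoc)
    then have "x \<in> ideal_pow P (Suc m)" using x(1) mem_P_pow_iff by blast
    then have "Suc m \<le> m" by (rule m(2))
    then show False by simp
  qed
  have "int_valuation P x = m" by (rule int_valuation_eqI[OF x(1) 1 2])
  then show "algebraic_int (t ^ int_valuation P x * x)" "t ^ int_valuation P x * x \<notin> P"
    using 1 2 by simp_all
qed

end

text \<open>The product of two integral elements outside P is outside P, so the powers of t that
  make x and y units at P combine.\<close>

lemma int_valuation_mult:
  assumes "algebraic_int x" "x \<noteq> 0" "algebraic_int y" "y \<noteq> 0"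
  shows "int_valuation P (x * y) = int_valuation P x + int_valuation P y"
proof -
  obtain t \<pi> where u: "uniformizing t \<pi>" using uniformizing_exists by blast
  note X = int_valuation_spec[OF u assms(1,2)] and Y = int_valuation_spec[OF u assms(3,4)]
  have eq: "t ^ (int_valuation P x + int_valuation P y) * (x * y) =
    (t ^ int_valuation P x * x) * (t ^ int_valuation P y * y)" by (simp add: power_add mult_ac)
  have "(t ^ int_valuation P x * x) * (t ^ int_valuation P y * y) \<notin> P"
    using P_prime[OF X(1) Y(1)] X(2) Y(2) by blast
  then show ?thesis
    using X(1) Y(1) assms by (intro int_valuation_eqI[OF u]) (simp_all only: eq algebraic_int_mult not_False_eq_True)
qed

lemma mem_P_pow_iff_int_valuation:
  assumes "algebraic_int x" "x \<noteq> 0"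
  shows "x \<in> ideal_pow P n \<longleftrightarrow> n \<le> int_valuation P x"
proof
  obtain t \<pi> where u: "uniformizing t \<pi>" using uniformizing_exists by blast
  note X = int_valuation_spec[OF u assms]
  have "x \<in> ideal_pow P (int_valuation P x)" using X(1) assms(1) mem_P_pow_iff[OF u] by blast
  then show "n \<le> int_valuation P x \<Longrightarrow> x \<in> ideal_pow P n" using P_pow_antimono by blast
  show "x \<in> ideal_pow P n \<Longrightarrow> n \<le> int_valuation P x" by (rule mem_P_pow_imp_le[OF u X])
qed

lemma int_valuation_eq_0: "algebraic_int x \<Longrightarrow> x \<notin> P \<Longrightarrow> int_valuation P x = 0"
  using uniformizing_exists int_valuation_eqI[of _ _ x 0] by auto

lemma int_valuation_1: "int_valuation P 1 = 0"
  using int_valuation_eq_0 one_notin_P by simp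

section \<open>The P-adic absolute value on K\<close>

text \<open>The definite description is legitimate: cross-multiplying two fractions for the same
  element and taking exponents gives the same difference.\<close>

lemma valuation_divide:
  assumes "algebraic_int a" "algebraic_int b" "a \<noteq> 0" "b \<noteq> 0"
  shows "valuation P (a / b) = int (int_valuation P a) - int (int_valuation P b)"
  unfolding valuation_def
proof (rule the_equality)
  show "\<exists>c d. algebraic_int c \<and> algebraic_int d \<and> c \<noteq> 0 \<and> d \<noteq> 0 \<and> a / b = c / d \<and>
    int (int_valuation P a) - int (int_valuation P b) = int (int_valuation P c) - int (int_valuation P d)"
    using assms by blast
  fix v assume "\<exists>c d. algebraic_int c \<and> algebraic_int d \<and> c \<noteq> 0 \<and> d \<noteq> 0 \<and> a / b = c / d \<and>
    v = int (int_valuation P c) - int (int_valuation P d)"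
  then obtain c d where cd: "algebraic_int c" "algebraic_int d" "c \<noteq> 0" "d \<noteq> 0" "a / b = c / d"
    and v: "v = int (int_valuation P c) - int (int_valuation P d)" by blast
  have "a * d = c * b" using cd(3,4,5) assms(4) by (simp add: frac_eq_eq)
  then have "int_valuation P a + int_valuation P d = int_valuation P c + int_valuation P b"
    using int_valuation_mult assms cd by metis
  then show "v = int (int_valuation P a) - int (int_valuation P b)" using v by linarith
qed

lemma integral_fraction:
  fixes x :: 'k
  obtains a b where "algebraic_int a" "algebraic_int b" "b \<noteq> 0" "x = a / b"
proof -
  obtain d :: int where "d > 0" "algebraic_int (of_int d * x)" using number_field_denominator[OF nf] .
  then show ?thesis using that[of "of_int d * x" "of_int d"] by simp
qed

lemma abs_val_0 [simp]: "abs_val P 0 = 0"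
  by (simp add: abs_val_def)

lemma abs_val_pos: "x \<noteq> 0 \<Longrightarrow> abs_val P x > 0"
  by (simp add: abs_val_def)

lemma abs_val_nonneg [simp]: "abs_val P x \<ge> 0"
  by (simp add: abs_val_def)

lemma abs_val_integral:
  assumes "algebraic_int a" "a \<noteq> 0"
  shows "abs_val P a = 2 powi (- int (int_valuation P a))"
  using valuation_divide[of a 1] assms int_valuation_1 by (simp add: abs_val_def)

lemma abs_val_divide:
  assumes "algebraic_int a" "algebraic_int b" "b \<noteq> 0"
  shows "abs_val P (a / b) = abs_val P a / abs_val P b"
proof (cases "a = 0")
  case False
  then have "abs_val P (a / b) = 2 powi (- int (int_valuation P a) - - int (int_valuation P b))"
    using valuation_divide[of a b] assms by (simp add: abs_val_def)
  also have "\<dots> = abs_val P a / abs_val P b"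
    using assms False power_int_diff[of "2::real" "- int (int_valuation P a)" "- int (int_valuation P b)"]
    by (simp add: abs_val_integral)
  finally show ?thesis .
qed simp

lemma abs_val_mult_integral:
  assumes "algebraic_int a" "algebraic_int b"
  shows "abs_val P (a * b) = abs_val P a * abs_val P b"
proof (cases "a = 0 \<or> b = 0")
  case False
  then have "abs_val P (a * b) = 2 powi (- int (int_valuation P a) + - int (int_valuation P b))"
    using assms abs_val_integral[of "a * b"] int_valuation_mult[of a b] by simp
  also have "\<dots> = abs_val P a * abs_val P b"
    using assms False power_int_add[of "2::real" "- int (int_valuation P a)" "- int (int_valuation P b)"]
    by (simp add: abs_val_integral)
  finally show ?thesis .
qed auto

lemma abs_val_mult: "abs_val P (x * y) = abs_val P x * abs_val P y"
proof -
  obtain a b where ab: "algebraic_int a" "algebraic_int b" "b \<noteq> 0" "x = a / b" by (rule integral_fraction)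
  obtain c d where cd: "algebraic_int c" "algebraic_int d" "d \<noteq> 0" "y = c / d" by (rule integral_fraction)
  have "x * y = (a * c) / (b * d)" using ab cd by simp
  then show ?thesis
    using ab cd abs_val_divide[of "a * c" "b * d"] abs_val_divide[of a b] abs_val_divide[of c d]
      abs_val_mult_integral[of a c] abs_val_mult_integral[of b d] by simp
qed

lemma abs_val_1 [simp]: "abs_val P 1 = 1"
  using abs_val_integral[of 1] int_valuation_1 by simp

lemma abs_val_minus [simp]: "abs_val P (- x) = abs_val P x"
proof -
  have "abs_val P (- 1) * abs_val P (- 1) = 1" using abs_val_mult[of "-1" "-1"] by simp
  then have "abs_val P (- 1) = 1"
    by (metis abs_val_nonneg abs_of_nonneg abs_mult_self_eq power2_eq_square real_sqrt_abs2 real_sqrt_one)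
  then show ?thesis using abs_val_mult[of "-1" x] by simp
qed

lemma abs_val_inverse: "abs_val P (inverse x) = inverse (abs_val P x)"
proof (cases "x = 0")
  case False
  then have "abs_val P x * abs_val P (inverse x) = 1" using abs_val_mult[of x "inverse x"] by simp
  then show ?thesis by (simp add: inverse_unique)
qed simp

lemma abs_val_le_iff_P_pow:
  assumes "algebraic_int x"
  shows "x \<in> ideal_pow P n \<longleftrightarrow> abs_val P x \<le> 2 powi (- int n)"
proof (cases "x = 0")
  case True
  then show ?thesis using integral_idealD(2)[OF ideal_P_pow] by simp
next
  case False
  then show ?thesis
    using mem_P_pow_iff_int_valuation[OF assms False] abs_val_integral[OF assms False]
    by (simp add: power_int_minus)
qed

lemma abs_val_le_1: "algebraic_int x \<Longrightarrow> abs_val P x \<le> 1"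
  using abs_val_le_iff_P_pow[of x 0] by (simp add: P_pow_simps)

text \<open>For integral a and b with |b| \<le> |a|, both lie in P^n, where n is the exponent of a,
  and P^n is closed under addition. The general case follows after multiplication by the inverse of
  a common denominator.\<close>

lemma abs_val_add: "abs_val P (x + y) \<le> max (abs_val P x) (abs_val P y)"
proof -
  have int: "abs_val P (a + b) \<le> abs_val P a"
    if ab: "algebraic_int a" "algebraic_int b" "abs_val P b \<le> abs_val P a" for a b
  proof (cases "a = 0")
    case True
    then show ?thesis using ab abs_val_nonneg[of b] by (metis add_0 order_antisym abs_val_0 order_refl)
  next
    case False
    define n where "n = int_valuation P a"
    have eq: "abs_val P a = 2 powi (- int n)" using abs_val_integral[OF ab(1) False] by (simp add: n_def)
    have "a \<in> ideal_pow P n" "b \<in> ideal_pow P n" using ab eq abs_val_le_iff_P_pow by auto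
    then have "a + b \<in> ideal_pow P n" by (rule integral_idealD(3)[OF ideal_P_pow])
    then show ?thesis using eq abs_val_le_iff_P_pow[of "a + b" n] ab by simp
  qed
  obtain a b where ab: "algebraic_int a" "algebraic_int b" "b \<noteq> 0" "x = a / b" by (rule integral_fraction)
  obtain c d where cd: "algebraic_int c" "algebraic_int d" "d \<noteq> 0" "y = c / d" by (rule integral_fraction)
  have i: "algebraic_int (a * d)" "algebraic_int (c * b)" "algebraic_int (b * d)" using ab cd by simp_all
  have "abs_val P (a * d + c * b) \<le> max (abs_val P (a * d)) (abs_val P (c * b))"
    using int[OF i(1,2)] int[OF i(2,1)] by (auto simp: max_def add.commute)
  then have "abs_val P (a * d + c * b) * abs_val P (inverse (b * d)) \<le>
    max (abs_val P (a * d)) (abs_val P (c * b)) * abs_val P (inverse (b * d))"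
    by (intro mult_right_mono) simp_all
  also have "\<dots> = max (abs_val P (a * d * inverse (b * d))) (abs_val P (c * b * inverse (b * d)))"
    by (simp add: max_mult_distrib_right abs_val_mult)
  finally have "abs_val P ((a * d + c * b) * inverse (b * d)) \<le> \<dots>" unfolding abs_val_mult .
  moreover have "(a * d + c * b) * inverse (b * d) = x + y" "a * d * inverse (b * d) = x"
    "c * b * inverse (b * d) = y" using ab cd by (simp_all add: field_simps)
  ultimately show ?thesis by simp
qed

text \<open>A nonzero element of P has absolute value at most 1/2, so its powers tend to 0.\<close>

lemma abs_val_arbitrarily_small:
  assumes "\<epsilon> > 0"
  obtains x where "x \<noteq> 0" "abs_val P x < \<epsilon>"
proof -
  obtain a where a: "a \<in> P" "a \<noteq> 0" "algebraic_int a" by (rule obtain_nonzero)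
  have "a \<in> ideal_pow P (Suc 0)" using power_mem_P_pow[of a "Suc 0"] a by simp
  then have le: "abs_val P a \<le> 1 / 2"
    using abs_val_le_iff_P_pow[OF a(3), of "Suc 0"] by (simp add: power_int_minus field_simps)
  have pow: "abs_val P (a ^ n) = abs_val P a ^ n" for n by (induction n) (simp_all add: abs_val_mult)
  obtain n where "abs_val P a ^ n < \<epsilon>" using real_arch_pow_inv[OF assms, of "abs_val P a"] le by auto
  then show ?thesis using that[of "a ^ n"] a(2) pow by simp
qed

end

section \<open>Several primes at once\<close>

lemma finite_primes_containing:
  assumes "number_field TYPE('k::field_char_0)" "algebraic_int (a::'k)" "a \<noteq> 0"
  shows "finite {P \<in> prime_ideals. a \<in> P}"
  by (rule finite_subset[OF _ finite_ideals_containing[OF assms]])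
    (auto simp: number_field_prime.ideal_P[OF number_field_prime.intro[OF assms(1)]])

text \<open>If d x is integral for a positive integer d, then |x| > 1 is possible only at primes
  containing d. This is what places K inside the adeles.\<close>

lemma finite_abs_val_gt_1:
  assumes nf: "number_field TYPE('k::field_char_0)"
  shows "finite {P \<in> prime_ideals. abs_val P (x::'k) > 1}"
proof -
  obtain d :: int where d: "d > 0" "algebraic_int (of_int d * x)" using number_field_denominator[OF nf] .
  have "of_int d \<in> P" if P: "P \<in> prime_ideals" "abs_val P x > 1" for P
  proof (rule ccontr)
    assume neg: "of_int d \<notin> P"
    interpret number_field_prime P using nf P(1) by unfold_locales
    have "abs_val P (of_int d) = 1"
      using abs_val_integral[of "of_int d"] int_valuation_eq_0[OF _ neg] d(1) by simp
    moreover have "abs_val P (of_int d * x) \<le> 1" by (rule abs_val_le_1[OF d(2)])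
    ultimately show False using P(2) abs_val_mult by simp
  qed
  then have "{P \<in> prime_ideals. abs_val P x > 1} \<subseteq> {P \<in> prime_ideals. of_int d \<in> P}" by blast
  then show ?thesis using finite_primes_containing[OF nf, of "of_int d"] d(1) finite_subset by auto
qed

text \<open>Distinct nonzero primes are incomparable because they are maximal, so some q in Q is
  congruent to 1 modulo P. For e = 1 - (1 - q^n)^n, membership of q^n in Q^n puts e into Q^n, and 1
  - e is divisible by (1 - q)^n.\<close>

lemma comaximal_powers:
  assumes nf: "number_field TYPE('k::field_char_0)"
    and P: "P \<in> prime_ideals" and Q: "Q \<in> prime_ideals" and neq: "P \<noteq> (Q :: 'k set)"
  obtains e where "e \<in> ideal_pow Q n" "1 - e \<in> ideal_pow P n"
proof -
  interpret P: number_field_prime P using nf P by unfold_locales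
  interpret Q: number_field_prime Q using nf Q by unfold_locales
  have "\<not> P \<subseteq> Q"
  proof
    assume sub: "P \<subseteq> Q"
    then obtain x where x: "x \<in> Q" "x \<notin> P" using neq by blast
    obtain y where y: "algebraic_int y" "1 - x * y \<in> P" using P.inverse_mod_P[OF Q.P_integral[OF x(1)] x(2)] .
    then have "(1 - x * y) + x * y \<in> Q" using sub x(1) by (intro Q.P_add Q.P_mult_right) auto
    then show False using Q.one_notin_P by simp
  qed
  then obtain p where p: "p \<in> P" "p \<notin> Q" by blast
  obtain y where y: "algebraic_int y" "1 - p * y \<in> Q" using Q.inverse_mod_P[OF P.P_integral[OF p(1)] p(2)] .
  define q where "q = 1 - p * y"
  have q: "q \<in> Q" "1 - q \<in> P" using y P.P_mult_right[OF y(1) p(1)] by (simp_all add: q_def)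
  have qi: "algebraic_int q" by (rule Q.P_integral[OF q(1)])
  define e where "e = 1 - (1 - q ^ n) ^ n"
  have "e \<in> ideal_pow Q n" unfolding e_def
    by (rule ideal_one_minus_power[OF Q.ideal_P_pow Q.power_mem_P_pow[OF q(1)]])
  moreover have "1 - e \<in> ideal_pow P n"
  proof -
    have "1 - e = (\<Sum>i<n. q ^ i) ^ n * (1 - q) ^ n"
      unfolding e_def using one_diff_power_eq[of q n] by (simp add: power_mult_distrib mult.commute)
    then show ?thesis
      using P.power_mem_P_pow[OF q(2), of n] qi
      by (auto intro!: integral_idealD(4)[OF P.ideal_P_pow] algebraic_int_power algebraic_int_sum)
  qed
  ultimately show ?thesis by (rule that)
qed

text \<open>Interpolation: the product of the \<open>e P Q\<close> over Q \<noteq> P is congruent to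
  1 modulo P^n and to 0 modulo each other Q^n.\<close>

lemma chinese_remainder_primes:
  assumes nf: "number_field TYPE('k::field_char_0)" and G: "finite G" "G \<subseteq> prime_ideals"
    and f: "\<And>P. P \<in> G \<Longrightarrow> algebraic_int (f P :: 'k)"
  obtains y where "algebraic_int y" "\<And>P. P \<in> G \<Longrightarrow> y - f P \<in> ideal_pow P n"
proof -
  have loc: "number_field_prime P" if "P \<in> G" for P
    using nf G(2) that by (intro number_field_prime.intro) auto
  have "\<forall>P\<in>G. \<forall>Q\<in>G - {P}. \<exists>e. e \<in> ideal_pow Q n \<and> 1 - e \<in> ideal_pow P n"
    using comaximal_powers[OF nf] G(2) by (metis DiffE insertCI subsetD)
  then obtain e where e: "\<And>P Q. P \<in> G \<Longrightarrow> Q \<in> G - {P} \<Longrightarrow> e P Q \<in> ideal_pow Q n"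
    "\<And>P Q. P \<in> G \<Longrightarrow> Q \<in> G - {P} \<Longrightarrow> 1 - e P Q \<in> ideal_pow P n" by metis
  note idl = number_field_prime.ideal_P_pow[OF loc, of _ n]
  have ei: "algebraic_int (e P Q)" if "P \<in> G" "Q \<in> G - {P}" for P Q
    using e(1)[OF that] integral_idealD(1)[OF idl] that by blast
  define E where "E P = (\<Prod>Q\<in>G - {P}. e P Q)" for P
  have Ei: "algebraic_int (E P)" if "P \<in> G" for P
    unfolding E_def using ei that by (intro algebraic_int_prod) blast
  have E1: "1 - E P \<in> ideal_pow P n" if P: "P \<in> G" for P
  proof -
    have "1 - (\<Prod>Q\<in>H. e P Q) \<in> ideal_pow P n" if "finite H" "H \<subseteq> G - {P}" for H
      using that
    proof (induction rule: finite_induct)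
      case empty
      then show ?case using integral_idealD(2)[OF idl[OF P]] by simp
    next
      case (insert Q H)
      have "1 - (\<Prod>Q\<in>insert Q H. e P Q) = (1 - e P Q) + e P Q * (1 - (\<Prod>Q\<in>H. e P Q))"
        using insert by (simp add: algebra_simps)
      moreover have "1 - e P Q \<in> ideal_pow P n" using e(2) P insert by blast
      moreover have "e P Q * (1 - (\<Prod>Q\<in>H. e P Q)) \<in> ideal_pow P n"
        using ei P insert by (intro integral_idealD(4)[OF idl[OF P]]) auto
      ultimately show ?case using integral_idealD(3)[OF idl[OF P]] by metis
    qed
    then show ?thesis unfolding E_def using G(1) by blast
  qed
  have E0: "E P \<in> ideal_pow Q n" if "P \<in> G" "Q \<in> G - {P}" for P Q
  proof -
    have "E P = (\<Prod>Q\<in>G - {P} - {Q}. e P Q) * e P Q"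
      unfolding E_def using that G(1) by (subst prod.remove[of _ Q]) (auto simp: mult.commute)
    then show ?thesis using that ei e(1)
      by (auto intro!: integral_idealD(4)[OF idl] algebraic_int_prod)
  qed
  define y where "y = (\<Sum>P\<in>G. E P * f P)"
  show ?thesis
  proof (rule that[of y])
    show "algebraic_int y" unfolding y_def using Ei f by (intro algebraic_int_sum) simp
    fix P assume P: "P \<in> G"
    have sum_mem: "sum h H \<in> ideal_pow P n"
      if "finite H" "\<And>Q. Q \<in> H \<Longrightarrow> h Q \<in> ideal_pow P n" for h :: "'k set \<Rightarrow> 'k" and H
      using that by (induction rule: finite_induct) (auto intro: integral_idealD(2,3)[OF idl[OF P]])
    have "y - f P = (\<Sum>Q\<in>G - {P}. E Q * f Q) - (1 - E P) * f P"
      unfolding y_def using G(1) P by (subst sum.remove[of _ P]) (auto simp: algebra_simps)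
    moreover have "(\<Sum>Q\<in>G - {P}. E Q * f Q) \<in> ideal_pow P n"
      using G(1) P E0 f by (intro sum_mem integral_idealD(5)[OF idl[OF P]]) auto
    moreover have "(1 - E P) * f P \<in> ideal_pow P n"
      by (rule integral_idealD(5)[OF idl[OF P] f[OF P] E1[OF P]])
    ultimately show "y - f P \<in> ideal_pow P n"
      using integral_idealD(7)[OF idl[OF P]] by metis
  qed
qed

text \<open>An integer D clears the denominators of all \<open>f P\<close>, and congruences are
  solved for y = D x. Dividing by D can spoil integrality only at primes containing D, so these join
  F with target 0 and a precision finer than |D|.\<close>

theorem strong_approximation:
  fixes f :: "'k::field_char_0 set \<Rightarrow> 'k"
  assumes nf: "number_field TYPE('k)" and F: "finite F" "F \<subseteq> prime_ideals" and \<epsilon>: "\<epsilon> > 0"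
  obtains x where "\<And>P. P \<in> F \<Longrightarrow> abs_val P (x - f P) < \<epsilon>"
    "\<And>Q. Q \<in> prime_ideals - F \<Longrightarrow> abs_val Q x \<le> 1"
proof -
  have loc: "number_field_prime P" if "P \<in> prime_ideals" for P :: "'k set"
    using nf that by unfold_locales
  have "\<forall>P. \<exists>d::int. d > 0 \<and> algebraic_int (of_int d * f P)"
    using number_field_denominator[OF nf] by metis
  then obtain d :: "'k set \<Rightarrow> int" where d: "\<And>P. d P > 0" "\<And>P. algebraic_int (of_int (d P) * f P)" by metis
  define D :: 'k where "D = of_int (\<Prod>P\<in>F. d P)"
  have D: "D \<noteq> 0" "algebraic_int D"
  proof -
    have "(\<Prod>P\<in>F. d P) \<noteq> 0" using d(1) F(1) by (simp add: prod_zero_iff) (metis less_irrefl)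
    then show "D \<noteq> 0" "algebraic_int D" by (simp_all add: D_def del: of_int_prod)
  qed
  have Df: "algebraic_int (D * f P)" if "P \<in> F" for P
  proof -
    have "D = of_int (d P * (\<Prod>P\<in>F - {P}. d P))" unfolding D_def using F(1) that by (subst prod.remove[of _ P]) auto
    then have "D * f P = of_int (\<Prod>P\<in>F - {P}. d P) * (of_int (d P) * f P)"
      by (simp only: of_int_mult mult_ac)
    then show ?thesis by (simp only: algebraic_int_mult[OF algebraic_int_of_int d(2)])
  qed
  define G where "G = F \<union> {Q \<in> prime_ideals. D \<in> Q}"
  have G: "finite G" "G \<subseteq> prime_ideals"
    using F finite_primes_containing[OF nf D(2,1)] by (auto simp: G_def)
  \<comment> \<open>The factor |D| compensates for the division by D. The minimum of 1 and
    \<epsilon> forces |y| < |D| at the primes with target 0, and the inserted 1 keeps the outer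
    minimum defined when G is empty.\<close>
  define \<delta> where "\<delta> = Min (insert 1 ((\<lambda>P. abs_val P D * min 1 \<epsilon>) ` G))"
  have "\<delta> > 0" unfolding \<delta>_def
    using G \<epsilon> D(1) number_field_prime.abs_val_pos[OF loc] by (subst Min_gr_iff) auto
  then obtain N where N: "(1/2::real) ^ N < \<delta>" using real_arch_pow_inv[of \<delta> "1/2"] by auto
  have \<delta>: "\<delta> \<le> abs_val P D * min 1 \<epsilon>" if "P \<in> G" for P
    unfolding \<delta>_def using G that by (intro Min_le) auto
  have "algebraic_int (if P \<in> F then D * f P else 0)" for P using Df by simp
  then obtain y where y: "algebraic_int y"
    "\<And>P. P \<in> G \<Longrightarrow> y - (if P \<in> F then D * f P else 0) \<in> ideal_pow P N"
    using chinese_remainder_primes[OF nf G, of "\<lambda>P. if P \<in> F then D * f P else 0" N] by blast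
  have close: "abs_val P (y - (if P \<in> F then D * f P else 0)) < abs_val P D * min 1 \<epsilon>" if P: "P \<in> G" for P
  proof -
    interpret number_field_prime P using P G loc by blast
    have "algebraic_int (y - (if P \<in> F then D * f P else 0))" using y(1) Df by simp
    then have "abs_val P (y - (if P \<in> F then D * f P else 0)) \<le> 2 powi (- int N)"
      using y(2)[OF P] abs_val_le_iff_P_pow by blast
    also have "\<dots> = (1/2) ^ N" by (simp add: power_int_minus power_one_over field_simps)
    finally show ?thesis using N \<delta>[OF P] by linarith
  qed
  show ?thesis
  proof (rule that[of "y / D"])
    fix P assume P: "P \<in> F"
    then interpret number_field_prime P using F loc by blast
    have "abs_val P (y - D * f P) < abs_val P D * min 1 \<epsilon>" using close[of P] P by (simp add: G_def)
    also have "y - D * f P = D * (y / D - f P)" using D(1) by (simp add: field_simps)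
    finally have "abs_val P (y / D - f P) < min 1 \<epsilon>" using abs_val_pos[OF D(1)] by (simp add: abs_val_mult)
    then show "abs_val P (y / D - f P) < \<epsilon>" by simp
  next
    fix Q assume Q: "Q \<in> prime_ideals - F"
    then interpret number_field_prime Q using loc by blast
    have "abs_val Q y \<le> abs_val Q D"
    proof (cases "D \<in> Q")
      case True
      then have "abs_val Q y < abs_val Q D * min 1 \<epsilon>" using close[of Q] Q by (simp add: G_def)
      also have "\<dots> \<le> abs_val Q D * 1" by (intro mult_left_mono) auto
      finally show ?thesis by simp
    next
      case False
      then have "abs_val Q D = 1" using abs_val_integral[OF D(2,1)] int_valuation_eq_0[OF D(2)] by simp
      then show ?thesis using abs_val_le_1[OF y(1)] by simp
    qed
    then show "abs_val Q (y / D) \<le> 1"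
      using abs_val_divide[OF y(1) D(2,1)] abs_val_pos[OF D(1)] by simp
  qed
qed

section \<open>The completion as a valued field\<close>

lemma cauchy_ring_simps [simp]:
  "x \<otimes>\<^bsub>cauchy_ring P\<^esub> y = (\<lambda>n. x n * y n)" "x \<oplus>\<^bsub>cauchy_ring P\<^esub> y = (\<lambda>n. x n + y n)"
  "\<one>\<^bsub>cauchy_ring P\<^esub> = (\<lambda>n. 1)" "\<zero>\<^bsub>cauchy_ring P\<^esub> = (\<lambda>n. 0)"
  by (simp_all add: cauchy_ring_def)

context number_field_prime
begin

section \<open>Cauchy sequences and null sequences\<close>

lemma abs_val_triangle: "abs_val P (x + y) \<le> abs_val P x + abs_val P y"
  using abs_val_add[of x y] abs_val_nonneg[of x] abs_val_nonneg[of y] by linarith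

lemma abs_val_diff_swap: "abs_val P (x - y) = abs_val P (y - x)"
  using abs_val_minus[of "x - y"] by simp

lemma abs_val_reverse_triangle: "\<bar>abs_val P x - abs_val P y\<bar> \<le> abs_val P (x - y)"
  using abs_val_triangle[of "x - y" y] abs_val_triangle[of "y - x" x] abs_val_diff_swap[of x y] by simp

lemma mem_cauchy_ring:
  "x \<in> carrier (cauchy_ring P) \<longleftrightarrow> (\<forall>e>0. \<exists>N. \<forall>m\<ge>N. \<forall>n\<ge>N. abs_val P (x m - x n) < e)"
  by (simp add: cauchy_ring_def)

text \<open>By the reverse triangle inequality, the absolute values form a Cauchy sequence of
  reals.\<close>

lemma cauchy_ring_convergent:
  assumes "x \<in> carrier (cauchy_ring P)"
  shows "convergent (\<lambda>n. abs_val P (x n))"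
  unfolding Cauchy_convergent_iff[symmetric] Cauchy_iff
  using assms unfolding mem_cauchy_ring real_norm_def by (meson abs_val_reverse_triangle le_less_trans)

lemma cauchy_ring_bounded:
  assumes "x \<in> carrier (cauchy_ring P)"
  obtains B where "B > 0" "\<And>n. abs_val P (x n) < B"
proof -
  have "Bseq (\<lambda>n. abs_val P (x n))" using cauchy_ring_convergent[OF assms] by (rule convergent_imp_Bseq)
  then obtain K where "K > 0" "\<And>n. \<bar>abs_val P (x n)\<bar> \<le> K" by (auto elim: BseqE)
  then show ?thesis using that[of "K + 1"] by (smt (verit))
qed

lemma cauchy_ring_const: "(\<lambda>n. x) \<in> carrier (cauchy_ring P)"
  by (simp add: mem_cauchy_ring)

lemma cauchy_ring_add:
  assumes "x \<in> carrier (cauchy_ring P)" "y \<in> carrier (cauchy_ring P)"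
  shows "(\<lambda>n. x n + y n) \<in> carrier (cauchy_ring P)"
  unfolding mem_cauchy_ring
proof (intro allI impI)
  fix e :: real assume "e > 0"
  then obtain M N where M: "\<And>m n. m \<ge> M \<Longrightarrow> n \<ge> M \<Longrightarrow> abs_val P (x m - x n) < e"
    and N: "\<And>m n. m \<ge> N \<Longrightarrow> n \<ge> N \<Longrightarrow> abs_val P (y m - y n) < e"
    using assms unfolding mem_cauchy_ring by meson
  have "abs_val P ((x m + y m) - (x n + y n)) < e" if "m \<ge> max M N" "n \<ge> max M N" for m n
  proof -
    have eq: "(x m + y m) - (x n + y n) = (x m - x n) + (y m - y n)" by simp
    have lt: "max (abs_val P (x m - x n)) (abs_val P (y m - y n)) < e"
      using M[of m n] N[of m n] that by simp
    show ?thesis unfolding eq by (rule le_less_trans[OF abs_val_add lt])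
  qed
  then show "\<exists>N. \<forall>m\<ge>N. \<forall>n\<ge>N. abs_val P ((x m + y m) - (x n + y n)) < e" by blast
qed

text \<open>The usual splitting x_m (y_m - y_n) + (x_m - x_n) y_n with bounds A and B; by the
  ultrametric inequality each summand may use the full e.\<close>

lemma cauchy_ring_mult:
  assumes x: "x \<in> carrier (cauchy_ring P)" and y: "y \<in> carrier (cauchy_ring P)"
  shows "(\<lambda>n. x n * y n) \<in> carrier (cauchy_ring P)"
  unfolding mem_cauchy_ring
proof (intro allI impI)
  fix e :: real assume e: "e > 0"
  obtain A where A: "A > 0" "\<And>n. abs_val P (x n) < A" using cauchy_ring_bounded[OF x] by metis
  obtain B where B: "B > 0" "\<And>n. abs_val P (y n) < B" using cauchy_ring_bounded[OF y] by metis
  obtain M N where M: "\<And>m n. m \<ge> M \<Longrightarrow> n \<ge> M \<Longrightarrow> abs_val P (x m - x n) < e / B"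
    and N: "\<And>m n. m \<ge> N \<Longrightarrow> n \<ge> N \<Longrightarrow> abs_val P (y m - y n) < e / A"
    using assms e A(1) B(1) unfolding mem_cauchy_ring by (meson divide_pos_pos)
  have "abs_val P (x m * y m - x n * y n) < e" if "m \<ge> max M N" "n \<ge> max M N" for m n
  proof -
    have eq: "x m * y m - x n * y n = x m * (y m - y n) + (x m - x n) * y n" by (simp add: algebra_simps)
    have lt1: "abs_val P (x m * (y m - y n)) < e"
    proof -
      have "abs_val P (x m) * abs_val P (y m - y n) < A * (e / A)"
        using A(2)[of m] N[of m n] that by (intro mult_strict_mono') auto
      then show ?thesis using A(1) by (simp add: abs_val_mult)
    qed
    have lt2: "abs_val P ((x m - x n) * y n) < e"
    proof -
      have "abs_val P (x m - x n) * abs_val P (y n) < (e / B) * B"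
        using B(2)[of n] M[of m n] that by (intro mult_strict_mono') auto
      then show ?thesis using B(1) by (simp add: abs_val_mult split: if_splits)
    qed
    show ?thesis unfolding eq using lt1 lt2 by (intro le_less_trans[OF abs_val_add]) simp
  qed
  then show "\<exists>N. \<forall>m\<ge>N. \<forall>n\<ge>N. abs_val P (x m * y m - x n * y n) < e" by blast
qed

lemma cauchy_ring_minus:
  assumes "x \<in> carrier (cauchy_ring P)"
  shows "(\<lambda>n. - x n) \<in> carrier (cauchy_ring P)"
  using cauchy_ring_mult[OF cauchy_ring_const[of "-1"] assms] by simp

lemma cring_cauchy_ring: "cring (cauchy_ring P)"
proof (rule cringI)
  show "abelian_group (cauchy_ring P)"
  proof (rule abelian_groupI)
    fix x assume "x \<in> carrier (cauchy_ring P)"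
    then show "\<exists>y\<in>carrier (cauchy_ring P). y \<oplus>\<^bsub>cauchy_ring P\<^esub> x = \<zero>\<^bsub>cauchy_ring P\<^esub>"
      by (intro bexI[of _ "\<lambda>n. - x n"]) (simp_all add: cauchy_ring_minus)
  qed (simp_all add: cauchy_ring_add cauchy_ring_const add_ac)
  show "comm_monoid (cauchy_ring P)"
    by (rule comm_monoidI) (simp_all add: cauchy_ring_mult cauchy_ring_const mult_ac)
qed (simp add: distrib_right)

sublocale cauchy: cring "cauchy_ring P"
  by (rule cring_cauchy_ring)

lemma mem_null_sequences: "x \<in> null_sequences P \<longleftrightarrow> (\<lambda>n. abs_val P (x n)) \<longlonglongrightarrow> 0"
  by (simp add: null_sequences_def)

lemma null_sequences_cauchy:
  assumes "x \<in> null_sequences P"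
  shows "x \<in> carrier (cauchy_ring P)"
  unfolding mem_cauchy_ring
proof (intro allI impI)
  fix e :: real assume "e > 0"
  then obtain N where N: "\<And>n. n \<ge> N \<Longrightarrow> abs_val P (x n) < e"
    using assms LIMSEQ_D[of "\<lambda>n. abs_val P (x n)" 0 e] unfolding mem_null_sequences by auto
  have "abs_val P (x m - x n) < e" if "m \<ge> N" "n \<ge> N" for m n
    using abs_val_add[of "x m" "- x n"] N[OF that(1)] N[OF that(2)] by simp
  then show "\<exists>N. \<forall>m\<ge>N. \<forall>n\<ge>N. abs_val P (x m - x n) < e" by blast
qed

lemma null_sequences_add:
  assumes "x \<in> null_sequences P" "y \<in> null_sequences P"
  shows "(\<lambda>n. x n + y n) \<in> null_sequences P"
proof -
  have "(\<lambda>n. abs_val P (x n) + abs_val P (y n)) \<longlonglongrightarrow> 0"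
    using tendsto_add[OF assms[unfolded mem_null_sequences]] by simp
  then show ?thesis unfolding mem_null_sequences
    by (rule tendsto_sandwich[OF _ _ tendsto_const, rotated 2]) (auto simp: abs_val_triangle)
qed

lemma null_sequences_mult:
  assumes x: "x \<in> null_sequences P" and y: "y \<in> carrier (cauchy_ring P)"
  shows "(\<lambda>n. y n * x n) \<in> null_sequences P"
proof -
  obtain l where "(\<lambda>n. abs_val P (y n)) \<longlonglongrightarrow> l" using cauchy_ring_convergent[OF y] by (auto simp: convergent_def)
  from tendsto_mult[OF this x[unfolded mem_null_sequences]] show ?thesis
    by (simp add: mem_null_sequences abs_val_mult)
qed

lemma null_sequences_ideal: "ideal (null_sequences P) (cauchy_ring P)"
proof (rule idealI)
  show "subgroup (null_sequences P) (add_monoid (cauchy_ring P))"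
  proof (rule group.subgroupI)
    show "group (add_monoid (cauchy_ring P))" by (rule cauchy.a_group)
    show "null_sequences P \<subseteq> carrier (add_monoid (cauchy_ring P))" using null_sequences_cauchy by auto
    have "(\<lambda>n. 0) \<in> null_sequences P" by (simp add: mem_null_sequences)
    then show "null_sequences P \<noteq> {}" by blast
    fix x y assume x: "x \<in> null_sequences P" and y: "y \<in> null_sequences P"
    show "x \<otimes>\<^bsub>add_monoid (cauchy_ring P)\<^esub> y \<in> null_sequences P" using null_sequences_add[OF x y] by simp
    have "\<ominus>\<^bsub>cauchy_ring P\<^esub> x = (\<lambda>n. - x n)"
      using null_sequences_cauchy[OF x] cauchy_ring_minus by (intro cauchy.minus_equality) auto
    moreover have "(\<lambda>n. - x n) \<in> null_sequences P" using x by (simp add: mem_null_sequences)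
    ultimately show "inv\<^bsub>add_monoid (cauchy_ring P)\<^esub> x \<in> null_sequences P" by (simp add: a_inv_def)
  qed
qed (use null_sequences_mult in \<open>auto simp: cauchy.ring_axioms mult.commute\<close>)

sublocale null: ideal "null_sequences P" "cauchy_ring P"
  by (rule null_sequences_ideal)

section \<open>The valued field K_P\<close>

abbreviation completion_plus (infixl "\<oplus>\<^sub>P" 65) where "x \<oplus>\<^sub>P y \<equiv> x \<oplus>\<^bsub>completion P\<^esub> y"
abbreviation completion_diff (infixl "\<ominus>\<^sub>P" 65) where "x \<ominus>\<^sub>P y \<equiv> x \<ominus>\<^bsub>completion P\<^esub> y"
abbreviation completion_times (infixl "\<otimes>\<^sub>P" 70) where "x \<otimes>\<^sub>P y \<equiv> x \<otimes>\<^bsub>completion P\<^esub> y"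
abbreviation completion_zero ("\<zero>\<^sub>P") where "\<zero>\<^sub>P \<equiv> \<zero>\<^bsub>completion P\<^esub>"
abbreviation completion_one ("\<one>\<^sub>P") where "\<one>\<^sub>P \<equiv> \<one>\<^bsub>completion P\<^esub>"

lemma cring_completion: "cring (completion P)"
  unfolding completion_def by (rule null.quotient_is_cring[OF cauchy.cring_axioms])

sublocale completion: cring "completion P"
  by (rule cring_completion)

definition cls :: "(nat \<Rightarrow> 'k) \<Rightarrow> (nat \<Rightarrow> 'k) set" where
  "cls x = null_sequences P +>\<^bsub>cauchy_ring P\<^esub> x"

lemma mem_cls: "y \<in> cls x \<longleftrightarrow> (\<lambda>n. y n - x n) \<in> null_sequences P"
proof
  assume "y \<in> cls x"
  then show "(\<lambda>n. y n - x n) \<in> null_sequences P" by (auto simp: cls_def a_r_coset_def')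
next
  assume "(\<lambda>n. y n - x n) \<in> null_sequences P"
  then show "y \<in> cls x" unfolding cls_def a_r_coset_def' by (intro UN_I) auto
qed

lemma cls_hom: "cls \<in> Ring.ring_hom (cauchy_ring P) (completion P)"
  unfolding cls_def completion_def by (rule null.rcos_ring_hom)

sublocale cls: ring_hom_cring "cauchy_ring P" "completion P" cls
  by unfold_locales (rule cls_hom)

lemma completion_zero_eq: "\<zero>\<^sub>P = null_sequences P"
  by (simp add: completion_def FactRing_def)

lemma completion_cases:
  assumes "c \<in> carrier (completion P)"
  obtains x where "x \<in> carrier (cauchy_ring P)" "c = cls x"
  using assms by (auto simp: completion_def FactRing_def A_RCOSETS_def' cls_def)

lemma cls_eq_iff:
  assumes "x \<in> carrier (cauchy_ring P)" "y \<in> carrier (cauchy_ring P)"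
  shows "cls x = cls y \<longleftrightarrow> (\<lambda>n. x n - y n) \<in> null_sequences P"
proof
  assume "cls x = cls y"
  moreover have "x \<in> cls x" by (simp add: mem_cls mem_null_sequences)
  ultimately show "(\<lambda>n. x n - y n) \<in> null_sequences P" using mem_cls by blast
next
  assume xy: "(\<lambda>n. x n - y n) \<in> null_sequences P"
  have "cls x = cls (\<lambda>n. (x n - y n) + y n)" by simp
  also have "\<dots> = cls (\<lambda>n. x n - y n) \<oplus>\<^sub>P cls y"
    using cls.hom_add[OF null_sequences_cauchy[OF xy] assms(2)] by simp
  also have "cls (\<lambda>n. x n - y n) = \<zero>\<^sub>P"
    unfolding cls_def completion_zero_eq by (rule null.a_rcos_const[OF xy])
  finally show "cls x = cls y" using assms by simp
qed

lemma embed_cls: "embed P x = cls (\<lambda>n. x)"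
  by (simp add: embed_def cls_def)

text \<open>Sequences in one coset differ by a null sequence, so their absolute values have the same
  limit; this justifies the definite description in \<open>completion_abs\<close>.\<close>

lemma completion_abs_cls:
  assumes "x \<in> carrier (cauchy_ring P)"
  shows "(\<lambda>n. abs_val P (x n)) \<longlonglongrightarrow> completion_abs P (cls x)"
proof -
  obtain l where l: "(\<lambda>n. abs_val P (x n)) \<longlonglongrightarrow> l"
    using cauchy_ring_convergent[OF assms] by (auto simp: convergent_def)
  have "completion_abs P (cls x) = l" unfolding completion_abs_def
  proof (rule the_equality)
    show "\<exists>y\<in>cls x. (\<lambda>n. abs_val P (y n)) \<longlonglongrightarrow> l"
      using l by (intro bexI[of _ x]) (simp_all add: mem_cls mem_null_sequences)
    fix l' assume "\<exists>y\<in>cls x. (\<lambda>n. abs_val P (y n)) \<longlonglongrightarrow> l'"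
    then obtain y where y: "(\<lambda>n. abs_val P (y n - x n)) \<longlonglongrightarrow> 0" "(\<lambda>n. abs_val P (y n)) \<longlonglongrightarrow> l'"
      by (auto simp: mem_cls mem_null_sequences)
    have "(\<lambda>n. abs_val P (y n) - abs_val P (x n)) \<longlonglongrightarrow> 0"
      by (rule Lim_null_comparison[OF _ y(1)]) (simp add: abs_val_reverse_triangle)
    moreover have "(\<lambda>n. abs_val P (y n) - abs_val P (x n)) \<longlonglongrightarrow> l' - l" by (rule tendsto_diff[OF y(2) l])
    ultimately show "l' = l" using LIMSEQ_unique by fastforce
  qed
  then show ?thesis using l by simp
qed

lemma completion_abs_nonneg:
  assumes "c \<in> carrier (completion P)"
  shows "completion_abs P c \<ge> 0"
proof -
  obtain x where x: "x \<in> carrier (cauchy_ring P)" "c = cls x" using completion_cases[OF assms] .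
  show ?thesis unfolding x(2) by (rule LIMSEQ_le_const[OF completion_abs_cls[OF x(1)]]) auto
qed

lemma completion_abs_eq_0_iff:
  assumes "c \<in> carrier (completion P)"
  shows "completion_abs P c = 0 \<longleftrightarrow> c = \<zero>\<^sub>P"
proof -
  obtain x where x: "x \<in> carrier (cauchy_ring P)" "c = cls x" using completion_cases[OF assms] .
  have "c = \<zero>\<^sub>P \<longleftrightarrow> cls x = cls (\<lambda>n. 0)" using cls.hom_zero x(2) by simp
  also have "\<dots> \<longleftrightarrow> (\<lambda>n. abs_val P (x n)) \<longlonglongrightarrow> 0"
    using cls_eq_iff[OF x(1) cauchy_ring_const[of 0]] by (simp add: mem_null_sequences)
  also have "\<dots> \<longleftrightarrow> completion_abs P c = 0"
  proof
    assume "(\<lambda>n. abs_val P (x n)) \<longlonglongrightarrow> 0"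
    then show "completion_abs P c = 0" unfolding x(2) by (rule LIMSEQ_unique[OF completion_abs_cls[OF x(1)]])
  next
    assume "completion_abs P c = 0"
    then show "(\<lambda>n. abs_val P (x n)) \<longlonglongrightarrow> 0" using completion_abs_cls[OF x(1)] x(2) by simp
  qed
  finally show ?thesis by blast
qed

lemma completion_abs_mult:
  assumes "c \<in> carrier (completion P)" "d \<in> carrier (completion P)"
  shows "completion_abs P (c \<otimes>\<^sub>P d) = completion_abs P c * completion_abs P d"
proof -
  obtain x where x: "x \<in> carrier (cauchy_ring P)" "c = cls x" using completion_cases[OF assms(1)] .
  obtain y where y: "y \<in> carrier (cauchy_ring P)" "d = cls y" using completion_cases[OF assms(2)] .
  have eq: "c \<otimes>\<^sub>P d = cls (\<lambda>n. x n * y n)" using cls.hom_mult[OF x(1) y(1)] x(2) y(2) by simp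
  have 1: "(\<lambda>n. abs_val P (x n * y n)) \<longlonglongrightarrow> completion_abs P (cls (\<lambda>n. x n * y n))"
    by (rule completion_abs_cls[OF cauchy_ring_mult[OF x(1) y(1)]])
  have 2: "(\<lambda>n. abs_val P (x n * y n)) \<longlonglongrightarrow> completion_abs P c * completion_abs P d"
    unfolding abs_val_mult x(2) y(2) by (intro tendsto_mult completion_abs_cls x(1) y(1))
  show ?thesis unfolding eq by (rule LIMSEQ_unique[OF 1 2])
qed

lemma completion_abs_add:
  assumes "c \<in> carrier (completion P)" "d \<in> carrier (completion P)"
  shows "completion_abs P (c \<oplus>\<^sub>P d) \<le> max (completion_abs P c) (completion_abs P d)"
proof -
  obtain x where x: "x \<in> carrier (cauchy_ring P)" "c = cls x" using completion_cases[OF assms(1)] .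
  obtain y where y: "y \<in> carrier (cauchy_ring P)" "d = cls y" using completion_cases[OF assms(2)] .
  have eq: "c \<oplus>\<^sub>P d = cls (\<lambda>n. x n + y n)" using cls.hom_add[OF x(1) y(1)] x(2) y(2) by simp
  have 1: "(\<lambda>n. abs_val P (x n + y n)) \<longlonglongrightarrow> completion_abs P (cls (\<lambda>n. x n + y n))"
    by (rule completion_abs_cls[OF cauchy_ring_add[OF x(1) y(1)]])
  have 2: "(\<lambda>n. max (abs_val P (x n)) (abs_val P (y n))) \<longlonglongrightarrow> max (completion_abs P c) (completion_abs P d)"
    unfolding x(2) y(2) by (intro tendsto_max completion_abs_cls x(1) y(1))
  show ?thesis unfolding eq by (rule LIMSEQ_le[OF 1 2]) (auto simp: abs_val_add)
qed

lemma embed_closed [simp]: "embed P x \<in> carrier (completion P)"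
  unfolding embed_cls by (rule cls.hom_closed[OF cauchy_ring_const])

lemma completion_abs_embed [simp]: "completion_abs P (embed P x) = abs_val P x"
  unfolding embed_cls by (rule LIMSEQ_unique[OF completion_abs_cls[OF cauchy_ring_const] tendsto_const])

lemma embed_add: "embed P (x + y) = embed P x \<oplus>\<^sub>P embed P y"
  using cls.hom_add[OF cauchy_ring_const[of x] cauchy_ring_const[of y]] by (simp add: embed_cls)

lemma embed_mult: "embed P (x * y) = embed P x \<otimes>\<^sub>P embed P y"
  using cls.hom_mult[OF cauchy_ring_const[of x] cauchy_ring_const[of y]] by (simp add: embed_cls)

lemma embed_0: "embed P 0 = \<zero>\<^sub>P"
  using cls.hom_zero by (simp add: embed_cls)

lemma embed_1: "embed P 1 = \<one>\<^sub>P"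
  using cls.hom_one by (simp add: embed_cls)

lemma embed_minus: "embed P (- x) = \<ominus>\<^bsub>completion P\<^esub> embed P x"
proof -
  have "embed P (- x) \<oplus>\<^sub>P embed P x = \<zero>\<^sub>P"
    by (simp add: embed_add[symmetric] embed_0)
  then show ?thesis by (intro completion.minus_equality[symmetric]) simp_all
qed

lemma embed_diff: "embed P (x - y) = embed P x \<ominus>\<^sub>P embed P y"
  using embed_add[of x "- y"] embed_minus[of y] by (simp add: a_minus_def)

lemma completion_abs_one [simp]: "completion_abs P \<one>\<^sub>P = 1"
  using completion_abs_embed[of 1] by (simp add: embed_1)

lemma completion_abs_zero [simp]: "completion_abs P \<zero>\<^sub>P = 0"
  using completion_abs_embed[of 0] by (simp add: embed_0)

lemma completion_abs_minus:
  assumes "c \<in> carrier (completion P)"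
  shows "completion_abs P (\<ominus>\<^bsub>completion P\<^esub> c) = completion_abs P c"
proof -
  have "\<ominus>\<^bsub>completion P\<^esub> c = embed P (- 1) \<otimes>\<^sub>P c"
    using assms by (simp add: embed_minus embed_1 completion.l_minus)
  then show ?thesis using assms by (simp add: completion_abs_mult)
qed

lemma completion_abs_diff:
  assumes "c \<in> carrier (completion P)" "d \<in> carrier (completion P)"
  shows "completion_abs P (c \<ominus>\<^sub>P d) \<le> max (completion_abs P c) (completion_abs P d)"
  using completion_abs_add[of c "\<ominus>\<^bsub>completion P\<^esub> d"] assms by (simp add: a_minus_def completion_abs_minus)

lemma completion_abs_diff_swap:
  assumes "c \<in> carrier (completion P)" "d \<in> carrier (completion P)"
  shows "completion_abs P (c \<ominus>\<^sub>P d) = completion_abs P (d \<ominus>\<^sub>P c)"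
proof -
  have "d \<ominus>\<^sub>P c = \<ominus>\<^bsub>completion P\<^esub> (c \<ominus>\<^sub>P d)" using assms by algebra
  then show ?thesis using assms by (simp add: completion_abs_minus)
qed

lemma completion_abs_diff_trans:
  assumes "c \<in> carrier (completion P)" "d \<in> carrier (completion P)" "e \<in> carrier (completion P)"
  shows "completion_abs P (c \<ominus>\<^sub>P e) \<le>
    max (completion_abs P (c \<ominus>\<^sub>P d)) (completion_abs P (d \<ominus>\<^sub>P e))"
proof -
  have "c \<ominus>\<^sub>P e = (c \<ominus>\<^sub>P d) \<oplus>\<^sub>P (d \<ominus>\<^sub>P e)"
    using assms by algebra
  then show ?thesis using completion_abs_add assms by simp
qed

text \<open>A late term of a representing Cauchy sequence, taken as a constant, is close to the
  class. The bound e/2 restores the strict inequality, as limits preserve only weak ones.\<close>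

lemma embed_dense:
  assumes c: "c \<in> carrier (completion P)" and e: "e > 0"
  obtains x where "completion_abs P (embed P x \<ominus>\<^sub>P c) < e"
proof -
  obtain x where x: "x \<in> carrier (cauchy_ring P)" "c = cls x" using completion_cases[OF c] .
  obtain N where N: "\<And>m n. m \<ge> N \<Longrightarrow> n \<ge> N \<Longrightarrow> abs_val P (x m - x n) < e / 2"
    using x(1) e unfolding mem_cauchy_ring by (meson half_gt_zero)
  have minus: "\<ominus>\<^bsub>completion P\<^esub> c = cls (\<lambda>n. - x n)"
  proof (rule completion.minus_equality)
    show "cls (\<lambda>n. - x n) \<oplus>\<^sub>P c = \<zero>\<^sub>P"
      using cls.hom_add[OF cauchy_ring_minus[OF x(1)] x(1)] cls.hom_zero x(2) by simp
  qed (use c cls.hom_closed[OF cauchy_ring_minus[OF x(1)]] in auto)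
  have y: "(\<lambda>n. x N - x n) \<in> carrier (cauchy_ring P)"
    using cauchy_ring_add[OF cauchy_ring_const[of "x N"] cauchy_ring_minus[OF x(1)]] by simp
  have "embed P (x N) \<ominus>\<^sub>P c = cls (\<lambda>n. x N - x n)"
    unfolding a_minus_def minus embed_cls
    using cls.hom_add[OF cauchy_ring_const[of "x N"] cauchy_ring_minus[OF x(1)]] by simp
  moreover have "completion_abs P (cls (\<lambda>n. x N - x n)) \<le> e / 2"
    by (rule LIMSEQ_le_const2[OF completion_abs_cls[OF y]]) (use N in \<open>auto intro!: exI[of _ N] less_imp_le\<close>)
  ultimately show ?thesis using that[of "x N"] e by simp
qed

text \<open>If L is the absolute value of the class, a representative stays above L/2 in absolute
  value from some index M on, so it can be inverted term by term.\<close>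

lemma completion_inverse:
  assumes c: "c \<in> carrier (completion P)" "c \<noteq> \<zero>\<^sub>P"
  obtains d where "d \<in> carrier (completion P)" "c \<otimes>\<^sub>P d = \<one>\<^sub>P"
proof -
  obtain x where x: "x \<in> carrier (cauchy_ring P)" "c = cls x" using completion_cases[OF c(1)] .
  define L where "L = completion_abs P c"
  have L: "L > 0" using completion_abs_nonneg[OF c(1)] completion_abs_eq_0_iff[OF c(1)] c(2) by (simp add: L_def)
  have "eventually (\<lambda>n. abs_val P (x n) > L / 2) sequentially"
    using completion_abs_cls[OF x(1)] L by (intro order_tendstoD(1)[of _ L]) (auto simp: L_def x(2))
  then obtain M where M: "\<And>n. n \<ge> M \<Longrightarrow> abs_val P (x n) > L / 2" by (auto simp: eventually_sequentially)
  have nz: "x n \<noteq> 0" if "n \<ge> M" for n using M[OF that] L by auto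
  \<comment> \<open>Terms before M may be zero; their inverse is then 0 by convention, which does
    not affect the class of the product.\<close>
  define y where "y n = inverse (x n)" for n
  have y: "y \<in> carrier (cauchy_ring P)" unfolding mem_cauchy_ring
  proof (intro allI impI)
    fix e :: real assume e: "e > 0"
    \<comment> \<open>A difference of inverses is a difference of terms divided by x_m x_n, whose
      absolute value exceeds (L/2)^2.\<close>
    then have "e * (L / 2 * (L / 2)) > 0" using L by simp
    then obtain N where N: "\<And>m n. m \<ge> N \<Longrightarrow> n \<ge> N \<Longrightarrow> abs_val P (x m - x n) < e * (L / 2 * (L / 2))"
      using x(1) unfolding mem_cauchy_ring by meson
    have "abs_val P (y m - y n) < e" if "m \<ge> max M N" "n \<ge> max M N" for m n
    proof -
      have mn: "x m \<noteq> 0" "x n \<noteq> 0" using nz that by auto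
      have "(y m - y n) * (x m * x n) = x n - x m" using mn by (simp add: y_def field_simps)
      then have "abs_val P (y m - y n) * (abs_val P (x m) * abs_val P (x n)) = abs_val P (x n - x m)"
        by (metis abs_val_mult)
      also have "\<dots> < e * (L / 2 * (L / 2))" using N that by simp
      also have "\<dots> \<le> e * (abs_val P (x m) * abs_val P (x n))"
        using M[of m] M[of n] that e L by (intro mult_left_mono mult_mono) auto
      finally show ?thesis using abs_val_pos[OF mn(1)] abs_val_pos[OF mn(2)] by (simp add: mult_less_cancel_right)
    qed
    then show "\<exists>N. \<forall>m\<ge>N. \<forall>n\<ge>N. abs_val P (y m - y n) < e" by blast
  qed
  have "c \<otimes>\<^sub>P cls y = cls (\<lambda>n. x n * y n)" using cls.hom_mult[OF x(1) y] x(2) by simp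
  also have "\<dots> = cls (\<lambda>n. 1)"
  proof -
    have "eventually (\<lambda>n. abs_val P (x n * y n - 1) = 0) sequentially"
      using nz by (auto simp: eventually_sequentially y_def intro!: exI[of _ M])
    then have "(\<lambda>n. x n * y n - 1) \<in> null_sequences P"
      unfolding mem_null_sequences by (rule tendsto_eventually)
    then show ?thesis using cls_eq_iff[OF cauchy_ring_mult[OF x(1) y] cauchy_ring_const[of 1]] by simp
  qed
  also have "\<dots> = \<one>\<^sub>P" using cls.hom_one by simp
  finally show ?thesis using that cls.hom_closed[OF y] by blast
qed

lemma completion_diff_eq_zero_iff:
  assumes "c \<in> carrier (completion P)" "d \<in> carrier (completion P)"
  shows "c \<ominus>\<^sub>P d = \<zero>\<^sub>P \<longleftrightarrow> c = d"
proof
  assume eq: "c \<ominus>\<^sub>P d = \<zero>\<^sub>P"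
  have "c = (c \<ominus>\<^sub>P d) \<oplus>\<^sub>P d" using assms by algebra
  then show "c = d" unfolding eq using assms by simp
qed (use assms in \<open>simp add: a_minus_def completion.r_neg\<close>)

lemma completion_Metric_space: "Metric_space (carrier (completion P)) (completion_dist P)"
proof
  show "0 \<le> completion_dist P x y" for x y by (simp add: completion_dist_def completion_abs_nonneg)
  show "completion_dist P x y = completion_dist P y x" for x y
    by (simp add: completion_dist_def completion_abs_diff_swap)
  show "completion_dist P x y = 0 \<longleftrightarrow> x = y"
    if "x \<in> carrier (completion P)" "y \<in> carrier (completion P)" for x y
    using that by (simp add: completion_dist_def completion_abs_eq_0_iff completion_diff_eq_zero_iff)
  show "completion_dist P x z \<le> completion_dist P x y + completion_dist P y z"
    if "x \<in> carrier (completion P)" "y \<in> carrier (completion P)" "z \<in> carrier (completion P)" for x y z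
    using that completion_abs_diff_trans[OF that] completion_abs_nonneg[of "x \<ominus>\<^sub>P y"]
      completion_abs_nonneg[of "y \<ominus>\<^sub>P z"] by (simp add: completion_dist_def)
qed

section \<open>Open sets of K_P\<close>

lemma openin_completion_top:
  "openin (completion_top P) U \<longleftrightarrow> U \<subseteq> carrier (completion P) \<and>
    (\<forall>c\<in>U. \<exists>r>0. \<forall>d\<in>carrier (completion P). completion_abs P (d \<ominus>\<^sub>P c) < r \<longrightarrow> d \<in> U)"
proof -
  interpret M: Metric_space "carrier (completion P)" "completion_dist P" by (rule completion_Metric_space)
  have "M.mball c r = {d \<in> carrier (completion P). completion_abs P (d \<ominus>\<^sub>P c) < r}"
    if "c \<in> carrier (completion P)" for c r
    using that completion_abs_diff_swap by (auto simp: M.mball_def completion_dist_def)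
  then have key: "(\<exists>r>0. M.mball c r \<subseteq> U) \<longleftrightarrow>
    (\<exists>r>0. \<forall>d\<in>carrier (completion P). completion_abs P (d \<ominus>\<^sub>P c) < r \<longrightarrow> d \<in> U)"
    if "c \<in> carrier (completion P)" for c
    using that by (simp only: subset_iff mem_Collect_eq) blast
  have top: "openin (completion_top P) U \<longleftrightarrow>
    U \<subseteq> carrier (completion P) \<and> (\<forall>c\<in>U. \<exists>r>0. M.mball c r \<subseteq> U)"
    unfolding completion_top_def M.openin_mtopology by blast
  show ?thesis unfolding top by (intro conj_cong refl ball_cong key) (erule subsetD)
qed

lemma openin_completion_carrier: "openin (completion_top P) (carrier (completion P))"
  unfolding openin_completion_top by (auto intro: exI[of _ 1])

lemma completion_integers_add:
  assumes "c \<in> completion_integers P" "d \<in> completion_integers P"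
  shows "c \<oplus>\<^sub>P d \<in> completion_integers P"
  using completion_abs_add[of c d] assms by (auto simp: completion_integers_def)

lemma completion_integers_mult:
  assumes "c \<in> completion_integers P" "d \<in> completion_integers P"
  shows "c \<otimes>\<^sub>P d \<in> completion_integers P"
  using assms by (auto simp: completion_integers_def completion_abs_mult completion_abs_nonneg intro: mult_le_one)

lemma completion_integers_minus:
  assumes "c \<in> completion_integers P"
  shows "\<ominus>\<^bsub>completion P\<^esub> c \<in> completion_integers P"
  using assms by (auto simp: completion_integers_def completion_abs_minus)

lemma completion_integers_0_1: "\<zero>\<^sub>P \<in> completion_integers P" "\<one>\<^sub>P \<in> completion_integers P"
  by (simp_all add: completion_integers_def)

text \<open>By the ultrametric inequality, the open ball of radius 1 around an integral point stays
  integral.\<close>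

lemma openin_completion_integers: "openin (completion_top P) (completion_integers P)"
  unfolding openin_completion_top
proof (intro conjI ballI)
  fix c assume c: "c \<in> completion_integers P"
  have "d \<in> completion_integers P"
    if "d \<in> carrier (completion P)" "completion_abs P (d \<ominus>\<^sub>P c) < 1" for d
  proof -
    have "c \<in> carrier (completion P)" using c by (simp add: completion_integers_def)
    then have "d = (d \<ominus>\<^sub>P c) \<oplus>\<^sub>P c" using that(1) by algebra
    moreover have "d \<ominus>\<^sub>P c \<in> completion_integers P"
      using that c by (auto simp: completion_integers_def)
    ultimately show ?thesis using completion_integers_add c by metis
  qed
  then show "\<exists>r>0. \<forall>d\<in>carrier (completion P). completion_abs P (d \<ominus>\<^sub>P c) < r \<longrightarrow> d \<in> completion_integers P"
    by (intro exI[of _ 1]) auto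
qed (auto simp: completion_integers_def)

text \<open>For nonzero c, the open ball of radius |c| around c misses zero.\<close>

lemma openin_completion_nonzero: "openin (completion_top P) (carrier (completion P) - {\<zero>\<^sub>P})"
  unfolding openin_completion_top
proof (intro conjI ballI)
  fix c assume c: "c \<in> carrier (completion P) - {\<zero>\<^sub>P}"
  then have "completion_abs P c > 0" using completion_abs_nonneg[of c] completion_abs_eq_0_iff[of c] by auto
  moreover have "d \<noteq> \<zero>\<^sub>P" if "completion_abs P (d \<ominus>\<^sub>P c) < completion_abs P c" for d
    using that c completion_abs_minus[of c] by (auto simp: a_minus_def)
  ultimately show "\<exists>r>0. \<forall>d\<in>carrier (completion P). completion_abs P (d \<ominus>\<^sub>P c) < r \<longrightarrow>
      d \<in> carrier (completion P) - {\<zero>\<^sub>P}"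
    by (intro exI[of _ "completion_abs P c"]) auto
qed auto

text \<open>Zero is not isolated, as K has nonzero elements of arbitrarily small absolute value.
  Hence a vanishing component of an adele can be made nonzero inside a given neighbourhood.\<close>

lemma completion_small_nonzero:
  assumes "openin (completion_top P) U" "c \<in> U"
  obtains d where "d \<in> U" "d \<noteq> \<zero>\<^sub>P"
proof (cases "c = \<zero>\<^sub>P")
  case True
  obtain r where r: "r > 0" "\<And>d. d \<in> carrier (completion P) \<Longrightarrow>
      completion_abs P (d \<ominus>\<^sub>P c) < r \<Longrightarrow> d \<in> U"
    using assms unfolding openin_completion_top by blast
  obtain x where x: "x \<noteq> 0" "abs_val P x < r" using abs_val_arbitrarily_small[OF r(1)] .
  have "embed P x \<ominus>\<^sub>P c = embed P x" unfolding True a_minus_def by simp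
  then have "embed P x \<in> U" using r(2)[of "embed P x"] x(2) by simp
  moreover have "embed P x \<noteq> \<zero>\<^sub>P"
    by (metis abs_val_pos completion_abs_embed completion_abs_zero less_irrefl x(1))
  ultimately show ?thesis by (rule that)
qed (use assms that in blast)

end

section \<open>Finite adeles\<close>

context number_field_prime
begin

text \<open>The local problem behind the orbit closure, in a form that strong approximation can
  solve: the condition on k is a ball around some y in K. On |k - y| < |y| the absolute value of k
  is constant. If b = 0, a small |k| suffices with u = 1. Otherwise a \<noteq> 0, y approximates c =
  b/a, and u = c/k is a unit for which k a u equals b exactly.\<close>

lemma completion_unit_approximation:
  assumes a: "a \<in> carrier (completion P)" and b: "b \<in> carrier (completion P)"
    and ab: "a = \<zero>\<^sub>P \<Longrightarrow> b = \<zero>\<^sub>P" and \<epsilon>: "\<epsilon> > 0"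
  shows "\<exists>y \<delta>. \<delta> > 0 \<and> (\<forall>k. abs_val P (k - y) < \<delta> \<longrightarrow> k \<noteq> 0 \<and>
    (\<exists>u\<in>carrier (completion P). completion_abs P u = 1 \<and>
      completion_abs P (embed P k \<otimes>\<^sub>P a \<otimes>\<^sub>P u \<ominus>\<^sub>P b) < \<epsilon>))"
proof -
  have near: "abs_val P k = abs_val P y \<and> k \<noteq> 0" if "abs_val P (k - y) < abs_val P y" for k y
  proof
    have "abs_val P k \<le> max (abs_val P (k - y)) (abs_val P y)" using abs_val_add[of "k - y" y] by simp
    moreover have "abs_val P y \<le> max (abs_val P (y - k)) (abs_val P k)" using abs_val_add[of "y - k" k] by simp
    ultimately show "abs_val P k = abs_val P y" using that abs_val_diff_swap[of k y] by (auto simp: max_def split: if_splits)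
    show "k \<noteq> 0" using that by auto
  qed
  show ?thesis
  proof (cases "b = \<zero>\<^sub>P")
    case True
    \<comment> \<open>Chosen so that |k| < e gives |k a| < \<epsilon>; the added 1 covers a =
      0.\<close>
    define e where "e = \<epsilon> / (completion_abs P a + 1)"
    have pos: "completion_abs P a + 1 > 0" using completion_abs_nonneg[OF a] by simp
    have "e > 0" using \<epsilon> pos by (simp add: e_def)
    then obtain y where y: "y \<noteq> 0" "abs_val P y < e" using abs_val_arbitrarily_small by blast
    show ?thesis
    proof (intro exI[of _ y] exI[of _ "abs_val P y"] conjI allI impI)
      show "abs_val P y > 0" using y(1) by (rule abs_val_pos)
      fix k assume "abs_val P (k - y) < abs_val P y"
      then have k: "abs_val P k = abs_val P y" "k \<noteq> 0" using near by blast+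
      show "k \<noteq> 0" by (rule k(2))
      have "abs_val P y * completion_abs P a \<le> e * completion_abs P a"
        using y(2) completion_abs_nonneg[OF a] by (intro mult_right_mono) auto
      also have "\<dots> < e * (completion_abs P a + 1)" using \<open>e > 0\<close> by simp
      also have "\<dots> = \<epsilon>" using pos by (simp add: e_def)
      finally have "abs_val P k * completion_abs P a < \<epsilon>" unfolding k(1) .
      moreover have "embed P k \<otimes>\<^sub>P a \<otimes>\<^sub>P \<one>\<^sub>P \<ominus>\<^sub>P b =
        embed P k \<otimes>\<^sub>P a" using a True by (simp add: a_minus_def)
      ultimately show "\<exists>u\<in>carrier (completion P). completion_abs P u = 1 \<and>
        completion_abs P (embed P k \<otimes>\<^sub>P a \<otimes>\<^sub>P u \<ominus>\<^sub>P b) < \<epsilon>"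
        using a by (intro bexI[of _ "\<one>\<^sub>P"]) (simp_all add: completion_abs_mult)
    qed
  next
    case False
    then obtain a' where a': "a' \<in> carrier (completion P)" "a \<otimes>\<^sub>P a' = \<one>\<^sub>P"
      using completion_inverse[OF a] ab by blast
    have "completion_abs P a * completion_abs P a' = 1"
      using completion_abs_mult[OF a a'(1)] a'(2) by simp
    define c where "c = b \<otimes>\<^sub>P a'"
    have c: "c \<in> carrier (completion P)" using b a'(1) by (simp add: c_def)
    have ac: "a \<otimes>\<^sub>P c = b"
    proof -
      have "a \<otimes>\<^sub>P c = (a \<otimes>\<^sub>P a') \<otimes>\<^sub>P b"
        unfolding c_def using a a'(1) b by algebra
      then show ?thesis using a'(2) b by simp
    qed
    have "c \<noteq> \<zero>\<^sub>P" using ac False a by auto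
    then have cpos: "completion_abs P c > 0"
      using completion_abs_nonneg[OF c] completion_abs_eq_0_iff[OF c] by simp
    \<comment> \<open>An approximation within distance |c| already has absolute value |c|.\<close>
    obtain y where y: "completion_abs P (embed P y \<ominus>\<^sub>P c) < completion_abs P c"
      using embed_dense[OF c cpos] by blast
    have yc: "abs_val P y = completion_abs P c"
    proof -
      have 1: "embed P y = (embed P y \<ominus>\<^sub>P c) \<oplus>\<^sub>P c"
        using embed_closed[of y] c by algebra
      have 2: "c = embed P y \<ominus>\<^sub>P (embed P y \<ominus>\<^sub>P c)"
        using embed_closed[of y] c by algebra
      have "completion_abs P (embed P y) \<le> max (completion_abs P (embed P y \<ominus>\<^sub>P c)) (completion_abs P c)"
        using completion_abs_add[of "embed P y \<ominus>\<^sub>P c" c] c 1 by simp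
      moreover have "completion_abs P c \<le> max (completion_abs P (embed P y)) (completion_abs P (embed P y \<ominus>\<^sub>P c))"
        using completion_abs_diff[of "embed P y" "embed P y \<ominus>\<^sub>P c"] c 2 by simp
      ultimately show ?thesis using y by (simp add: max_def split: if_splits)
    qed
    show ?thesis
    proof (intro exI[of _ y] exI[of _ "abs_val P y"] conjI allI impI)
      show "abs_val P y > 0" using cpos yc by simp
      fix k assume "abs_val P (k - y) < abs_val P y"
      then have k: "abs_val P k = abs_val P y" "k \<noteq> 0" using near by blast+
      show "k \<noteq> 0" by (rule k(2))
      define u where "u = c \<otimes>\<^sub>P embed P (inverse k)"
      have u: "u \<in> carrier (completion P)" using c by (simp add: u_def)
      have "completion_abs P u = 1"
        using c cpos k yc abs_val_inverse[of k] by (simp add: u_def completion_abs_mult)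
      moreover have kk: "embed P k \<otimes>\<^sub>P embed P (inverse k) = \<one>\<^sub>P"
        using k(2) by (simp add: embed_mult[symmetric] embed_1)
      have "embed P k \<otimes>\<^sub>P a \<otimes>\<^sub>P u =
        (embed P k \<otimes>\<^sub>P embed P (inverse k)) \<otimes>\<^sub>P (a \<otimes>\<^sub>P c)"
        unfolding u_def using a c embed_closed[of k] embed_closed[of "inverse k"] by algebra
      then have "embed P k \<otimes>\<^sub>P a \<otimes>\<^sub>P u = b" using kk ac b by simp
      then have "embed P k \<otimes>\<^sub>P a \<otimes>\<^sub>P u \<ominus>\<^sub>P b = \<zero>\<^sub>P"
        using b by (simp add: completion_diff_eq_zero_iff)
      ultimately show "\<exists>u\<in>carrier (completion P). completion_abs P u = 1 \<and>
        completion_abs P (embed P k \<otimes>\<^sub>P a \<otimes>\<^sub>P u \<ominus>\<^sub>P b) < \<epsilon>"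
        using u \<epsilon> by (intro bexI[of _ u]) simp_all
    qed
  qed
qed

lemma completion_integers_if_close:
  assumes "c \<in> carrier (completion P)" "d \<in> completion_integers P"
    "completion_abs P (c \<ominus>\<^sub>P d) \<le> 1"
  shows "c \<in> completion_integers P"
proof -
  have d: "d \<in> carrier (completion P)" using assms(2) by (simp add: completion_integers_def)
  have "c = (c \<ominus>\<^sub>P d) \<oplus>\<^sub>P d" using assms(1) d by algebra
  moreover have "c \<ominus>\<^sub>P d \<in> completion_integers P"
    using assms d by (simp add: completion_integers_def)
  ultimately show ?thesis using completion_integers_add[OF _ assms(2)] by metis
qed

end

locale number_field_adeles =
  fixes K :: "'k::field_char_0 itself"
  assumes nf: "number_field TYPE('k)"
begin

abbreviation \<A> :: "'k adele ring" where "\<A> \<equiv> finite_adeles"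
abbreviation primes :: "'k set set" where "primes \<equiv> prime_ideals"
abbreviation adele_plus (infixl "\<oplus>\<^sub>\<A>" 65) where "a \<oplus>\<^sub>\<A> b \<equiv> a \<oplus>\<^bsub>\<A>\<^esub> b"
abbreviation adele_diff (infixl "\<ominus>\<^sub>\<A>" 65) where "a \<ominus>\<^sub>\<A> b \<equiv> a \<ominus>\<^bsub>\<A>\<^esub> b"
abbreviation adele_times (infixl "\<otimes>\<^sub>\<A>" 70) where "a \<otimes>\<^sub>\<A> b \<equiv> a \<otimes>\<^bsub>\<A>\<^esub> b"
abbreviation adele_zero ("\<zero>\<^sub>\<A>") where "\<zero>\<^sub>\<A> \<equiv> \<zero>\<^bsub>\<A>\<^esub>"
abbreviation adele_one ("\<one>\<^sub>\<A>") where "\<one>\<^sub>\<A> \<equiv> \<one>\<^bsub>\<A>\<^esub>"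
abbreviation poles :: "'k adele \<Rightarrow> 'k set set" where
  "poles a \<equiv> {P \<in> primes. a P \<notin> completion_integers P}"
abbreviation constrained :: "('k set \<Rightarrow> (nat \<Rightarrow> 'k) set set) \<Rightarrow> 'k set set" where
  "constrained U \<equiv> {P \<in> primes. U P \<noteq> completion_integers P}"

section \<open>The ring of finite adeles\<close>

lemma local: "P \<in> primes \<Longrightarrow> number_field_prime P"
  using nf by (rule number_field_prime.intro)

lemmas local_cring = number_field_prime.cring_completion[OF local]

lemma adele_simps:
  "a \<otimes>\<^sub>\<A> b = (\<lambda>P\<in>primes. a P \<otimes>\<^bsub>completion P\<^esub> b P)" "a \<oplus>\<^sub>\<A> b = (\<lambda>P\<in>primes. a P \<oplus>\<^bsub>completion P\<^esub> b P)"
  "\<one>\<^sub>\<A> = (\<lambda>P\<in>primes. \<one>\<^bsub>completion P\<^esub>)" "\<zero>\<^sub>\<A> = (\<lambda>P\<in>primes. \<zero>\<^bsub>completion P\<^esub>)"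
  by (simp_all add: finite_adeles_def)

lemma adele_closed_iff:
  "a \<in> carrier \<A> \<longleftrightarrow> a \<in> extensional primes \<and> (\<forall>P\<in>primes. a P \<in> carrier (completion P)) \<and>
    finite (poles a)"
  by (auto simp: finite_adeles_def PiE_iff)

lemma adele_component: "a \<in> carrier \<A> \<Longrightarrow> P \<in> primes \<Longrightarrow> a P \<in> carrier (completion P)"
  by (simp add: adele_closed_iff)

lemma adele_finite: "a \<in> carrier \<A> \<Longrightarrow> finite (poles a)"
  by (simp add: adele_closed_iff)

lemma adele_eqI:
  assumes "a \<in> extensional primes" "b \<in> extensional primes" "\<And>P. P \<in> primes \<Longrightarrow> a P = b P"
  shows "a = b"
  using assms by (rule extensionalityI)

lemma adele_closedI:
  assumes "a \<in> carrier \<A>" "b \<in> carrier \<A>" "c \<in> extensional primes"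
    "\<And>P. P \<in> primes \<Longrightarrow> c P \<in> carrier (completion P)"
    "\<And>P. P \<in> primes \<Longrightarrow> a P \<in> completion_integers P \<Longrightarrow> b P \<in> completion_integers P \<Longrightarrow> c P \<in> completion_integers P"
  shows "c \<in> carrier \<A>"
proof -
  have "poles c \<subseteq>
    poles a \<union> poles b" using assms(5) by blast
  then have "finite (poles c)"
    using adele_finite[OF assms(1)] adele_finite[OF assms(2)] by (meson finite_UnI finite_subset)
  then show ?thesis using assms by (simp add: adele_closed_iff)
qed

lemma integral_adeles_iff:
  "a \<in> integral_adeles \<longleftrightarrow> a \<in> extensional primes \<and> (\<forall>P\<in>primes. a P \<in> completion_integers P)"
  by (auto simp: integral_adeles_def PiE_iff)

lemma integral_adeles_closed: "a \<in> integral_adeles \<Longrightarrow> a \<in> carrier \<A>"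
proof -
  assume "a \<in> integral_adeles"
  then have *: "a \<in> extensional primes" "\<And>P. P \<in> primes \<Longrightarrow> a P \<in> completion_integers P"
    by (auto simp: integral_adeles_iff)
  then have empty: "poles a = {}" by blast
  have "\<forall>P\<in>primes. a P \<in> carrier (completion P)" using *(2) by (simp add: completion_integers_def)
  then show "a \<in> carrier \<A>" unfolding adele_closed_iff empty using *(1) by simp
qed

lemma integral_adeles_ops:
  "\<zero>\<^sub>\<A> \<in> integral_adeles" "\<one>\<^sub>\<A> \<in> integral_adeles"
  "a \<in> integral_adeles \<Longrightarrow> b \<in> integral_adeles \<Longrightarrow> a \<oplus>\<^sub>\<A> b \<in> integral_adeles"
  "a \<in> integral_adeles \<Longrightarrow> b \<in> integral_adeles \<Longrightarrow> a \<otimes>\<^sub>\<A> b \<in> integral_adeles"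
  using number_field_prime.completion_integers_0_1[OF local]
    number_field_prime.completion_integers_add[OF local] number_field_prime.completion_integers_mult[OF local]
  by (auto simp: integral_adeles_iff adele_simps)

lemmas local_simprules = cring.cring_simprules[OF local_cring]

lemma adele_ops_closed:
  assumes "a \<in> carrier \<A>" "b \<in> carrier \<A>"
  shows "a \<oplus>\<^sub>\<A> b \<in> carrier \<A>" "a \<otimes>\<^sub>\<A> b \<in> carrier \<A>"
  using assms number_field_prime.completion_integers_add[OF local]
    number_field_prime.completion_integers_mult[OF local]
  by (auto intro!: adele_closedI[OF assms] simp: adele_simps adele_component local_simprules(1,5))

lemma adele_uminus:
  assumes "a \<in> carrier \<A>"
  shows "(\<lambda>P\<in>primes. \<ominus>\<^bsub>completion P\<^esub> a P) \<in> carrier \<A>"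
    "(\<lambda>P\<in>primes. \<ominus>\<^bsub>completion P\<^esub> a P) \<oplus>\<^sub>\<A> a = \<zero>\<^sub>\<A>"
  using assms number_field_prime.completion_integers_minus[OF local]
  by (auto intro!: adele_closedI[OF assms assms] adele_eqI
      simp: adele_simps adele_component local_simprules(3,9))

lemma cring_adeles: "cring \<A>"
proof (intro cringI abelian_groupI comm_monoidI)
  fix a assume a: "a \<in> carrier \<A>"
  then have ext: "a \<in> extensional primes" by (simp add: adele_closed_iff)
  show "\<zero>\<^sub>\<A> \<oplus>\<^sub>\<A> a = a" "\<one>\<^sub>\<A> \<otimes>\<^sub>\<A> a = a"
    using a ext by (auto simp: adele_simps adele_component local_simprules(8,12) intro!: adele_eqI)
  show "\<exists>b\<in>carrier \<A>. b \<oplus>\<^sub>\<A> a = \<zero>\<^sub>\<A>" using adele_uminus[OF a] by blast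
qed (simp_all add: adele_ops_closed integral_adeles_closed[OF integral_adeles_ops(1)]
    integral_adeles_closed[OF integral_adeles_ops(2)],
    auto simp: adele_simps(1,2) adele_component local_simprules(1,5,7,10,11,13,14,23,24,25) intro!: restrict_ext)

sublocale cring \<A>
  by (rule cring_adeles)

lemma integral_adeles_minus: "a \<in> integral_adeles \<Longrightarrow> \<ominus>\<^bsub>\<A>\<^esub> a \<in> integral_adeles"
proof -
  assume a: "a \<in> integral_adeles"
  have "\<ominus>\<^bsub>\<A>\<^esub> a = (\<lambda>P\<in>primes. \<ominus>\<^bsub>completion P\<^esub> a P)"
    using adele_uminus integral_adeles_closed[OF a] by (intro minus_equality)
  then show ?thesis
    using a number_field_prime.completion_integers_minus[OF local] by (simp add: integral_adeles_iff)
qed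

lemma diag_closed: "diag x \<in> carrier \<A>"
proof -
  have "{P \<in> primes. diag x P \<notin> completion_integers P} \<subseteq> {P \<in> primes. abs_val P x > 1}"
    using number_field_prime.completion_abs_embed[OF local] number_field_prime.embed_closed[OF local]
    by (auto simp: diag_def completion_integers_def)
  then have "finite {P \<in> primes. diag x P \<notin> completion_integers P}"
    using finite_abs_val_gt_1[OF nf] finite_subset by blast
  then show ?thesis
    using number_field_prime.embed_closed[OF local] by (simp add: adele_closed_iff) (simp add: diag_def)
qed

lemma diag_mult: "diag x \<otimes>\<^sub>\<A> diag y = diag (x * y)"
  using number_field_prime.embed_mult[OF local] by (auto simp: adele_simps diag_def intro!: adele_eqI)

lemma diag_1: "diag 1 = \<one>\<^sub>\<A>"
  using number_field_prime.embed_1[OF local] by (auto simp: adele_simps diag_def intro!: adele_eqI)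

lemma mem_adele_units:
  "u \<in> integral_adele_units \<longleftrightarrow> u \<in> integral_adeles \<and> (\<exists>v\<in>integral_adeles. u \<otimes>\<^sub>\<A> v = \<one>\<^sub>\<A>)"
  using integral_adeles_closed m_comm by (auto simp: integral_adele_units_def Units_def)

text \<open>Components of absolute value 1 have inverses of absolute value 1 in K_P; these are
  integral everywhere and together form the inverse adele.\<close>

lemma adele_unitsI:
  assumes "u \<in> extensional primes" "\<And>P. P \<in> primes \<Longrightarrow> u P \<in> carrier (completion P)"
    "\<And>P. P \<in> primes \<Longrightarrow> completion_abs P (u P) = 1"
  shows "u \<in> integral_adele_units"
proof -
  have "\<exists>v\<in>completion_integers P. u P \<otimes>\<^bsub>completion P\<^esub> v = \<one>\<^bsub>completion P\<^esub>" if P: "P \<in> primes" for P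
  proof -
    interpret number_field_prime P using P by (rule local)
    have "u P \<noteq> \<zero>\<^bsub>completion P\<^esub>" using assms(3)[OF P] by auto
    then obtain v where v: "v \<in> carrier (completion P)" "u P \<otimes>\<^bsub>completion P\<^esub> v = \<one>\<^bsub>completion P\<^esub>"
      using completion_inverse[OF assms(2)[OF P]] by blast
    then have "completion_abs P v = 1"
      using completion_abs_mult[OF assms(2)[OF P] v(1)] assms(3)[OF P] by simp
    then show ?thesis using v by (intro bexI[of _ v]) (simp_all add: completion_integers_def)
  qed
  then obtain v where v: "\<And>P. P \<in> primes \<Longrightarrow> v P \<in> completion_integers P"
    "\<And>P. P \<in> primes \<Longrightarrow> u P \<otimes>\<^bsub>completion P\<^esub> v P = \<one>\<^bsub>completion P\<^esub>" by metis
  have "(\<lambda>P\<in>primes. v P) \<in> integral_adeles" using v(1) by (simp add: integral_adeles_iff)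
  moreover have "u \<otimes>\<^sub>\<A> (\<lambda>P\<in>primes. v P) = \<one>\<^sub>\<A>" using v(2) by (auto simp: adele_simps intro!: adele_eqI)
  moreover have "u \<in> integral_adeles" using assms by (simp add: integral_adeles_iff completion_integers_def)
  ultimately show ?thesis unfolding mem_adele_units by blast
qed

lemma mem_zero_primes: "P \<in> zero_primes a \<longleftrightarrow> P \<in> primes \<and> a P = \<zero>\<^bsub>completion P\<^esub>"
  by (simp add: zero_primes_def)

text \<open>Multiplication by u can only enlarge the zero set, and multiplying back by v gives the
  reverse inclusion. This covers integral units as well as nonzero elements of K.\<close>

lemma zero_primes_unit_mult:
  assumes "u \<in> carrier \<A>" "v \<in> carrier \<A>" "u \<otimes>\<^sub>\<A> v = \<one>\<^sub>\<A>" "a \<in> carrier \<A>"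
  shows "zero_primes (u \<otimes>\<^sub>\<A> a) = zero_primes a"
proof -
  have sub: "zero_primes b \<subseteq> zero_primes (c \<otimes>\<^sub>\<A> b)" if "b \<in> carrier \<A>" "c \<in> carrier \<A>" for b c
  proof
    fix P assume "P \<in> zero_primes b"
    then have P: "P \<in> primes" "b P = \<zero>\<^bsub>completion P\<^esub>" by (auto simp: mem_zero_primes)
    interpret P: number_field_prime P using P(1) by (rule local)
    show "P \<in> zero_primes (c \<otimes>\<^sub>\<A> b)" using P that by (simp add: mem_zero_primes adele_simps adele_component)
  qed
  have "a = v \<otimes>\<^sub>\<A> (u \<otimes>\<^sub>\<A> a)"
    using assms by (metis m_assoc m_comm l_one)
  then show ?thesis using sub[OF assms(4,1)] sub[of "u \<otimes>\<^sub>\<A> a" v] assms(1,2,4) by auto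
qed

section \<open>The restricted product topology\<close>

lemma adele_top_basic_open:
  assumes "\<And>P. P \<in> primes \<Longrightarrow> openin (completion_top P) (U P)" "finite (constrained U)"
  shows "openin adele_top (Pi\<^sub>E primes U)"
  unfolding adele_top_def using assms by (intro topology_generated_by_Basis) blast

text \<open>The generating sets are closed under finite intersections, hence form a base: an
  intersection is constrained only at primes where one of the two sets is.\<close>

lemma adele_top_basic_nbhd:
  assumes "openin adele_top W" "a \<in> W"
  shows "\<exists>U. (\<forall>P\<in>primes. openin (completion_top P) (U P)) \<and> finite (constrained U) \<and>
    a \<in> Pi\<^sub>E primes U \<and> Pi\<^sub>E primes U \<subseteq> W"
proof -
  have "generate_topology_on {Pi\<^sub>E primes U | U. (\<forall>P\<in>primes. openin (completion_top P) (U P)) \<and>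
        finite (constrained U)} W"
    using assms(1) unfolding adele_top_def openin_topology_generated_by_iff .
  then show ?thesis using assms(2)
  proof (induction arbitrary: a rule: generate_topology_on.induct)
    case (Int V W)
    obtain U where U: "\<forall>P\<in>primes. openin (completion_top P) (U P)" "finite (constrained U)"
      "a \<in> Pi\<^sub>E primes U" "Pi\<^sub>E primes U \<subseteq> V" using Int.IH(1)[of a] Int.prems by blast
    obtain U' where U': "\<forall>P\<in>primes. openin (completion_top P) (U' P)" "finite (constrained U')"
      "a \<in> Pi\<^sub>E primes U'" "Pi\<^sub>E primes U' \<subseteq> W" using Int.IH(2)[of a] Int.prems by blast
    have "{P \<in> primes. U P \<inter> U' P \<noteq> completion_integers P} \<subseteq>
      constrained U \<union> constrained U'" by auto
    then have "finite {P \<in> primes. U P \<inter> U' P \<noteq> completion_integers P}"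
      using U(2) U'(2) by (meson finite_UnI finite_subset)
    moreover have "Pi\<^sub>E primes (\<lambda>P. U P \<inter> U' P) = Pi\<^sub>E primes U \<inter> Pi\<^sub>E primes U'" by (auto simp: PiE_iff)
    ultimately show ?case using U U' by (intro exI[of _ "\<lambda>P. U P \<inter> U' P"]) auto
  next
    case (UN \<K>)
    then obtain V where V: "V \<in> \<K>" "a \<in> V" by blast
    obtain U where "\<forall>P\<in>primes. openin (completion_top P) (U P)" "finite (constrained U)"
      "a \<in> Pi\<^sub>E primes U" "Pi\<^sub>E primes U \<subseteq> V" using UN.IH[OF V] by blast
    then show ?case using V(1) by (intro exI[of _ U]) blast
  next
    case (Basis W)
    then show ?case by blast
  qed simp
qed

text \<open>In a basic open set an element can have poles only at the finitely many constrained
  primes.\<close>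

lemma openin_adele_top_carrier:
  assumes "openin adele_top W"
  shows "W \<subseteq> carrier \<A>"
proof
  fix a assume "a \<in> W"
  then obtain U where U: "\<forall>P\<in>primes. openin (completion_top P) (U P)" "finite (constrained U)"
    "a \<in> Pi\<^sub>E primes U" using adele_top_basic_nbhd[OF assms] by blast
  have "poles a \<subseteq> constrained U"
    using U(3) by (auto simp: PiE_iff)
  then have "finite (poles a)" using U(2) finite_subset by blast
  moreover have "a P \<in> carrier (completion P)" if P: "P \<in> primes" for P
  proof -
    interpret number_field_prime P using P by (rule local)
    have "U P \<subseteq> carrier (completion P)" using U(1) P openin_completion_top by blast
    then show ?thesis using U(3) P by (auto simp: PiE_iff)
  qed
  ultimately show "a \<in> carrier \<A>" using U(3) by (simp add: adele_closed_iff PiE_iff)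
qed

lemma openin_adele_top_nonzero:
  assumes F: "finite F" "F \<subseteq> primes"
  shows "openin adele_top {a \<in> carrier \<A>. zero_primes a \<inter> F = {}}"
  unfolding openin_subopen[of _ "{a \<in> carrier \<A>. zero_primes a \<inter> F = {}}"]
proof
  fix a assume "a \<in> {a \<in> carrier \<A>. zero_primes a \<inter> F = {}}"
  then have a: "a \<in> carrier \<A>" "\<And>P. P \<in> F \<Longrightarrow> a P \<noteq> \<zero>\<^bsub>completion P\<^esub>" using F(2) mem_zero_primes by blast+
  \<comment> \<open>Outside F the whole K_P is allowed at the poles of a and the integers at all
    other primes, so the constrained primes lie in F or among the poles.\<close>
  define U where "U P = (if P \<in> F then carrier (completion P) - {\<zero>\<^bsub>completion P\<^esub>}
    else if a P \<in> completion_integers P then completion_integers P else carrier (completion P))" for P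
  have "openin (completion_top P) (U P)" if P: "P \<in> primes" for P
  proof -
    interpret number_field_prime P using P by (rule local)
    show ?thesis using openin_completion_nonzero openin_completion_integers openin_completion_carrier
      by (simp add: U_def)
  qed
  moreover have "constrained U \<subseteq> F \<union> poles a"
    by (auto simp: U_def)
  then have "finite (constrained U)"
    using F(1) adele_finite[OF a(1)] by (meson finite_UnI finite_subset)
  ultimately have op: "openin adele_top (Pi\<^sub>E primes U)" by (rule adele_top_basic_open)
  moreover have "a \<in> Pi\<^sub>E primes U"
    using a by (auto simp: U_def PiE_iff adele_closed_iff)
  moreover have "Pi\<^sub>E primes U \<subseteq> {a \<in> carrier \<A>. zero_primes a \<inter> F = {}}"
  proof
    fix b assume b: "b \<in> Pi\<^sub>E primes U"
    then have "b \<in> carrier \<A>" using openin_adele_top_carrier[OF op] by blast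
    moreover have "b P \<noteq> \<zero>\<^bsub>completion P\<^esub>" if "P \<in> F" for P
    proof -
      have "b P \<in> U P" using b that F(2) by blast
      then show ?thesis using that by (simp add: U_def)
    qed
    ultimately show "b \<in> {a \<in> carrier \<A>. zero_primes a \<inter> F = {}}" by (auto simp: mem_zero_primes)
  qed
  ultimately show "\<exists>T. openin adele_top T \<and> a \<in> T \<and> T \<subseteq> {a \<in> carrier \<A>. zero_primes a \<inter> F = {}}" by blast
qed

lemma topspace_adele_top: "topspace adele_top = carrier \<A>"
proof
  show "topspace adele_top \<subseteq> carrier \<A>" by (rule openin_adele_top_carrier[OF openin_topspace])
  show "carrier \<A> \<subseteq> topspace adele_top"
    using openin_subset[OF openin_adele_top_nonzero[of "{}"]] by simp
qed

text \<open>Neighbourhoods in metric form: a common precision \<epsilon> at finitely many primes,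
  integrality at the rest. The bound \<epsilon> \<le> 1 lets closeness to an integral component
  imply integrality.\<close>

lemma adele_nbhd:
  assumes "openin adele_top W" "a \<in> W"
  obtains F \<epsilon> where "finite F" "F \<subseteq> primes" "\<epsilon> > 0" "\<epsilon> \<le> 1" "\<And>P. P \<in> primes - F \<Longrightarrow> a P \<in> completion_integers P"
    "\<And>b. b \<in> carrier \<A> \<Longrightarrow> (\<And>P. P \<in> F \<Longrightarrow> completion_abs P (b P \<ominus>\<^bsub>completion P\<^esub> a P) < \<epsilon>) \<Longrightarrow>
      (\<And>P. P \<in> primes - F \<Longrightarrow> b P \<in> completion_integers P) \<Longrightarrow> b \<in> W"
proof -
  obtain U where U: "\<And>P. P \<in> primes \<Longrightarrow> openin (completion_top P) (U P)"
    "finite (constrained U)" "a \<in> Pi\<^sub>E primes U" "Pi\<^sub>E primes U \<subseteq> W"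
    using adele_top_basic_nbhd[OF assms] by blast
  define F where "F = constrained U"
  have "\<exists>r>0. \<forall>c\<in>carrier (completion P). completion_abs P (c \<ominus>\<^bsub>completion P\<^esub> a P) < r \<longrightarrow> c \<in> U P"
    if P: "P \<in> F" for P
  proof -
    have P': "P \<in> primes" using P by (simp add: F_def)
    interpret number_field_prime P using P' by (rule local)
    have "a P \<in> U P" using U(3) P' by (auto simp: PiE_iff)
    then show ?thesis using U(1)[OF P'] unfolding openin_completion_top by blast
  qed
  then obtain r where r: "\<And>P. P \<in> F \<Longrightarrow> r P > 0"
    "\<And>P c. P \<in> F \<Longrightarrow> c \<in> carrier (completion P) \<Longrightarrow> completion_abs P (c \<ominus>\<^bsub>completion P\<^esub> a P) < r P \<Longrightarrow> c \<in> U P"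
    by metis
  \<comment> \<open>Inserting 1 gives the upper bound and keeps the minimum defined for empty
    F.\<close>
  define \<epsilon> where "\<epsilon> = Min (insert 1 (r ` F))"
  have F: "finite F" "F \<subseteq> primes" using U(2) by (auto simp: F_def)
  have "\<epsilon> > 0" unfolding \<epsilon>_def using F(1) r(1) by (subst Min_gr_iff) auto
  moreover have "\<epsilon> \<le> 1" unfolding \<epsilon>_def using F(1) by (intro Min_le) auto
  moreover have \<epsilon>: "\<epsilon> \<le> r P" if "P \<in> F" for P unfolding \<epsilon>_def using F(1) that by (intro Min_le) auto
  moreover have "a P \<in> completion_integers P" if "P \<in> primes - F" for P
    using U(3) that by (auto simp: F_def PiE_iff)
  moreover have "b \<in> W" if b: "b \<in> carrier \<A>" "\<And>P. P \<in> F \<Longrightarrow> completion_abs P (b P \<ominus>\<^bsub>completion P\<^esub> a P) < \<epsilon>"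
      "\<And>P. P \<in> primes - F \<Longrightarrow> b P \<in> completion_integers P" for b
  proof -
    have "b P \<in> U P" if P: "P \<in> primes" for P
    proof (cases "P \<in> F")
      case True
      then show ?thesis using r(2)[OF True adele_component[OF b(1) P]] b(2)[OF True] \<epsilon>[OF True] by linarith
    next
      case False
      then show ?thesis using b(3)[of P] P by (simp add: F_def)
    qed
    then have "b \<in> Pi\<^sub>E primes U" using b(1) by (simp add: PiE_iff adele_closed_iff)
    then show ?thesis using U(4) by blast
  qed
  ultimately show ?thesis using that[of F \<epsilon>] F by blast
qed

end

section \<open>Orbit closures and quasi-orbits\<close>

context number_field_adeles
begin

section \<open>Integral units, the equivalence relation and the action\<close>

lemma adele_units_closed:
  assumes "u \<in> integral_adele_units"
  shows "u \<in> integral_adeles" "u \<in> carrier \<A>"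
  using assms integral_adeles_closed by (auto simp: mem_adele_units)

lemma adele_units_one: "\<one>\<^sub>\<A> \<in> integral_adele_units"
  unfolding mem_adele_units using integral_adeles_ops(2) by (intro conjI bexI[of _ "\<one>\<^sub>\<A>"]) simp_all

lemma adele_units_inverse:
  assumes "u \<in> integral_adele_units"
  obtains v where "v \<in> integral_adele_units" "u \<otimes>\<^sub>\<A> v = \<one>\<^sub>\<A>"
proof -
  obtain v where v: "u \<in> integral_adeles" "v \<in> integral_adeles" "u \<otimes>\<^sub>\<A> v = \<one>\<^sub>\<A>"
    using assms by (auto simp: mem_adele_units)
  then have "v \<otimes>\<^sub>\<A> u = \<one>\<^sub>\<A>" using integral_adeles_closed m_comm by simp
  then show ?thesis using that v by (auto simp: mem_adele_units)
qed

lemma adele_units_mult: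
  assumes "u \<in> integral_adele_units" "v \<in> integral_adele_units"
  shows "u \<otimes>\<^sub>\<A> v \<in> integral_adele_units"
proof -
  obtain u' where u': "u' \<in> integral_adele_units" "u \<otimes>\<^sub>\<A> u' = \<one>\<^sub>\<A>"
    using adele_units_inverse[OF assms(1)] by blast
  obtain v' where v': "v' \<in> integral_adele_units" "v \<otimes>\<^sub>\<A> v' = \<one>\<^sub>\<A>"
    using adele_units_inverse[OF assms(2)] by blast
  note c = adele_units_closed
  have "(u \<otimes>\<^sub>\<A> v) \<otimes>\<^sub>\<A> (u' \<otimes>\<^sub>\<A> v') = (u \<otimes>\<^sub>\<A> u') \<otimes>\<^sub>\<A> (v \<otimes>\<^sub>\<A> v')"
    using c(2)[OF assms(1)] c(2)[OF assms(2)] c(2)[OF u'(1)] c(2)[OF v'(1)] by algebra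
  then have "(u \<otimes>\<^sub>\<A> v) \<otimes>\<^sub>\<A> (u' \<otimes>\<^sub>\<A> v') = \<one>\<^sub>\<A>" unfolding u'(2) v'(2) by simp
  moreover have "u \<otimes>\<^sub>\<A> v \<in> integral_adeles" "u' \<otimes>\<^sub>\<A> v' \<in> integral_adeles"
    using integral_adeles_ops(4) c(1) assms u'(1) v'(1) by blast+
  ultimately show ?thesis unfolding mem_adele_units by blast
qed

lemma mem_l_coset: "x \<in> a <#\<^bsub>\<A>\<^esub> H \<longleftrightarrow> (\<exists>h\<in>H. x = a \<otimes>\<^sub>\<A> h)"
  by (auto simp: l_coset_def)

lemma l_coset_units_eq_iff:
  assumes a: "a \<in> carrier \<A>" and b: "b \<in> carrier \<A>"
  shows "a <#\<^bsub>\<A>\<^esub> integral_adele_units = b <#\<^bsub>\<A>\<^esub> integral_adele_units \<longleftrightarrow>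
    (\<exists>u\<in>integral_adele_units. b = a \<otimes>\<^sub>\<A> u)"
proof
  assume eq: "a <#\<^bsub>\<A>\<^esub> integral_adele_units = b <#\<^bsub>\<A>\<^esub> integral_adele_units"
  have "b \<otimes>\<^sub>\<A> \<one>\<^sub>\<A> \<in> b <#\<^bsub>\<A>\<^esub> integral_adele_units"
    using adele_units_one unfolding mem_l_coset by blast
  then have "b \<in> a <#\<^bsub>\<A>\<^esub> integral_adele_units" using b by (simp only: eq r_one)
  then show "\<exists>u\<in>integral_adele_units. b = a \<otimes>\<^sub>\<A> u" by (simp only: mem_l_coset)
next
  have sub: "c \<otimes>\<^sub>\<A> u <#\<^bsub>\<A>\<^esub> integral_adele_units \<subseteq> c <#\<^bsub>\<A>\<^esub> integral_adele_units"
    if "c \<in> carrier \<A>" "u \<in> integral_adele_units" for c u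
  proof
    fix x assume "x \<in> c \<otimes>\<^sub>\<A> u <#\<^bsub>\<A>\<^esub> integral_adele_units"
    then obtain w where w: "w \<in> integral_adele_units" "x = c \<otimes>\<^sub>\<A> u \<otimes>\<^sub>\<A> w" by (auto simp: l_coset_def)
    then have "x = c \<otimes>\<^sub>\<A> (u \<otimes>\<^sub>\<A> w)"
      using that adele_units_closed(2) by (simp add: m_assoc)
    then show "x \<in> c <#\<^bsub>\<A>\<^esub> integral_adele_units"
      using adele_units_mult[OF that(2) w(1)] by (auto simp: l_coset_def)
  qed
  assume "\<exists>u\<in>integral_adele_units. b = a \<otimes>\<^sub>\<A> u"
  then obtain u where u: "u \<in> integral_adele_units" "b = a \<otimes>\<^sub>\<A> u" by blast
  obtain v where v: "v \<in> integral_adele_units" "u \<otimes>\<^sub>\<A> v = \<one>\<^sub>\<A>"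
    using adele_units_inverse[OF u(1)] by blast
  have "b \<otimes>\<^sub>\<A> v = a"
    using u v a adele_units_closed(2) by (simp add: m_assoc)
  then show "a <#\<^bsub>\<A>\<^esub> integral_adele_units = b <#\<^bsub>\<A>\<^esub> integral_adele_units"
    using sub[OF a u(1)] sub[OF b v(1)] u(2) by auto
qed

lemma Omega_rel_iff:
  "((r, a), (s, b)) \<in> Omega_rel \<longleftrightarrow> r \<in> carrier \<A> \<and> a \<in> carrier \<A> \<and> s \<in> carrier \<A> \<and> b \<in> carrier \<A> \<and>
    (\<exists>u\<in>integral_adele_units. b = a \<otimes>\<^sub>\<A> u) \<and> (\<exists>z\<in>integral_adeles. r \<ominus>\<^sub>\<A> s = a \<otimes>\<^sub>\<A> z)"
  using l_coset_units_eq_iff[of a b] by (auto simp: Omega_rel_def mem_l_coset)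

abbreviation Orel :: "(('k adele \<times> 'k adele) \<times> ('k adele \<times> 'k adele)) set" where
  "Orel \<equiv> Omega_rel"

text \<open>Since b = a u with an integral unit u, the adeles a and b have the same integral
  multiples. This makes the condition on r - s symmetric and lets it add up along a chain.\<close>

lemma equiv_Omega_rel: "equiv (carrier \<A> \<times> carrier \<A>) Orel"
proof (rule equivI)
  show "Orel \<subseteq> (carrier \<A> \<times> carrier \<A>) \<times> (carrier \<A> \<times> carrier \<A>)" by (auto simp: Omega_rel_def)
  show "refl_on (carrier \<A> \<times> carrier \<A>) Orel"
  proof (rule refl_onI)
    fix p :: "'k adele \<times> 'k adele" assume "p \<in> carrier \<A> \<times> carrier \<A>"
    then obtain r a where p: "p = (r, a)" "r \<in> carrier \<A>" "a \<in> carrier \<A>" by blast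
    have "a = a \<otimes>\<^sub>\<A> \<one>\<^sub>\<A>" "r \<ominus>\<^sub>\<A> r = a \<otimes>\<^sub>\<A> \<zero>\<^sub>\<A>" using p by (simp_all add: a_minus_def r_neg)
    then show "(p, p) \<in> Omega_rel"
      unfolding p(1) Omega_rel_iff using p(2,3) adele_units_one integral_adeles_ops(1) by blast
  qed
  show "sym Orel"
  proof (rule symI)
    fix p q :: "'k adele \<times> 'k adele" assume pq: "(p, q) \<in> Omega_rel"
    obtain r a s b where [simp]: "p = (r, a)" "q = (s, b)" by force
    obtain u z where c: "r \<in> carrier \<A>" "a \<in> carrier \<A>" "s \<in> carrier \<A>" "b \<in> carrier \<A>"
      and u: "u \<in> integral_adele_units" "b = a \<otimes>\<^sub>\<A> u" and z: "z \<in> integral_adeles" "r \<ominus>\<^sub>\<A> s = a \<otimes>\<^sub>\<A> z"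
      using pq unfolding \<open>p = (r, a)\<close> \<open>q = (s, b)\<close> Omega_rel_iff by blast
    obtain v where v: "v \<in> integral_adele_units" "u \<otimes>\<^sub>\<A> v = \<one>\<^sub>\<A>"
      using adele_units_inverse[OF u(1)] by blast
    note uc = adele_units_closed(2)[OF u(1)] and vc = adele_units_closed(2)[OF v(1)]
      and zc = integral_adeles_closed[OF z(1)]
    have a: "a = b \<otimes>\<^sub>\<A> v" using u v c uc vc by (simp add: m_assoc)
    have "s \<ominus>\<^sub>\<A> r = \<ominus>\<^bsub>\<A>\<^esub> (r \<ominus>\<^sub>\<A> s)" using c by algebra
    also have "\<dots> = \<ominus>\<^bsub>\<A>\<^esub> (b \<otimes>\<^sub>\<A> v \<otimes>\<^sub>\<A> z)" unfolding z(2) a[symmetric] ..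
    also have "\<dots> = b \<otimes>\<^sub>\<A> (v \<otimes>\<^sub>\<A> \<ominus>\<^bsub>\<A>\<^esub> z)" using c vc zc by algebra
    finally have "s \<ominus>\<^sub>\<A> r = b \<otimes>\<^sub>\<A> (v \<otimes>\<^sub>\<A> \<ominus>\<^bsub>\<A>\<^esub> z)" .
    moreover have "v \<otimes>\<^sub>\<A> \<ominus>\<^bsub>\<A>\<^esub> z \<in> integral_adeles"
      using integral_adeles_ops(4) integral_adeles_minus adele_units_closed(1) v(1) z(1) by blast
    ultimately show "(q, p) \<in> Omega_rel"
      unfolding \<open>p = (r, a)\<close> \<open>q = (s, b)\<close> Omega_rel_iff using c a v(1) by blast
  qed
  show "trans Orel"
  proof (rule transI)
    fix p q t :: "'k adele \<times> 'k adele" assume pq: "(p, q) \<in> Omega_rel" and qt: "(q, t) \<in> Omega_rel"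
    obtain r a s b l d where [simp]: "p = (r, a)" "q = (s, b)" "t = (l, d)"
      by (cases p, cases q, cases t) blast
    obtain u z where c: "r \<in> carrier \<A>" "a \<in> carrier \<A>" "s \<in> carrier \<A>" "b \<in> carrier \<A>"
      and u: "u \<in> integral_adele_units" "b = a \<otimes>\<^sub>\<A> u" and z: "z \<in> integral_adeles" "r \<ominus>\<^sub>\<A> s = a \<otimes>\<^sub>\<A> z"
      using pq unfolding \<open>p = (r, a)\<close> \<open>q = (s, b)\<close> Omega_rel_iff by blast
    obtain v w where c': "l \<in> carrier \<A>" "d \<in> carrier \<A>"
      and v: "v \<in> integral_adele_units" "d = b \<otimes>\<^sub>\<A> v" and w: "w \<in> integral_adeles" "s \<ominus>\<^sub>\<A> l = b \<otimes>\<^sub>\<A> w"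
      using qt unfolding \<open>q = (s, b)\<close> \<open>t = (l, d)\<close> Omega_rel_iff by blast
    note uc = adele_units_closed[OF u(1)] and vc = adele_units_closed[OF v(1)]
      and zc = integral_adeles_closed[OF z(1)] and wc = integral_adeles_closed[OF w(1)]
    have d: "d = a \<otimes>\<^sub>\<A> (u \<otimes>\<^sub>\<A> v)" unfolding v(2) u(2) using c uc vc by (simp add: m_assoc)
    have "r \<ominus>\<^sub>\<A> l = (r \<ominus>\<^sub>\<A> s) \<oplus>\<^sub>\<A> (s \<ominus>\<^sub>\<A> l)" using c c' by algebra
    also have "\<dots> = a \<otimes>\<^sub>\<A> z \<oplus>\<^sub>\<A> a \<otimes>\<^sub>\<A> u \<otimes>\<^sub>\<A> w" unfolding z(2) w(2) u(2) ..
    also have "\<dots> = a \<otimes>\<^sub>\<A> (z \<oplus>\<^sub>\<A> u \<otimes>\<^sub>\<A> w)" using c(2) zc uc(2) wc by algebra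
    finally have "r \<ominus>\<^sub>\<A> l = a \<otimes>\<^sub>\<A> (z \<oplus>\<^sub>\<A> u \<otimes>\<^sub>\<A> w)" .
    moreover have "z \<oplus>\<^sub>\<A> u \<otimes>\<^sub>\<A> w \<in> integral_adeles"
      using integral_adeles_ops(3,4) uc(1) z(1) w(1) by blast
    moreover have "u \<otimes>\<^sub>\<A> v \<in> integral_adele_units" by (rule adele_units_mult[OF u(1) v(1)])
    ultimately show "(p, t) \<in> Omega_rel"
      unfolding \<open>p = (r, a)\<close> \<open>t = (l, d)\<close> Omega_rel_iff using c c' d by blast
  qed
qed

lemma omega_eq_iff:
  assumes "r \<in> carrier \<A>" "a \<in> carrier \<A>" "s \<in> carrier \<A>" "b \<in> carrier \<A>"
  shows "omega r a = omega s b \<longleftrightarrow> ((r, a), (s, b)) \<in> Omega_rel"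
  unfolding omega_def using assms by (intro eq_equiv_class_iff[OF equiv_Omega_rel]) auto

text \<open>This is the freedom that absorbs the local unit discrepancy in the orbit
  closure.\<close>

lemma omega_unit:
  assumes "r \<in> carrier \<A>" "a \<in> carrier \<A>" "u \<in> integral_adele_units"
  shows "omega r (a \<otimes>\<^sub>\<A> u) = omega r a"
proof -
  have "r \<ominus>\<^sub>\<A> r = a \<otimes>\<^sub>\<A> \<zero>\<^sub>\<A>" using assms by (simp add: a_minus_def r_neg)
  then have "((r, a), (r, a \<otimes>\<^sub>\<A> u)) \<in> Omega_rel"
    unfolding Omega_rel_iff using assms adele_units_closed(2) integral_adeles_ops(1) by blast
  then show ?thesis
    using assms adele_units_closed(2) by (subst eq_commute, subst omega_eq_iff) auto
qed

lemma topspace_prod: "topspace (prod_topology adele_top adele_top) = carrier \<A> \<times> carrier \<A>"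
  by (simp add: topspace_adele_top)

lemma topspace_Omega_top:
  "topspace Omega_top = {omega r a | r a. r \<in> carrier \<A> \<and> a \<in> carrier \<A>}"
  unfolding Omega_top_def topspace_quotient_topology topspace_prod quotient_def omega_def by auto

lemma openin_Omega_top:
  "openin Omega_top V \<longleftrightarrow> V \<subseteq> topspace Omega_top \<and>
    openin (prod_topology adele_top adele_top) {(r, a). r \<in> carrier \<A> \<and> a \<in> carrier \<A> \<and> omega r a \<in> V}"
proof -
  have "{x \<in> topspace (prod_topology adele_top adele_top). Omega_rel `` {x} \<in> V} =
      {(r, a). r \<in> carrier \<A> \<and> a \<in> carrier \<A> \<and> omega r a \<in> V}"
    unfolding topspace_prod omega_def by auto
  then show ?thesis
    unfolding topspace_quotient_topology Omega_top_def openin_quotient_topology by simp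
qed

lemma Omega_top_nbhd:
  assumes "openin Omega_top V" "omega r a \<in> V" "r \<in> carrier \<A>" "a \<in> carrier \<A>"
  obtains M N where "openin adele_top M" "openin adele_top N" "r \<in> M" "a \<in> N"
    "\<And>s b. s \<in> M \<Longrightarrow> b \<in> N \<Longrightarrow> omega s b \<in> V"
proof -
  define S where "S = {(r, a). r \<in> carrier \<A> \<and> a \<in> carrier \<A> \<and> omega r a \<in> V}"
  have S: "openin (prod_topology adele_top adele_top) S"
    using assms(1) by (simp add: openin_Omega_top S_def)
  have "(r, a) \<in> S" using assms by (simp add: S_def)
  from S[unfolded openin_prod_topology_alt, rule_format, OF this]
  obtain M N where MN: "openin adele_top M" "openin adele_top N" "r \<in> M" "a \<in> N" "M \<times> N \<subseteq> S"
    by blast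
  have "omega s b \<in> V" if "s \<in> M" "b \<in> N" for s b using MN(5) that unfolding S_def by blast
  with MN(1-4) show ?thesis by (intro that[of M N])
qed

text \<open>The action multiplies r - s as well as a and b by k, so related pairs stay related and
  all members of the union in \<open>affine_action\<close> coincide.\<close>

lemma affine_action_omega:
  assumes r: "r \<in> carrier \<A>" and a: "a \<in> carrier \<A>"
  shows "affine_action (x, k) (omega r a) = omega (diag x \<oplus>\<^sub>\<A> diag k \<otimes>\<^sub>\<A> r) (diag k \<otimes>\<^sub>\<A> a)"
proof -
  have eq: "omega (diag x \<oplus>\<^sub>\<A> diag k \<otimes>\<^sub>\<A> s) (diag k \<otimes>\<^sub>\<A> b) =
      omega (diag x \<oplus>\<^sub>\<A> diag k \<otimes>\<^sub>\<A> r) (diag k \<otimes>\<^sub>\<A> a)"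
    if "(s, b) \<in> omega r a" for s b
  proof -
    have "((r, a), (s, b)) \<in> Omega_rel" using that by (simp add: omega_def)
    then obtain u z where c: "s \<in> carrier \<A>" "b \<in> carrier \<A>"
      and u: "u \<in> integral_adele_units" "b = a \<otimes>\<^sub>\<A> u" and z: "z \<in> integral_adeles" "r \<ominus>\<^sub>\<A> s = a \<otimes>\<^sub>\<A> z"
      unfolding Omega_rel_iff by blast
    note uc = adele_units_closed(2)[OF u(1)] and zc = integral_adeles_closed[OF z(1)]
      and x = diag_closed[of x] and k = diag_closed[of k]
    have "(diag x \<oplus>\<^sub>\<A> diag k \<otimes>\<^sub>\<A> r) \<ominus>\<^sub>\<A> (diag x \<oplus>\<^sub>\<A> diag k \<otimes>\<^sub>\<A> s) = diag k \<otimes>\<^sub>\<A> (r \<ominus>\<^sub>\<A> s)"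
      using r c(1) x k by algebra
    also have "\<dots> = diag k \<otimes>\<^sub>\<A> a \<otimes>\<^sub>\<A> z" unfolding z(2) using a zc k by (simp add: m_assoc)
    finally have "(diag x \<oplus>\<^sub>\<A> diag k \<otimes>\<^sub>\<A> r) \<ominus>\<^sub>\<A> (diag x \<oplus>\<^sub>\<A> diag k \<otimes>\<^sub>\<A> s) = diag k \<otimes>\<^sub>\<A> a \<otimes>\<^sub>\<A> z" .
    moreover have "diag k \<otimes>\<^sub>\<A> b = diag k \<otimes>\<^sub>\<A> a \<otimes>\<^sub>\<A> u" unfolding u(2) using a uc k by (simp add: m_assoc)
    ultimately have "((diag x \<oplus>\<^sub>\<A> diag k \<otimes>\<^sub>\<A> r, diag k \<otimes>\<^sub>\<A> a),
        (diag x \<oplus>\<^sub>\<A> diag k \<otimes>\<^sub>\<A> s, diag k \<otimes>\<^sub>\<A> b)) \<in> Omega_rel"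
      unfolding Omega_rel_iff using r a c x k u(1) z(1) by blast
    then show ?thesis using r a c x k by (subst eq_commute, subst omega_eq_iff) auto
  qed
  have mem: "(r, a) \<in> omega r a"
    unfolding omega_def using equiv_class_self[OF equiv_Omega_rel] r a by blast
  show ?thesis
    unfolding affine_action_def prod.case
    by (rule UN_constant_eq[OF mem]) (clarify, erule eq)
qed

section \<open>Orbits and the invariance of Z\<close>

abbreviation "affine_orbit r a \<equiv> orbit affine_group affine_action (omega r a :: ('k adele \<times> 'k adele) set)"
abbreviation "affine_quasi_orbit_rel \<equiv> quasi_orbit_rel affine_group affine_action (Omega_top :: ('k adele \<times> 'k adele) set topology)"

lemma orbit_omega:
  assumes "r \<in> carrier \<A>" "a \<in> carrier \<A>"
  shows "affine_orbit r a =
    {omega (diag x \<oplus>\<^sub>\<A> diag k \<otimes>\<^sub>\<A> r) (diag k \<otimes>\<^sub>\<A> a) | x k. k \<noteq> 0}"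
  using affine_action_omega[OF assms] by (auto simp: orbit_def affine_group_def)

lemma zero_primes_diag_mult:
  assumes "k \<noteq> 0" "a \<in> carrier \<A>"
  shows "zero_primes (diag k \<otimes>\<^sub>\<A> a) = zero_primes a"
  using assms diag_mult[of k "inverse k"] diag_1
  by (intro zero_primes_unit_mult[OF diag_closed diag_closed[of "inverse k"]]) simp_all

lemma zero_primes_omega:
  assumes "omega r a = omega s b" "r \<in> carrier \<A>" "a \<in> carrier \<A>" "s \<in> carrier \<A>" "b \<in> carrier \<A>"
  shows "zero_primes a = zero_primes b"
proof -
  have "((r, a), (s, b)) \<in> Omega_rel" using assms omega_eq_iff by blast
  then obtain u where u: "u \<in> integral_adele_units" "b = a \<otimes>\<^sub>\<A> u" by (auto simp: Omega_rel_iff)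
  obtain v where v: "v \<in> integral_adele_units" "u \<otimes>\<^sub>\<A> v = \<one>\<^sub>\<A>"
    using adele_units_inverse[OF u(1)] by blast
  note uc = adele_units_closed(2)[OF u(1)] and vc = adele_units_closed(2)[OF v(1)]
  have "b = u \<otimes>\<^sub>\<A> a" using u(2) assms(3) uc by (simp add: m_comm)
  then show ?thesis using zero_primes_unit_mult[OF uc vc v(2) assms(3)] by simp
qed

text \<open>The preimage under Z of the basic open set U_F, described by representatives.\<close>

definition nonvanishing :: "'k set set \<Rightarrow> ('k adele \<times> 'k adele) set set" where
  "nonvanishing F = {omega r a | r a. r \<in> carrier \<A> \<and> a \<in> carrier \<A> \<and> zero_primes a \<inter> F = {}}"

lemma mem_nonvanishing:
  assumes "r \<in> carrier \<A>" "a \<in> carrier \<A>"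
  shows "omega r a \<in> nonvanishing F \<longleftrightarrow> zero_primes a \<inter> F = {}"
  using assms zero_primes_omega[OF _ assms] unfolding nonvanishing_def by blast

lemma openin_nonvanishing:
  assumes "finite F" "F \<subseteq> primes"
  shows "openin Omega_top (nonvanishing F)"
proof -
  have "{(r, a). r \<in> carrier \<A> \<and> a \<in> carrier \<A> \<and> omega r a \<in> nonvanishing F} =
      carrier \<A> \<times> {a \<in> carrier \<A>. zero_primes a \<inter> F = {}}"
    using mem_nonvanishing by auto
  moreover have "openin (prod_topology adele_top adele_top) \<dots>"
    using openin_adele_top_nonzero[OF assms] openin_topspace[of "adele_top :: 'k adele topology"]
    by (auto simp: openin_prod_Times_iff topspace_adele_top)
  moreover have "nonvanishing F \<subseteq> topspace Omega_top"
    unfolding nonvanishing_def topspace_Omega_top by blast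
  ultimately show ?thesis unfolding openin_Omega_top by simp
qed

section \<open>Approximation by K and, up to integral units, by its nonzero elements\<close>

text \<open>Translates of K are dense: strong approximation is applied to s - q at the constrained
  primes and at the poles of q, while x and q are integral elsewhere.\<close>

lemma diag_add_dense:
  assumes W: "openin adele_top W" "s \<in> W" and q: "q \<in> carrier \<A>"
  obtains x where "diag x \<oplus>\<^sub>\<A> q \<in> W"
proof -
  obtain F \<epsilon> where F: "finite F" "F \<subseteq> primes" and \<epsilon>: "\<epsilon> > 0" "\<epsilon> \<le> 1"
    and sF: "\<And>P. P \<in> primes - F \<Longrightarrow> s P \<in> completion_integers P"
    and nbhd: "\<And>b. b \<in> carrier \<A> \<Longrightarrow> (\<And>P. P \<in> F \<Longrightarrow> completion_abs P (b P \<ominus>\<^bsub>completion P\<^esub> s P) < \<epsilon>) \<Longrightarrow>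
      (\<And>P. P \<in> primes - F \<Longrightarrow> b P \<in> completion_integers P) \<Longrightarrow> b \<in> W"
    using adele_nbhd[OF W] by blast
  have s: "s \<in> carrier \<A>" using W openin_adele_top_carrier by blast
  \<comment> \<open>At a pole of q outside F, x has to cancel the pole: x + q comes within
    \<epsilon> \<le> 1 of s, which is integral there.\<close>
  define G where "G = F \<union> poles q"
  have G: "finite G" "G \<subseteq> primes" using F adele_finite[OF q] by (auto simp: G_def)
  have "\<exists>y. completion_abs P (embed P y \<ominus>\<^bsub>completion P\<^esub> (s P \<ominus>\<^bsub>completion P\<^esub> q P)) < \<epsilon>" if P: "P \<in> G" for P
  proof -
    have P': "P \<in> primes" using P G(2) by blast
    interpret number_field_prime P using P' by (rule local)
    show ?thesis
      using embed_dense[OF completion.minus_closed[OF adele_component[OF s P'] adele_component[OF q P']] \<epsilon>(1)] by blast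
  qed
  then obtain f where f: "\<And>P. P \<in> G \<Longrightarrow>
      completion_abs P (embed P (f P) \<ominus>\<^bsub>completion P\<^esub> (s P \<ominus>\<^bsub>completion P\<^esub> q P)) < \<epsilon>" by metis
  obtain x where x: "\<And>P. P \<in> G \<Longrightarrow> abs_val P (x - f P) < \<epsilon>" "\<And>Q. Q \<in> primes - G \<Longrightarrow> abs_val Q x \<le> 1"
    using strong_approximation[OF nf G \<epsilon>(1)] by blast
  have comp: "(diag x \<oplus>\<^sub>\<A> q) P = embed P x \<oplus>\<^bsub>completion P\<^esub> q P" if "P \<in> primes" for P
    using that by (simp add: adele_simps diag_def)
  have closed: "diag x \<oplus>\<^sub>\<A> q \<in> carrier \<A>" using diag_closed q by simp
  have close: "completion_abs P ((diag x \<oplus>\<^sub>\<A> q) P \<ominus>\<^bsub>completion P\<^esub> s P) < \<epsilon>" if P: "P \<in> G" for P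
  proof -
    have P': "P \<in> primes" using P G(2) by blast
    interpret number_field_prime P using P' by (rule local)
    note sP = adele_component[OF s P'] and qP = adele_component[OF q P']
    have eq: "(diag x \<oplus>\<^sub>\<A> q) P \<ominus>\<^bsub>completion P\<^esub> s P =
      (embed P x \<ominus>\<^bsub>completion P\<^esub> embed P (f P)) \<oplus>\<^bsub>completion P\<^esub>
      (embed P (f P) \<ominus>\<^bsub>completion P\<^esub> (s P \<ominus>\<^bsub>completion P\<^esub> q P))"
      unfolding comp[OF P'] using sP qP embed_closed[of x] embed_closed[of "f P"] by algebra
    have "completion_abs P ((diag x \<oplus>\<^sub>\<A> q) P \<ominus>\<^bsub>completion P\<^esub> s P) \<le>
      max (completion_abs P (embed P x \<ominus>\<^bsub>completion P\<^esub> embed P (f P)))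
      (completion_abs P (embed P (f P) \<ominus>\<^bsub>completion P\<^esub> (s P \<ominus>\<^bsub>completion P\<^esub> q P)))"
      unfolding eq using sP qP by (intro completion_abs_add) simp_all
    also have "\<dots> < \<epsilon>"
    proof -
      have "completion_abs P (embed P x \<ominus>\<^bsub>completion P\<^esub> embed P (f P)) < \<epsilon>"
        using x(1)[OF P] completion_abs_embed[of "x - f P"] by (simp only: embed_diff)
      then show ?thesis using f[OF P] by (simp only: max_less_iff_conj)
    qed
    finally show ?thesis .
  qed
  have "diag x \<oplus>\<^sub>\<A> q \<in> W"
  proof (rule nbhd[OF closed])
    show "completion_abs P ((diag x \<oplus>\<^sub>\<A> q) P \<ominus>\<^bsub>completion P\<^esub> s P) < \<epsilon>" if "P \<in> F" for P
      using close that by (simp add: G_def)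
    show "(diag x \<oplus>\<^sub>\<A> q) P \<in> completion_integers P" if P: "P \<in> primes - F" for P
    proof -
      have P': "P \<in> primes" using P by blast
      interpret number_field_prime P using P' by (rule local)
      show ?thesis
      proof (cases "P \<in> G")
        case True
        show ?thesis
          using completion_integers_if_close[OF adele_component[OF closed P'] sF[OF P]] close[OF True] \<epsilon>(2)
          by linarith
      next
        case False
        then have "q P \<in> completion_integers P" using P' by (simp add: G_def)
        moreover have "embed P x \<in> completion_integers P"
          using x(2)[of P] False P' by (simp add: completion_integers_def)
        ultimately show ?thesis unfolding comp[OF P'] by (simp add: completion_integers_add)
      qed
    qed
  qed
  then show ?thesis by (rule that)
qed

text \<open>The local balls for k at the constrained primes and at the poles of a are met
  simultaneously by strong approximation. The local units are glued to an integral unit, with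
  components of absolute value 1 at the other primes.\<close>

lemma diag_unit_mult_dense:
  assumes a: "a \<in> carrier \<A>" and W: "openin adele_top W" "b \<in> W"
    and sub: "zero_primes a \<subseteq> zero_primes b"
  obtains k u where "k \<noteq> 0" "u \<in> integral_adele_units" "diag k \<otimes>\<^sub>\<A> a \<otimes>\<^sub>\<A> u \<in> W"
proof -
  obtain F \<epsilon> where F: "finite F" "F \<subseteq> primes" and \<epsilon>: "\<epsilon> > 0" "\<epsilon> \<le> 1"
    and bF: "\<And>P. P \<in> primes - F \<Longrightarrow> b P \<in> completion_integers P"
    and nbhd: "\<And>c. c \<in> carrier \<A> \<Longrightarrow> (\<And>P. P \<in> F \<Longrightarrow> completion_abs P (c P \<ominus>\<^bsub>completion P\<^esub> b P) < \<epsilon>) \<Longrightarrow>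
      (\<And>P. P \<in> primes - F \<Longrightarrow> c P \<in> completion_integers P) \<Longrightarrow> c \<in> W"
    using adele_nbhd[OF W] by blast
  have b: "b \<in> carrier \<A>" using W openin_adele_top_carrier by blast
  \<comment> \<open>Outside G, k is only known to be integral, so the poles of a have to be handled
    inside G, by closeness to the component of b.\<close>
  define G where "G = F \<union> poles a"
  have G: "finite G" "G \<subseteq> primes" using F adele_finite[OF a] by (auto simp: G_def)
  have "\<exists>y \<delta>. \<delta> > 0 \<and> (\<forall>k. abs_val P (k - y) < \<delta> \<longrightarrow> k \<noteq> 0 \<and>
    (\<exists>u\<in>carrier (completion P). completion_abs P u = 1 \<and>
      completion_abs P (embed P k \<otimes>\<^bsub>completion P\<^esub> a P \<otimes>\<^bsub>completion P\<^esub> u \<ominus>\<^bsub>completion P\<^esub> b P) < \<epsilon>))"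
    if P: "P \<in> G" for P
  proof -
    have P': "P \<in> primes" using P G(2) by blast
    have "a P = \<zero>\<^bsub>completion P\<^esub> \<Longrightarrow> b P = \<zero>\<^bsub>completion P\<^esub>" using sub P' mem_zero_primes by blast
    then show ?thesis
      by (rule number_field_prime.completion_unit_approximation
          [OF local[OF P'] adele_component[OF a P'] adele_component[OF b P'] _ \<epsilon>(1)])
  qed
  then obtain y \<delta> where \<delta>: "\<And>P. P \<in> G \<Longrightarrow> \<delta> P > 0"
    and y: "\<And>P. P \<in> G \<Longrightarrow> \<forall>k. abs_val P (k - y P) < \<delta> P \<longrightarrow> k \<noteq> 0 \<and>
      (\<exists>u\<in>carrier (completion P). completion_abs P u = 1 \<and>
        completion_abs P (embed P k \<otimes>\<^bsub>completion P\<^esub> a P \<otimes>\<^bsub>completion P\<^esub> u \<ominus>\<^bsub>completion P\<^esub> b P) < \<epsilon>)"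
    by metis
  \<comment> \<open>Any single local condition forces k to be nonzero; when there is none, k = 1
    serves.\<close>
  have "\<exists>k. k \<noteq> 0 \<and> (\<forall>P\<in>G. abs_val P (k - y P) < \<delta> P) \<and> (\<forall>Q\<in>primes - G. abs_val Q k \<le> 1)"
  proof (cases "G = {}")
    case True
    have "abs_val Q 1 \<le> 1" if "Q \<in> primes" for Q :: "'k set"
      using number_field_prime.abs_val_1[OF local[OF that]] by simp
    then show ?thesis using True by (intro exI[of _ 1]) auto
  next
    case False
    define \<delta>' where "\<delta>' = Min (\<delta> ` G)"
    have "\<delta>' > 0" unfolding \<delta>'_def using G(1) False \<delta> by (subst Min_gr_iff) auto
    then obtain k where k: "\<And>P. P \<in> G \<Longrightarrow> abs_val P (k - y P) < \<delta>'" "\<And>Q. Q \<in> primes - G \<Longrightarrow> abs_val Q k \<le> 1"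
      using strong_approximation[OF nf G] by blast
    have "abs_val P (k - y P) < \<delta> P" if P: "P \<in> G" for P
    proof -
      have "\<delta>' \<le> \<delta> P" unfolding \<delta>'_def using G(1) P by (intro Min_le) auto
      then show ?thesis using k(1)[OF P] by linarith
    qed
    then show ?thesis using y k(2) False by blast
  qed
  then obtain k where k: "k \<noteq> 0" "\<And>P. P \<in> G \<Longrightarrow> abs_val P (k - y P) < \<delta> P"
    "\<And>Q. Q \<in> primes - G \<Longrightarrow> abs_val Q k \<le> 1" by blast
  have "\<exists>u\<in>carrier (completion P). completion_abs P u = 1 \<and> (P \<in> G \<longrightarrow>
      completion_abs P (embed P k \<otimes>\<^bsub>completion P\<^esub> a P \<otimes>\<^bsub>completion P\<^esub> u \<ominus>\<^bsub>completion P\<^esub> b P) < \<epsilon>)"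
    if P: "P \<in> primes" for P
  proof (cases "P \<in> G")
    case True
    then show ?thesis using y[OF True] k(2)[OF True] by blast
  next
    case False
    interpret number_field_prime P using P by (rule local)
    show ?thesis using False by (intro bexI[of _ "\<one>\<^bsub>completion P\<^esub>"]) simp_all
  qed
  then obtain f where f: "\<And>P. P \<in> primes \<Longrightarrow> f P \<in> carrier (completion P)"
    "\<And>P. P \<in> primes \<Longrightarrow> completion_abs P (f P) = 1"
    "\<And>P. P \<in> primes \<Longrightarrow> P \<in> G \<Longrightarrow>
      completion_abs P (embed P k \<otimes>\<^bsub>completion P\<^esub> a P \<otimes>\<^bsub>completion P\<^esub> f P \<ominus>\<^bsub>completion P\<^esub> b P) < \<epsilon>" by metis
  define u where "u = (\<lambda>P\<in>primes. f P)"
  have u: "u \<in> integral_adele_units" using f(1,2) by (intro adele_unitsI) (simp_all add: u_def)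
  define c where "c = diag k \<otimes>\<^sub>\<A> a \<otimes>\<^sub>\<A> u"
  have closed: "c \<in> carrier \<A>" using diag_closed a adele_units_closed(2)[OF u] by (simp add: c_def)
  have comp: "c P = embed P k \<otimes>\<^bsub>completion P\<^esub> a P \<otimes>\<^bsub>completion P\<^esub> f P" if "P \<in> primes" for P
    using that by (simp add: c_def adele_simps diag_def u_def)
  have close: "completion_abs P (c P \<ominus>\<^bsub>completion P\<^esub> b P) < \<epsilon>" if P: "P \<in> G" for P
  proof -
    have P': "P \<in> primes" using P G(2) by blast
    show ?thesis unfolding comp[OF P'] by (rule f(3)[OF P' P])
  qed
  have "c \<in> W"
  proof (rule nbhd[OF closed])
    show "completion_abs P (c P \<ominus>\<^bsub>completion P\<^esub> b P) < \<epsilon>" if "P \<in> F" for P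
      using close that by (simp add: G_def)
    show "c P \<in> completion_integers P" if P: "P \<in> primes - F" for P
    proof -
      have P': "P \<in> primes" using P by blast
      interpret number_field_prime P using P' by (rule local)
      show ?thesis
      proof (cases "P \<in> G")
        case True
        show ?thesis
          using completion_integers_if_close[OF adele_component[OF closed P'] bF[OF P]] close[OF True] \<epsilon>(2)
          by linarith
      next
        case False
        then have "a P \<in> completion_integers P" using P' by (simp add: G_def)
        moreover have "embed P k \<in> completion_integers P"
          using k(3)[of P] False P' by (simp add: completion_integers_def)
        moreover have "f P \<in> completion_integers P" using f(1,2)[OF P'] by (simp add: completion_integers_def)
        ultimately show ?thesis unfolding comp[OF P'] by (simp add: completion_integers_mult)
      qed
    qed
  qed
  then show ?thesis using that[OF k(1) u] by (simp add: c_def)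
qed

section \<open>Closures of orbits\<close>

lemma orbit_closure:
  assumes r: "r \<in> carrier \<A>" and a: "a \<in> carrier \<A>" and s: "s \<in> carrier \<A>" and b: "b \<in> carrier \<A>"
  shows "omega s b \<in> Omega_top closure_of affine_orbit r a \<longleftrightarrow>
    zero_primes a \<subseteq> zero_primes b"
proof
  assume cl: "omega s b \<in> Omega_top closure_of affine_orbit r a"
  show "zero_primes a \<subseteq> zero_primes b"
  proof (rule ccontr)
    assume "\<not> ?thesis"
    then obtain P where P: "P \<in> zero_primes a" "P \<notin> zero_primes b" by blast
    \<comment> \<open>This open set contains the class of (s, b) but misses the orbit, on which Z is
      constant.\<close>
    then have "openin Omega_top (nonvanishing {P})" by (intro openin_nonvanishing) (auto simp: mem_zero_primes)
    moreover have "omega s b \<in> nonvanishing {P}" using mem_nonvanishing[OF s b] P(2) by blast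
    ultimately obtain C where C: "C \<in> affine_orbit r a" "C \<in> nonvanishing {P}"
      using cl unfolding in_closure_of by blast
    then obtain x k where k: "k \<noteq> 0" "C = omega (diag x \<oplus>\<^sub>\<A> diag k \<otimes>\<^sub>\<A> r) (diag k \<otimes>\<^sub>\<A> a)"
      unfolding orbit_omega[OF r a] by blast
    have "zero_primes (diag k \<otimes>\<^sub>\<A> a) \<inter> {P} = {}"
      using C(2) mem_nonvanishing[of "diag x \<oplus>\<^sub>\<A> diag k \<otimes>\<^sub>\<A> r" "diag k \<otimes>\<^sub>\<A> a" "{P}"] diag_closed r a
      by (simp add: k(2))
    then show False using zero_primes_diag_mult[OF k(1) a] P(1) by blast
  qed
next
  assume sub: "zero_primes a \<subseteq> zero_primes b"
  show "omega s b \<in> Omega_top closure_of affine_orbit r a"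
    unfolding in_closure_of
  proof (intro conjI allI impI)
    show "omega s b \<in> topspace Omega_top" using s b by (auto simp: topspace_Omega_top)
    fix V assume V: "omega s b \<in> V \<and> openin Omega_top V"
    obtain M N where MN: "openin adele_top M" "openin adele_top N" "s \<in> M" "b \<in> N"
      "\<And>t c. t \<in> M \<Longrightarrow> c \<in> N \<Longrightarrow> omega t c \<in> V" using Omega_top_nbhd[OF _ _ s b] V by blast
    obtain k u where k: "k \<noteq> 0" and u: "u \<in> integral_adele_units" "diag k \<otimes>\<^sub>\<A> a \<otimes>\<^sub>\<A> u \<in> N"
      using diag_unit_mult_dense[OF a MN(2,4) sub] by blast
    have kr: "diag k \<otimes>\<^sub>\<A> r \<in> carrier \<A>" using diag_closed r by simp
    obtain x where x: "diag x \<oplus>\<^sub>\<A> diag k \<otimes>\<^sub>\<A> r \<in> M" using diag_add_dense[OF MN(1,3) kr] by blast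
    have "omega (diag x \<oplus>\<^sub>\<A> diag k \<otimes>\<^sub>\<A> r) (diag k \<otimes>\<^sub>\<A> a \<otimes>\<^sub>\<A> u) \<in> V" using MN(5) x u(2) by blast
    \<comment> \<open>The unit u was introduced to reach N; it drops out of the class, which leaves
      a point of the orbit.\<close>
    then have "omega (diag x \<oplus>\<^sub>\<A> diag k \<otimes>\<^sub>\<A> r) (diag k \<otimes>\<^sub>\<A> a) \<in> V"
      using omega_unit[OF _ _ u(1)] diag_closed kr a by simp
    then show "\<exists>C. C \<in> affine_orbit r a \<and> C \<in> V"
      unfolding orbit_omega[OF r a] using k by blast
  qed
qed

text \<open>Every point lies in the closure of its own orbit, so equal closures give both inclusions
  between the zero sets. Conversely, the description of a closure involves only the zero
  set.\<close>

lemma quasi_orbit_rel_iff: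
  assumes "r \<in> carrier \<A>" "a \<in> carrier \<A>" "s \<in> carrier \<A>" "b \<in> carrier \<A>"
  shows "(omega r a, omega s b) \<in> affine_quasi_orbit_rel \<longleftrightarrow>
    zero_primes a = zero_primes b"
proof
  assume "(omega r a, omega s b) \<in> affine_quasi_orbit_rel"
  then have "Omega_top closure_of affine_orbit r a =
    Omega_top closure_of affine_orbit s b" by (simp add: quasi_orbit_rel_def)
  then show "zero_primes a = zero_primes b"
    using orbit_closure[OF assms] orbit_closure[OF assms(1,2,1,2)]
      orbit_closure[OF assms(3,4,1,2)] orbit_closure[OF assms(3,4,3,4)] by auto
next
  assume eq: "zero_primes a = zero_primes b"
  have "C \<in> Omega_top closure_of affine_orbit r a \<longleftrightarrow>
    C \<in> Omega_top closure_of affine_orbit s b" for C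
  proof (cases "C \<in> topspace Omega_top")
    case True
    then obtain t c where "C = omega t c" "t \<in> carrier \<A>" "c \<in> carrier \<A>" by (auto simp: topspace_Omega_top)
    then show ?thesis using orbit_closure assms eq by simp
  next
    case False
    then show ?thesis by (simp add: in_closure_of)
  qed
  then show "(omega r a, omega s b) \<in> affine_quasi_orbit_rel"
    using assms by (auto simp: quasi_orbit_rel_def topspace_Omega_top)
qed

section \<open>Z as a quotient map and the induced homeomorphism\<close>

text \<open>The choice of representative is harmless since Z is constant on classes; on sets that
  are not classes the value is arbitrary.\<close>

definition class_zero_primes :: "('k adele \<times> 'k adele) set \<Rightarrow> 'k set set" where
  "class_zero_primes C = zero_primes (snd (SOME p. p \<in> carrier \<A> \<times> carrier \<A> \<and> C = omega (fst p) (snd p)))"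

lemma class_zero_primes_omega:
  assumes "r \<in> carrier \<A>" "a \<in> carrier \<A>"
  shows "class_zero_primes (omega r a) = zero_primes a"
proof -
  define p where "p = (SOME p. p \<in> carrier \<A> \<times> carrier \<A> \<and> omega r a = omega (fst p) (snd p))"
  have "(r, a) \<in> carrier \<A> \<times> carrier \<A> \<and> omega r a = omega (fst (r, a)) (snd (r, a))" using assms by simp
  then have "p \<in> carrier \<A> \<times> carrier \<A> \<and> omega r a = omega (fst p) (snd p)"
    unfolding p_def by (rule someI)
  then have p: "omega r a = omega (fst p) (snd p)" "fst p \<in> carrier \<A>" "snd p \<in> carrier \<A>"
    by (simp_all only: mem_Times_iff)
  have "zero_primes a = zero_primes (snd p)" by (rule zero_primes_omega[OF p(1) assms p(2,3)])
  then show ?thesis by (simp add: class_zero_primes_def p_def)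
qed

lemma topspace_power_cofinite_top: "topspace (power_cofinite_top A) = Pow A"
  by (auto simp: power_cofinite_top_def)

text \<open>Openness of Z before passing to classes. F collects the constrained primes at which b is
  nonzero. Off F a component may be set to 0, since \<open>U P\<close> is the ring of integers or
  contains b P = 0; and at every prime a nonzero value is available because zero is not
  isolated.\<close>

lemma adele_with_zero_primes:
  assumes b: "b \<in> carrier \<A>" and W: "openin adele_top W" "b \<in> W"
  obtains F where "finite F" "F \<subseteq> primes" "zero_primes b \<inter> F = {}"
    "\<forall>T\<subseteq>primes. T \<inter> F = {} \<longrightarrow> (\<exists>c\<in>W. zero_primes c = T)"
proof -
  obtain U where U: "\<And>P. P \<in> primes \<Longrightarrow> openin (completion_top P) (U P)"
    "finite (constrained U)" "b \<in> Pi\<^sub>E primes U" "Pi\<^sub>E primes U \<subseteq> W"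
    using adele_top_basic_nbhd[OF W] by blast
  define F where "F = constrained U - zero_primes b"
  have nz: "\<exists>d\<in>U P. d \<noteq> \<zero>\<^bsub>completion P\<^esub>" if P: "P \<in> primes" for P
  proof -
    interpret number_field_prime P using P by (rule local)
    have bP: "b P \<in> U P" using U(3) P by (simp add: PiE_iff)
    obtain e where "e \<in> U P" "e \<noteq> \<zero>\<^bsub>completion P\<^esub>"
      by (rule completion_small_nonzero[OF U(1)[OF P] bP])
    then show ?thesis by (rule bexI[rotated])
  qed
  then obtain d where d: "\<And>P. P \<in> primes \<Longrightarrow> d P \<in> U P" "\<And>P. P \<in> primes \<Longrightarrow> d P \<noteq> \<zero>\<^bsub>completion P\<^esub>" by metis
  have "\<exists>c\<in>W. zero_primes c = T" if T: "T \<subseteq> primes" "T \<inter> F = {}" for T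
  proof
    define c where "c = (\<lambda>P\<in>primes. if P \<in> T then \<zero>\<^bsub>completion P\<^esub> else d P)"
    show "zero_primes c = T" using T(1) d(2) by (auto simp: mem_zero_primes c_def split: if_splits)
    have "c P \<in> U P" if P: "P \<in> primes" for P
    proof (cases "P \<in> T")
      case True
      then have "P \<in> zero_primes b \<or> U P = completion_integers P" using T(2) P by (auto simp: F_def)
      then have "\<zero>\<^bsub>completion P\<^esub> \<in> U P"
      proof
        assume "P \<in> zero_primes b"
        then have "b P = \<zero>\<^bsub>completion P\<^esub>" by (simp add: mem_zero_primes)
        moreover have "b P \<in> U P" using U(3) P by (simp add: PiE_iff)
        ultimately show ?thesis by simp
      qed (simp add: number_field_prime.completion_integers_0_1(1)[OF local[OF P]])
      then show ?thesis using True P by (simp add: c_def)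
    qed (use d(1) P in \<open>simp add: c_def\<close>)
    then have "c \<in> Pi\<^sub>E primes U" by (simp add: PiE_iff c_def)
    then show "c \<in> W" using U(4) by blast
  qed
  then have "\<forall>T\<subseteq>primes. T \<inter> F = {} \<longrightarrow> (\<exists>c\<in>W. zero_primes c = T)" by blast
  moreover have "finite F" "F \<subseteq> primes" "zero_primes b \<inter> F = {}" using U(2) by (auto simp: F_def)
  ultimately show ?thesis by (intro that[of F])
qed

text \<open>An open continuous surjection is a quotient map. The preimage of a basic set U_F is
  \<open>nonvanishing F\<close>, and the image of an open set contains a basic set around each of
  its points.\<close>

lemma quotient_map_class_zero_primes:
  "quotient_map Omega_top (power_cofinite_top primes) class_zero_primes"
proof (rule continuous_open_imp_quotient_map)
  have zp: "class_zero_primes C \<subseteq> primes" if "C \<in> topspace Omega_top" for C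
    using that class_zero_primes_omega by (auto simp: topspace_Omega_top mem_zero_primes)
  show "continuous_map Omega_top (power_cofinite_top primes) class_zero_primes"
    unfolding power_cofinite_top_def continuous_on_generated_topo_iff
  proof (intro conjI allI impI)
    fix U assume "U \<in> {{T \<in> Pow primes. T \<inter> F = {}} | F. finite F \<and> F \<subseteq> primes}"
    then obtain F where F: "finite F" "F \<subseteq> primes" "U = {T \<in> Pow primes. T \<inter> F = {}}" by blast
    have "class_zero_primes -` U \<inter> topspace Omega_top = nonvanishing F"
    proof
      show "class_zero_primes -` U \<inter> topspace Omega_top \<subseteq> nonvanishing F"
      proof
        fix C assume C: "C \<in> class_zero_primes -` U \<inter> topspace Omega_top"
        then obtain r a where ra: "C = omega r a" "r \<in> carrier \<A>" "a \<in> carrier \<A>" by (auto simp: topspace_Omega_top)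
        then show "C \<in> nonvanishing F"
          using C F(3) class_zero_primes_omega[OF ra(2,3)] mem_nonvanishing[OF ra(2,3)] by simp
      qed
      show "nonvanishing F \<subseteq> class_zero_primes -` U \<inter> topspace Omega_top"
      proof
        fix C assume "C \<in> nonvanishing F"
        then obtain r a where ra: "C = omega r a" "r \<in> carrier \<A>" "a \<in> carrier \<A>" "zero_primes a \<inter> F = {}"
          by (auto simp: nonvanishing_def)
        then have "C \<in> topspace Omega_top" by (auto simp: topspace_Omega_top)
        then show "C \<in> class_zero_primes -` U \<inter> topspace Omega_top"
          using zp[of C] F(3) ra class_zero_primes_omega[OF ra(2,3)] by simp
      qed
    qed
    then show "openin Omega_top (class_zero_primes -` U \<inter> topspace Omega_top)"
      using openin_nonvanishing[OF F(1,2)] by simp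
  next
    have "class_zero_primes ` topspace Omega_top \<subseteq> Pow primes" using zp by (intro image_subsetI PowI)
    \<comment> \<open>The empty F yields the whole power set, so the generating sets cover the
      image.\<close>
    moreover have "Pow primes \<in> {{T \<in> Pow primes. T \<inter> F = {}} | F. finite F \<and> F \<subseteq> primes}"
      by (rule CollectI, rule exI[of _ "{}"]) auto
    ultimately show "class_zero_primes ` topspace Omega_top \<subseteq>
        \<Union> {{T \<in> Pow primes. T \<inter> F = {}} | F. finite F \<and> F \<subseteq> primes}"
      by (rule subset_trans[OF _ Union_upper])
  qed
  \<comment> \<open>Only the second component is moved inside the neighbourhood; the first stays at
    r.\<close>
  have op: "\<exists>F. finite F \<and> F \<subseteq> primes \<and> class_zero_primes C \<inter> F = {} \<and>
      {T \<in> Pow primes. T \<inter> F = {}} \<subseteq> class_zero_primes ` V"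
    if V: "openin Omega_top V" and C: "C \<in> V" for V C
  proof -
    obtain r a where ra: "C = omega r a" "r \<in> carrier \<A>" "a \<in> carrier \<A>"
      using openin_subset[OF V] C by (auto simp: topspace_Omega_top)
    obtain M N where MN: "openin adele_top M" "openin adele_top N" "r \<in> M" "a \<in> N"
      "\<And>t c. t \<in> M \<Longrightarrow> c \<in> N \<Longrightarrow> omega t c \<in> V" using Omega_top_nbhd[OF V _ ra(2,3)] C ra(1) by blast
    obtain F where F: "finite F" "F \<subseteq> primes" "zero_primes a \<inter> F = {}"
      "\<forall>T\<subseteq>primes. T \<inter> F = {} \<longrightarrow> (\<exists>c\<in>N. zero_primes c = T)"
      by (rule adele_with_zero_primes[OF ra(3) MN(2,4)])
    have "T \<in> class_zero_primes ` V" if T: "T \<subseteq> primes" "T \<inter> F = {}" for T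
    proof -
      obtain c where c: "c \<in> N" "zero_primes c = T" using F(4) T by blast
      then have "c \<in> carrier \<A>" using MN(2) openin_adele_top_carrier by blast
      then have "T = class_zero_primes (omega r c)" using class_zero_primes_omega[OF ra(2)] c(2) by simp
      then show ?thesis using MN(3,5) c(1) by blast
    qed
    then show ?thesis using F(1-3) class_zero_primes_omega[OF ra(2,3)] ra(1) by (intro exI[of _ F]) auto
  qed
  show "open_map Omega_top (power_cofinite_top primes) class_zero_primes"
    unfolding open_map_def
  proof (intro allI impI)
    fix V :: "('k adele \<times> 'k adele) set set" assume V: "openin Omega_top V"
    show "openin (power_cofinite_top primes) (class_zero_primes ` V)"
      unfolding openin_subopen[of _ "class_zero_primes ` V"]
    proof
      fix T assume "T \<in> class_zero_primes ` V"
      then obtain C where C: "C \<in> V" "T = class_zero_primes C" by blast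
      obtain F where F: "finite F" "F \<subseteq> primes" "class_zero_primes C \<inter> F = {}"
        "{T \<in> Pow primes. T \<inter> F = {}} \<subseteq> class_zero_primes ` V" using op[OF V C(1)] by blast
      have "openin (power_cofinite_top primes) {T \<in> Pow primes. T \<inter> F = {}}"
        unfolding power_cofinite_top_def using F(1,2) by (intro topology_generated_by_Basis) blast
      moreover have "T \<in> {T \<in> Pow primes. T \<inter> F = {}}"
        using F(3) C zp openin_subset[OF V] by blast
      ultimately show "\<exists>S. openin (power_cofinite_top primes) S \<and> T \<in> S \<and> S \<subseteq> class_zero_primes ` V"
        using F(4) by blast
    qed
  qed
  show "class_zero_primes ` topspace Omega_top = topspace (power_cofinite_top primes)"
  proof
    show "class_zero_primes ` topspace Omega_top \<subseteq> topspace (power_cofinite_top primes)"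
      using zp by (auto simp: topspace_power_cofinite_top)
    show "topspace (power_cofinite_top primes) \<subseteq> class_zero_primes ` topspace Omega_top"
    proof
      fix T assume "T \<in> topspace (power_cofinite_top primes)"
      then have T: "T \<subseteq> primes" by (simp add: topspace_power_cofinite_top)
      define c where "c = (\<lambda>P\<in>primes. if P \<in> T then \<zero>\<^bsub>completion P\<^esub> else \<one>\<^bsub>completion P\<^esub>)"
      have "c \<in> carrier \<A>"
        by (rule integral_adeles_closed)
          (auto simp: integral_adeles_iff c_def number_field_prime.completion_integers_0_1[OF local])
      moreover have "\<one>\<^bsub>completion P\<^esub> \<noteq> \<zero>\<^bsub>completion P\<^esub>" if P: "P \<in> primes" for P
      proof -
        interpret number_field_prime P using P by (rule local)
        show ?thesis using completion_abs_one completion_abs_zero by (metis zero_neq_one)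
      qed
      then have "zero_primes c = T" using T by (auto simp: mem_zero_primes c_def split: if_splits)
      ultimately have "T = class_zero_primes (omega \<zero>\<^sub>\<A> c)" "omega \<zero>\<^sub>\<A> c \<in> topspace Omega_top"
        using class_zero_primes_omega[of "\<zero>\<^sub>\<A>" c] by (auto simp: topspace_Omega_top)
      then show "T \<in> class_zero_primes ` topspace Omega_top" by blast
    qed
  qed
qed

text \<open>The composition of h with the projection to quasi-orbits is Z. As Z and the projection
  are quotient maps, so is h; it is injective because the quasi-orbit relation is the kernel of Z,
  and an injective quotient map is a homeomorphism.\<close>

lemma quasi_orbit_space_homeomorphic:
  fixes \<Omega> :: "('k adele \<times> 'k adele) set topology"
  defines "\<Omega> \<equiv> Omega_top"
  shows "\<exists>h. homeomorphic_map (quasi_orbit_space affine_group affine_action \<Omega>) (power_cofinite_top primes) h \<and>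
    (\<forall>r\<in>carrier \<A>. \<forall>a\<in>carrier \<A>.
      h (quasi_orbit_rel affine_group affine_action \<Omega> `` {omega r a}) = zero_primes a)"
proof -
  define Q where "Q = quasi_orbit_rel affine_group affine_action \<Omega>"
  \<comment> \<open>Any member of the quasi-orbit will do, because Z is constant on it.\<close>
  define h where "h X = class_zero_primes (SOME C. C \<in> X)" for X
  have Q_iff: "(C, D) \<in> Q \<longleftrightarrow> class_zero_primes C = class_zero_primes D"
    if CD: "C \<in> topspace \<Omega>" "D \<in> topspace \<Omega>" for C D
  proof -
    obtain r a where C: "C = omega r a" "r \<in> carrier \<A>" "a \<in> carrier \<A>"
      using CD(1) unfolding \<Omega>_def topspace_Omega_top by blast
    obtain s b where D: "D = omega s b" "s \<in> carrier \<A>" "b \<in> carrier \<A>"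
      using CD(2) unfolding \<Omega>_def topspace_Omega_top by blast
    show ?thesis
      unfolding Q_def \<Omega>_def C(1) D(1) class_zero_primes_omega[OF C(2,3)] class_zero_primes_omega[OF D(2,3)]
      by (rule quasi_orbit_rel_iff[OF C(2,3) D(2,3)])
  qed
  have Q_top: "D \<in> topspace \<Omega>" if "(C, D) \<in> Q" for C D
    using that by (simp add: Q_def quasi_orbit_rel_def)
  have h: "h (Q `` {C}) = class_zero_primes C" if C: "C \<in> topspace \<Omega>" for C
  proof -
    have "C \<in> Q `` {C}" using Q_iff[OF C C] by simp
    then have "(SOME D. D \<in> Q `` {C}) \<in> Q `` {C}" by (rule someI)
    then have some: "(C, SOME D. D \<in> Q `` {C}) \<in> Q" by (simp only: Image_singleton_iff)
    show ?thesis unfolding h_def using iffD1[OF Q_iff[OF C Q_top[OF some]] some] by (rule sym)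
  qed
  have q: "quotient_map \<Omega> (quasi_orbit_space affine_group affine_action \<Omega>) (\<lambda>C. Q `` {C})"
    unfolding quasi_orbit_space_def Q_def by (rule quotient_map_quotient_topology)
  have "quotient_map \<Omega> (power_cofinite_top primes) (h \<circ> (\<lambda>C. Q `` {C}))"
    using quotient_map_class_zero_primes unfolding \<Omega>_def[symmetric]
    by (rule quotient_map_eq) (simp add: h)
  then have "quotient_map (quasi_orbit_space affine_group affine_action \<Omega>) (power_cofinite_top primes) h"
    unfolding quotient_map_compose_eq[OF q] .
  moreover have "inj_on h (topspace (quasi_orbit_space affine_group affine_action \<Omega>))"
  proof (rule inj_onI)
    fix X Y assume X: "X \<in> topspace (quasi_orbit_space affine_group affine_action \<Omega>)"
      and Y: "Y \<in> topspace (quasi_orbit_space affine_group affine_action \<Omega>)" and eq: "h X = h Y"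
    obtain C where C: "C \<in> topspace \<Omega>" "X = Q `` {C}"
      using X unfolding quasi_orbit_space_def topspace_quotient_topology Q_def[symmetric] by (rule quotientE)
    obtain D where D: "D \<in> topspace \<Omega>" "Y = Q `` {D}"
      using Y unfolding quasi_orbit_space_def topspace_quotient_topology Q_def[symmetric] by (rule quotientE)
    have "(C, D) \<in> Q" using Q_iff[OF C(1) D(1)] h[OF C(1)] h[OF D(1)] eq C(2) D(2) by simp
    then show "X = Y" unfolding C(2) D(2) Q_def quasi_orbit_rel_def by auto
  qed
  ultimately have "homeomorphic_map (quasi_orbit_space affine_group affine_action \<Omega>) (power_cofinite_top primes) h"
    unfolding homeomorphic_map_def by blast
  moreover have "h (Q `` {omega r a}) = zero_primes a" if "r \<in> carrier \<A>" "a \<in> carrier \<A>" for r a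
  proof -
    have "omega r a \<in> topspace \<Omega>" using that unfolding \<Omega>_def topspace_Omega_top by blast
    then show ?thesis using h class_zero_primes_omega[OF that] by simp
  qed
  ultimately show ?thesis unfolding Q_def by blast
qed

end

theorem lemma3p2:
  assumes "number_field TYPE('k::field_char_0)"
  shows "\<exists>h :: ('k adele \<times> 'k adele) set set \<Rightarrow> 'k set set.
    homeomorphic_map
      (quasi_orbit_space affine_group affine_action (Omega_top :: ('k adele \<times> 'k adele) set topology))
      (power_cofinite_top prime_ideals) h \<and>
    (\<forall>r\<in>carrier finite_adeles. \<forall>a\<in>carrier finite_adeles.
      h (quasi_orbit_rel affine_group affine_action Omega_top `` {omega r a}) = zero_primes a)"
proof -
  interpret number_field_adeles "TYPE('k)" by unfold_locales (rule assms)
  show ?thesis by (rule quasi_orbit_space_homeomorphic)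
qed

end
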